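(* Let $\Delta(x,\hat x)=(x-\hat x)^2$, let the perception measure be $\phi(p_X,p_{\hat X})=\phi_{KL}(p_{\hat X}\|p_X)$, let $\mu_X\in\mathbb R$, $\sigma_X>0$, $R,R_c\ge0$ and $P\ge0$. Then $$\underline D(R,R_c,P|\mathcal N(\mu_X,\sigma_X^2))\le D(R,R_c,P|\mathcal N(\mu_X,\sigma_X^2))\le \overline D(R,R_c,P|\mathcal N(\mu_X,\sigma_X^2)),$$ where $$\overline D(R,R_c,P|\mathcal N(\mu_X,\sigma_X^2)):=\begin{cases}\sigma_X^2-\sigma_X^2\xi^2(R,R_c)&\text{if }\sigma(P)\le\sigma_X\xi(R,R_c),\\ \sigma_X^2+\sigma^2(P)-2\sigma_X\sigma(P)\xi(R,R_c)&\text{if }\sigma(P)>\sigma_X\xi(R,R_c),\end{cases}$$ $$\underline D(R,R_c,P|\mathcal N(\mu_X,\sigma_X^2)):=\min_{\sigma_{\hat X}\in[\sigma(P),\sigma_X]}\Big(\sigma_X^2+\sigma_{\hat X}^2-2\sigma_X\sigma_{\hat X}\sqrt{(1-e^{-2R})(1-e^{-2(R+R_c+P-\psi(\sigma_{\hat X}))})}\Big).$$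
   Context: All logarithms are natural. $\xi(R,R_c):=\sqrt{(1-e^{-2R})(1-e^{-2(R+R_c)})}$. For $\sigma\in(0,\sigma_X]$, $\psi(\sigma):=\log\frac{\sigma_X}{\sigma}+\frac{\sigma^2-\sigma_X^2}{2\sigma_X^2}$; $\psi$ is strictly decreasing on $(0,\sigma_X]$ with $\psi(\sigma)\to\infty$ as $\sigma\to0$ and $\psi(\sigma_X)=0$, and $\sigma(P)$ denotes the unique $\sigma\in(0,\sigma_X]$ with $\psi(\sigma)=P$. Kullback–Leibler divergence: $\phi_{KL}(q\|p):=\mathbb E_{Z\sim q}\big[\log\frac{q(Z)}{p(Z)}\big]$ for densities $q\ll p$, and $+\infty$ if $q$ is not absolutely continuous with respect to $p$. Rate-distortion-perception function $D(R,R_c,P|p_X)$: for a block length $n\ge1$, a code consists of finite sets $\mathcal J,\mathcal K$, a random seed $K$ uniform on $\mathcal K$ and independent of the source sequence $X^n=(X_1,\dots,X_n)$ (i.i.d. with marginal $p_X$), a stochastic encoder $p_{J|X^nK}$ producing $J\in\mathcal J$, and a stochastic decoder $p_{\hat X^n|JK}$ producing $\hat X^n\in\mathbb R^n$. A level $D$ is achievable subject to rate constraints $(R,R_c)$ and perception constraint $P$ if for some $n$ there is such a code with $\frac1n\log|\mathcal J|\le R$, $\frac1n\log|\mathcal K|\le R_c$, $\frac1n\sum_{t=1}^n\mathbb E[\Delta(X_t,\hat X_t)]\le D$, $\frac1n\sum_{t=1}^n\phi(p_{X_t},p_{\hat X_t})\le P$, and $\hat X_1,\dots,\hat X_n$ i.i.d.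 (with some marginal). $D(R,R_c,P|p_X)$ is the infimum of achievable $D$. *)

theory Defs
  imports "HOL-Probability.Probability"
begin

definition gauss :: "real \<Rightarrow> real \<Rightarrow> real measure" where
  "gauss mu s = density lborel (normal_density mu s)"

text \<open>Kullback-Leibler divergence KL(q || p) = E_q[log dq/dp] if q << p, else +infinity.
  If q << p but log(dq/dp) is not q-integrable (its negative part is always integrable),
  the expectation is +infinity.\<close>
definition KL_div :: "real measure \<Rightarrow> real measure \<Rightarrow> ereal" where
  "KL_div q p =
     (if absolutely_continuous p q then
        (if integrable q (\<lambda>z. ln (enn2real (RN_deriv p q z)))
         then ereal (\<integral>z. ln (enn2real (RN_deriv p q z)) \<partial>q)
         else \<infinity>)
      else \<infinity>)"

definition xi :: "real \<Rightarrow> real \<Rightarrow> real" where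
  "xi R Rc = sqrt ((1 - exp (-2 * R)) * (1 - exp (-2 * (R + Rc))))"

definition psi :: "real \<Rightarrow> real \<Rightarrow> real" where
  "psi sX s = ln (sX / s) + (s\<^sup>2 - sX\<^sup>2) / (2 * sX\<^sup>2)"

definition sigmaP :: "real \<Rightarrow> real \<Rightarrow> real" where
  "sigmaP sX P = (THE s. 0 < s \<and> s \<le> sX \<and> psi sX s = P)"

definition src_block :: "nat \<Rightarrow> real \<Rightarrow> real \<Rightarrow> (nat \<Rightarrow> real) measure" where
  "src_block n mu s = PiM {..<n} (\<lambda>_. gauss mu s)"

definition rec_space :: "nat \<Rightarrow> (nat \<Rightarrow> real) measure" where
  "rec_space n = PiM {..<n} (\<lambda>_. borel)"

text \<open>Joint law of (X^n, Xhat^n) induced by a code: seed K uniform on {..<L}, independent of X^n;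
  encoder enc x k a pmf on J = {..<M}; decoder dec j k a probability law on R^n.\<close>
definition code_joint ::
  "nat \<Rightarrow> real \<Rightarrow> real \<Rightarrow> nat \<Rightarrow> ((nat \<Rightarrow> real) \<Rightarrow> nat \<Rightarrow> nat pmf)
   \<Rightarrow> (nat \<Rightarrow> nat \<Rightarrow> (nat \<Rightarrow> real) measure) \<Rightarrow> ((nat \<Rightarrow> real) \<times> (nat \<Rightarrow> real)) measure" where
  "code_joint n mu s L enc dec =
     src_block n mu s \<bind> (\<lambda>x.
       measure_pmf (pmf_of_set {..<L}) \<bind> (\<lambda>k.
         measure_pmf (enc x k) \<bind> (\<lambda>j.
           distr (dec j k) (src_block n mu s \<Otimes>\<^sub>M rec_space n) (\<lambda>xh. (x, xh)))))"

definition valid_code ::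
  "nat \<Rightarrow> real \<Rightarrow> real \<Rightarrow> nat \<Rightarrow> nat \<Rightarrow> ((nat \<Rightarrow> real) \<Rightarrow> nat \<Rightarrow> nat pmf)
   \<Rightarrow> (nat \<Rightarrow> nat \<Rightarrow> (nat \<Rightarrow> real) measure) \<Rightarrow> bool" where
  "valid_code n mu s L M enc dec \<longleftrightarrow>
     1 \<le> n \<and> 1 \<le> L \<and> 1 \<le> M \<and>
     (\<forall>x k. set_pmf (enc x k) \<subseteq> {..<M}) \<and>
     (\<forall>k j. (\<lambda>x. pmf (enc x k) j) \<in> borel_measurable (src_block n mu s)) \<and>
     (\<forall>j k. prob_space (dec j k) \<and> sets (dec j k) = sets (rec_space n))"

definition achievable :: "real \<Rightarrow> real \<Rightarrow> real \<Rightarrow> real \<Rightarrow> real \<Rightarrow> real \<Rightarrow> bool" where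
  "achievable mu s R Rc P D \<longleftrightarrow>
     (\<exists>n L M enc dec. valid_code n mu s L M enc dec \<and>
        ln (real M) / real n \<le> R \<and> ln (real L) / real n \<le> Rc \<and>
        ereal (1 / real n) *
          enn2ereal (\<Sum>t<n. \<integral>\<^sup>+ z. ennreal ((fst z t - snd z t)\<^sup>2) \<partial>(code_joint n mu s L enc dec))
          \<le> ereal D \<and>
        ereal (1 / real n) *
          (\<Sum>t<n. KL_div (distr (code_joint n mu s L enc dec) borel (\<lambda>z. snd z t)) (gauss mu s))
          \<le> ereal P \<and>
        (\<exists>q. prob_space q \<and> sets q = sets (borel :: real measure) \<and>
           distr (code_joint n mu s L enc dec) (rec_space n) snd = PiM {..<n} (\<lambda>_. q)))"

definition D_RDP :: "real \<Rightarrow> real \<Rightarrow> real \<Rightarrow> real \<Rightarrow> real \<Rightarrow> real" where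
  "D_RDP R Rc P mu s = Inf {D. achievable mu s R Rc P D}"

definition D_upper :: "real \<Rightarrow> real \<Rightarrow> real \<Rightarrow> real \<Rightarrow> real" where
  "D_upper R Rc P sX =
     (if sigmaP sX P \<le> sX * xi R Rc then sX\<^sup>2 - sX\<^sup>2 * (xi R Rc)\<^sup>2
      else sX\<^sup>2 + (sigmaP sX P)\<^sup>2 - 2 * sX * sigmaP sX P * xi R Rc)"

definition D_lower :: "real \<Rightarrow> real \<Rightarrow> real \<Rightarrow> real \<Rightarrow> real" where
  "D_lower R Rc P sX =
     Inf ((\<lambda>s. sX\<^sup>2 + s\<^sup>2 - 2 * sX * s *
              sqrt ((1 - exp (-2 * R)) * (1 - exp (-2 * (R + Rc + P - psi sX s)))))
          ` {sigmaP sX P..sX})"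

end

theory Submission
  imports Defs
begin

text \<open>
  Lower bound. Given the pair \<open>i\<close> of message and seed, source and reproduction are independent, so the
  distortion is governed by the energies of the two conditional means. A Gibbs-type inequality with
  Gaussian test densities of a fixed variance shows that the conditional means of the source carry
  energy at most \<open>s\<^sup>2 (1 - exp (-2 R))\<close> per letter, and those of the reproduction, whose marginal has
  second moment \<open>\<sigma>\<^sup>2\<close> around \<open>mu\<close> and divergence at most \<open>P\<close>, at most
  \<open>\<sigma>\<^sup>2 (1 - exp (-2 (R + Rc + P - \<psi>(\<sigma>))))\<close>. The Cauchy-Schwarz inequality combines the two; a second
  moment above that of the source never helps.

  Upper bound. Let \<open>X\<close> and the reproduction be jointly Gaussian with a codeword \<open>U\<close>, conditionally
  independent given \<open>U\<close>, with squared correlations \<open>1 - exp (-2 r)\<close> and \<open>1 - exp (-2 (r + Rc))\<close> for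
  \<open>r < R\<close>. For a random codebook, soft covering makes both the source law (for each seed) and the
  reproduction law (over all seeds) approximately a uniform mixture over codewords. Capping the
  likelihood encoder and thinning the decoder leave a vanishing defect, which an independent draw
  from the missing part of the product law repairs exactly. Finally let \<open>r\<close> tend to \<open>R\<close>.
\<close>

section \<open>The joint law induced by a code\<close>

text \<open>The term \<open>P - psi s \<sigma>\<close> in the lower bound is the room left for a
  non-Gaussian reproduction: if a letter has second moment \<open>\<sigma>^2\<close> around
  \<open>mu\<close>, its divergence from N(mu, \<open>\<sigma>^2\<close>) equals its divergence from
  N(mu, \<open>s^2\<close>) minus \<open>psi s \<sigma>\<close>. The codes of the upper bound have
  Gaussian output, whose divergence is exactly \<open>psi s \<sigma>\<close>. The obstacle on the
  coding side is exactness. The reproduction letters must be i.i.d. at a finite block length and the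
  rate and perception constraints admit no slack, so an output law close in total variation is not
  enough and has to be repaired. Squared error is unbounded, so a repair of small probability may
  still be expensive; finite fourth moments of both Gaussian laws rule this out. The only slack is
  in the distortion, because \<open>D_RDP\<close> is an infimum: it suffices to achieve every level
  strictly above the bound. This slack pays for the repair and, through continuity of
  \<open>xi\<close>, for using correlations of a rate below \<open>R\<close>.\<close>

lemma sets_gauss [simp, measurable_cong]: "sets (gauss m s) = sets borel"
  by (simp add: gauss_def)

lemma space_gauss [simp]: "space (gauss m s) = UNIV"
  by (simp add: gauss_def)

lemma prob_space_gauss: "0 < s \<Longrightarrow> prob_space (gauss m s)"
  unfolding gauss_def by (rule prob_space_normal_density)

lemma sets_rec_space_eq_PiM:
  assumes "sets q = sets (borel :: real measure)"
  shows "sets (PiM {..<n} (\<lambda>_. q)) = sets (rec_space n)"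
  unfolding rec_space_def by (intro sets_PiM_cong) (auto simp: assms)

lemma sets_src_block [simp, measurable_cong]: "sets (src_block n mu s) = sets (rec_space n)"
  unfolding src_block_def by (rule sets_rec_space_eq_PiM) simp

lemma space_src_block [simp]: "space (src_block n mu s) = space (rec_space n)"
  by (rule sets_eq_imp_space_eq) simp

lemma measurable_rec_space_component:
  "t < n \<Longrightarrow> (\<lambda>x. x t) \<in> borel_measurable (rec_space n)"
  unfolding rec_space_def by (rule measurable_component_singleton) simp

lemma prob_space_src_block: "0 < s \<Longrightarrow> prob_space (src_block n mu s)"
  unfolding src_block_def by (intro prob_space_PiM prob_space_gauss)

lemma nn_integral_PiM_component:
  assumes "prob_space N" "i \<in> I" "h \<in> borel_measurable N"
  shows "(\<integral>\<^sup>+c. h (c i) \<partial>PiM I (\<lambda>_. N)) = (\<integral>\<^sup>+u. h u \<partial>N)"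
proof -
  have "distr (PiM I (\<lambda>_. N)) N (\<lambda>c. c i) = N"
    using assms by (intro distr_PiM_component) auto
  then show ?thesis
    using nn_integral_distr[of "\<lambda>c. c i" "PiM I (\<lambda>_. N)" N h] assms by simp
qed

lemma nn_integral_block_component:
  assumes "0 < s" "t < n" "h \<in> borel_measurable borel"
  shows "(\<integral>\<^sup>+x. h (x t) \<partial>src_block n mu s) = (\<integral>\<^sup>+x. h x \<partial>gauss mu s)"
  unfolding src_block_def using assms
  by (intro nn_integral_PiM_component prob_space_gauss) (auto simp: measurable_cong_sets[OF sets_gauss refl])

locale coding_scheme =
  fixes n L M :: nat and mu s :: real
    and enc :: "(nat \<Rightarrow> real) \<Rightarrow> nat \<Rightarrow> nat pmf"
    and dec :: "nat \<Rightarrow> nat \<Rightarrow> (nat \<Rightarrow> real) measure"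
  assumes valid: "valid_code n mu s L M enc dec" and s_pos: "0 < s"
begin

lemma n_pos: "0 < n" and L_pos: "0 < L" and M_pos: "0 < M"
  and enc_subset: "set_pmf (enc x k) \<subseteq> {..<M}"
  and pmf_enc_measurable: "(\<lambda>x. pmf (enc x k) j) \<in> borel_measurable (rec_space n)"
  and prob_dec: "prob_space (dec j k)"
  and sets_dec: "sets (dec j k) = sets (rec_space n)"
  using valid by (auto simp: valid_code_def measurable_cong_sets[OF sets_src_block refl])

lemma distr_dec:
  assumes x: "x \<in> space (rec_space n)"
  shows "distr (dec j k) (src_block n mu s \<Otimes>\<^sub>M rec_space n) (\<lambda>y. (x, y))
    \<in> space (subprob_algebra (src_block n mu s \<Otimes>\<^sub>M rec_space n))"
    (is "?D \<in> space (subprob_algebra ?N)")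
proof -
  have m: "(\<lambda>y. (x, y)) \<in> measurable (dec j k) ?N"
    using x by (subst measurable_cong_sets[OF sets_dec refl]) (simp add: measurable_Pair1')
  then have "prob_space ?D"
    using prob_dec prob_space.prob_space_distr by blast
  then show ?thesis
    by (simp add: space_subprob_algebra prob_space_imp_subprob_space)
qed

lemma nn_integral_measure_pmf_lessThan:
  fixes M' :: nat
  assumes "set_pmf p \<subseteq> {..<M'}"
  shows "(\<integral>\<^sup>+j. h j \<partial>measure_pmf p) = (\<Sum>j<M'. ennreal (pmf p j) * h j)"
  using assms
  by (subst nn_integral_measure_pmf_support[of "{..<M'}"]) (auto simp: mult.commute)

definition seed_kernel :: "(nat \<Rightarrow> real) \<Rightarrow> nat \<Rightarrow> ((nat \<Rightarrow> real) \<times> (nat \<Rightarrow> real)) measure" where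
  "seed_kernel x k = measure_pmf (enc x k) \<bind> (\<lambda>j.
           distr (dec j k) (src_block n mu s \<Otimes>\<^sub>M rec_space n) (\<lambda>xh. (x, xh)))"

definition code_kernel :: "(nat \<Rightarrow> real) \<Rightarrow> ((nat \<Rightarrow> real) \<times> (nat \<Rightarrow> real)) measure" where
  "code_kernel x = measure_pmf (pmf_of_set {..<L}) \<bind> seed_kernel x"

lemma code_joint_eq_bind: "code_joint n mu s L enc dec = src_block n mu s \<bind> code_kernel"
  by (simp add: code_joint_def code_kernel_def[abs_def] seed_kernel_def[abs_def])

lemma subprob_bind_pmf:
  assumes "\<And>i. f i \<in> space (subprob_algebra N)"
  shows "measure_pmf p \<bind> f \<in> space (subprob_algebra N)"
proof -
  have "f \<in> measurable (measure_pmf p) (subprob_algebra N)"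
    using assms by simp
  then show ?thesis
    using assms unfolding space_subprob_algebra
    by (intro CollectI conjI subprob_space_bind[where N=N] measure_pmf.subprob_space_axioms
        sets_bind[where N=N]) auto
qed

lemma seed_kernel_subprob:
  assumes "x \<in> space (rec_space n)"
  shows "seed_kernel x k \<in> space (subprob_algebra (src_block n mu s \<Otimes>\<^sub>M rec_space n))"
  unfolding seed_kernel_def by (rule subprob_bind_pmf) (rule distr_dec[OF assms])

lemma code_kernel_subprob:
  assumes "x \<in> space (rec_space n)"
  shows "code_kernel x \<in> space (subprob_algebra (src_block n mu s \<Otimes>\<^sub>M rec_space n))"
  unfolding code_kernel_def by (rule subprob_bind_pmf) (rule seed_kernel_subprob[OF assms])

lemma nn_integral_code_kernel:
  assumes x: "x \<in> space (rec_space n)"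
    and h [measurable]: "h \<in> borel_measurable (rec_space n \<Otimes>\<^sub>M rec_space n)"
  shows "(\<integral>\<^sup>+z. h z \<partial>code_kernel x) =
    (\<Sum>k<L. \<Sum>j<M. ennreal (pmf (enc x k) j / L) * (\<integral>\<^sup>+y. h (x, y) \<partial>dec j k))"
proof -
  let ?N = "src_block n mu s \<Otimes>\<^sub>M rec_space n"
  have h': "h \<in> borel_measurable ?N"
    by measurable
  have i: "(\<integral>\<^sup>+z. h z \<partial>seed_kernel x k) = (\<Sum>j<M. ennreal (pmf (enc x k) j) * (\<integral>\<^sup>+y. h (x, y) \<partial>dec j k))" for k
  proof -
    have "(\<integral>\<^sup>+z. h z \<partial>seed_kernel x k) = (\<integral>\<^sup>+j. (\<integral>\<^sup>+z. h z \<partial>distr (dec j k) ?N (\<lambda>xh. (x, xh))) \<partial>measure_pmf (enc x k))"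
      unfolding seed_kernel_def using distr_dec[OF x] by (intro nn_integral_bind[OF h']) simp
    also have "\<dots> = (\<integral>\<^sup>+j. (\<integral>\<^sup>+y. h (x, y) \<partial>dec j k) \<partial>measure_pmf (enc x k))"
    proof (intro nn_integral_cong)
      fix j
      have "(\<lambda>y. (x, y)) \<in> measurable (dec j k) ?N"
        using x by (subst measurable_cong_sets[OF sets_dec refl]) (simp add: measurable_Pair1')
      then show "(\<integral>\<^sup>+z. h z \<partial>distr (dec j k) ?N (\<lambda>xh. (x, xh))) = (\<integral>\<^sup>+y. h (x, y) \<partial>dec j k)"
        using h' by (simp add: nn_integral_distr)
    qed
    finally show ?thesis
      by (simp add: nn_integral_measure_pmf_lessThan[OF enc_subset])
  qed
  have "(\<integral>\<^sup>+z. h z \<partial>code_kernel x) = (\<integral>\<^sup>+k. (\<integral>\<^sup>+z. h z \<partial>seed_kernel x k) \<partial>measure_pmf (pmf_of_set {..<L}))"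
    unfolding code_kernel_def using seed_kernel_subprob[OF x] by (intro nn_integral_bind[OF h']) simp
  also have "\<dots> = (\<Sum>k<L. ennreal (1 / L) * (\<integral>\<^sup>+z. h z \<partial>seed_kernel x k))"
    using L_pos by (subst nn_integral_measure_pmf_lessThan[of _ L])
      (auto simp: set_pmf_of_set lessThan_empty_iff pmf_of_set intro!: sum.cong)
  also have "\<dots> = (\<Sum>k<L. \<Sum>j<M. ennreal (pmf (enc x k) j / L) * (\<integral>\<^sup>+y. h (x, y) \<partial>dec j k))"
    by (intro sum.cong refl) (simp add: i sum_distrib_left ennreal_mult[symmetric] mult.assoc[symmetric])
  finally show ?thesis .
qed

lemma measurable_nn_integral_dec:
  assumes [measurable]: "h \<in> borel_measurable (rec_space n \<Otimes>\<^sub>M rec_space n)"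
  shows "(\<lambda>x. \<integral>\<^sup>+y. h (x, y) \<partial>dec j k) \<in> borel_measurable (rec_space n)"
proof -
  interpret prob_space "dec j k" by (rule prob_dec)
  have [measurable_cong]: "sets (dec j k) = sets (rec_space n)" by (rule sets_dec)
  show ?thesis by measurable
qed

text \<open>Required by \<open>nn_integral_bind\<close>. The decoder laws do not depend on the
  source block, so the block enters only through the encoder probabilities and the sections of the
  event.\<close>

lemma measurable_code_kernel [measurable]:
  "code_kernel \<in> measurable (src_block n mu s) (subprob_algebra (src_block n mu s \<Otimes>\<^sub>M rec_space n))"
proof (rule measurable_subprob_algebra)
  let ?N = "src_block n mu s \<Otimes>\<^sub>M rec_space n"
  fix x assume "x \<in> space (src_block n mu s)"
  then show "subprob_space (code_kernel x)" "sets (code_kernel x) = sets ?N"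
    using code_kernel_subprob by (auto simp: space_subprob_algebra)
next
  let ?N = "src_block n mu s \<Otimes>\<^sub>M rec_space n"
  fix A assume A: "A \<in> sets ?N"
  then have A' [measurable]: "A \<in> sets (rec_space n \<Otimes>\<^sub>M rec_space n)"
    by (simp cong: sets_pair_measure_cong)
  have [measurable]: "indicator A \<in> borel_measurable (rec_space n \<Otimes>\<^sub>M rec_space n)"
    by simp
  have [measurable]: "(\<lambda>x. \<integral>\<^sup>+y. indicator A (x, y) \<partial>dec j k) \<in> borel_measurable (rec_space n)" for j k
    by (rule measurable_nn_integral_dec) simp
  note pmf_enc_measurable [measurable]
  have eq: "emeasure (code_kernel x) A =
    (\<Sum>k<L. \<Sum>j<M. ennreal (pmf (enc x k) j / L) * (\<integral>\<^sup>+y. indicator A (x, y) \<partial>dec j k))"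
    if "x \<in> space (src_block n mu s)" for x
  proof -
    have "A \<in> sets (code_kernel x)"
      using code_kernel_subprob[of x] that A by (auto simp: space_subprob_algebra)
    then have "emeasure (code_kernel x) A = (\<integral>\<^sup>+z. indicator A z \<partial>code_kernel x)"
      by simp
    also have "\<dots> = (\<Sum>k<L. \<Sum>j<M. ennreal (pmf (enc x k) j / L) * (\<integral>\<^sup>+y. indicator A (x, y) \<partial>dec j k))"
      using that by (intro nn_integral_code_kernel) auto
    finally show ?thesis .
  qed
  show "(\<lambda>x. emeasure (code_kernel x) A) \<in> borel_measurable (src_block n mu s)"
    by (subst measurable_cong[OF eq]) (assumption, measurable)
qed

lemma sets_code_joint: "sets (code_joint n mu s L enc dec) = sets (rec_space n \<Otimes>\<^sub>M rec_space n)"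
proof -
  interpret prob_space "src_block n mu s" by (rule prob_space_src_block[OF s_pos])
  have "sets (code_joint n mu s L enc dec) = sets (src_block n mu s \<Otimes>\<^sub>M rec_space n)"
    unfolding code_joint_eq_bind using not_empty
    by (intro sets_bind[OF sets_kernel[OF measurable_code_kernel]]) auto
  then show ?thesis by (simp cong: sets_pair_measure_cong)
qed

text \<open>The working form of the nested binds: finite sums over seed and message inside one
  integral over the source.\<close>

lemma nn_integral_code_joint:
  assumes h [measurable]: "h \<in> borel_measurable (rec_space n \<Otimes>\<^sub>M rec_space n)"
  shows "(\<integral>\<^sup>+z. h z \<partial>code_joint n mu s L enc dec) =
    (\<integral>\<^sup>+x. (\<Sum>k<L. \<Sum>j<M. ennreal (pmf (enc x k) j / L) * (\<integral>\<^sup>+y. h (x, y) \<partial>dec j k)) \<partial>src_block n mu s)"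
proof -
  have h': "h \<in> borel_measurable (src_block n mu s \<Otimes>\<^sub>M rec_space n)"
    by measurable
  have "(\<integral>\<^sup>+z. h z \<partial>code_joint n mu s L enc dec) = (\<integral>\<^sup>+x. \<integral>\<^sup>+z. h z \<partial>code_kernel x \<partial>src_block n mu s)"
    unfolding code_joint_eq_bind by (rule nn_integral_bind[OF h' measurable_code_kernel])
  also have "\<dots> = (\<integral>\<^sup>+x. (\<Sum>k<L. \<Sum>j<M. ennreal (pmf (enc x k) j / L) * (\<integral>\<^sup>+y. h (x, y) \<partial>dec j k)) \<partial>src_block n mu s)"
    by (intro nn_integral_cong nn_integral_code_kernel) auto
  finally show ?thesis .
qed

lemma nn_integral_code_joint_sum:
  assumes h [measurable]: "h \<in> borel_measurable (rec_space n \<Otimes>\<^sub>M rec_space n)"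
  shows "(\<integral>\<^sup>+z. h z \<partial>code_joint n mu s L enc dec) =
    (\<Sum>k<L. \<Sum>j<M. \<integral>\<^sup>+x. ennreal (pmf (enc x k) j / L) * (\<integral>\<^sup>+y. h (x, y) \<partial>dec j k) \<partial>src_block n mu s)"
proof -
  note measurable_nn_integral_dec[OF h, measurable] pmf_enc_measurable [measurable]
  have m [measurable]: "(\<lambda>x. ennreal (pmf (enc x k) j / L) * (\<integral>\<^sup>+y. h (x, y) \<partial>dec j k))
      \<in> borel_measurable (src_block n mu s)" for j k
    by measurable
  show ?thesis
    by (simp add: nn_integral_code_joint[OF h] nn_integral_sum)
qed

end

section \<open>A variational bound for finite decompositions of a product law\<close>

text \<open>Integrate \<open>e\<^sup>y \<ge> 1 + y\<close> at \<open>y = F i - ln (c * card I)\<close> against \<open>\<mu> i\<close> and sum.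
  With \<open>\<mu> i\<close> the part of \<open>q\<close> belonging to message \<open>i\<close>, this bounds a mutual information by a rate
  without introducing entropies: \<open>c = 1/L\<close> gives \<open>ln M\<close> on the source side, \<open>c = 1\<close> gives
  \<open>ln (L M)\<close> on the reproduction side.\<close>

lemma variational_bound:
  fixes q :: "'a measure" and \<mu> :: "'i \<Rightarrow> 'a measure" and F :: "'i \<Rightarrow> 'a \<Rightarrow> real"
  assumes I: "finite I" "I \<noteq> {}" and c: "0 < c"
    and sets: "\<And>i. i \<in> I \<Longrightarrow> sets (\<mu> i) = sets q"
    and dom: "\<And>i h. i \<in> I \<Longrightarrow> h \<in> borel_measurable q \<Longrightarrow> (\<integral>\<^sup>+x. h x \<partial>\<mu> i) \<le> ennreal c * (\<integral>\<^sup>+x. h x \<partial>q)"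
    and fin: "\<And>i. i \<in> I \<Longrightarrow> finite_measure (\<mu> i)"
    and mass: "(\<Sum>i\<in>I. measure (\<mu> i) (space (\<mu> i))) = 1"
    and int: "\<And>i. i \<in> I \<Longrightarrow> integrable (\<mu> i) (F i)"
    and exp_le: "\<And>i. i \<in> I \<Longrightarrow> (\<integral>\<^sup>+x. ennreal (exp (F i x)) \<partial>q) \<le> 1"
  shows "(\<Sum>i\<in>I. \<integral>x. F i x \<partial>\<mu> i) \<le> ln (c * card I)"
proof -
  define N where "N = real (card I)"
  have N: "0 < N" using I by (simp add: N_def card_gt_0_iff)
  have "(\<integral>x. F i x \<partial>\<mu> i) \<le> (ln (c * N) - 1) * measure (\<mu> i) (space (\<mu> i)) + 1 / N" if i: "i \<in> I" for i
  proof -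
    interpret finite_measure "\<mu> i" by (rule fin[OF i])
    have Fm [measurable]: "F i \<in> borel_measurable (\<mu> i)" using int[OF i] by simp
    then have Fq [measurable]: "F i \<in> borel_measurable q"
      by (simp add: measurable_cong_sets[OF sets[OF i] refl])
    have e: "(\<integral>\<^sup>+x. ennreal (exp (F i x)) \<partial>\<mu> i) \<le> ennreal c"
    proof -
      have "(\<integral>\<^sup>+x. ennreal (exp (F i x)) \<partial>\<mu> i) \<le> ennreal c * (\<integral>\<^sup>+x. ennreal (exp (F i x)) \<partial>q)"
        by (rule dom[OF i]) measurable
      also have "\<dots> \<le> ennreal c * 1" by (intro mult_left_mono exp_le[OF i]) auto
      finally show ?thesis by simp
    qed
    have ie: "integrable (\<mu> i) (\<lambda>x. exp (F i x))"
      by (rule integrableI_nonneg) (use e in \<open>auto intro: le_less_trans\<close>)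
    have ee: "(\<integral>x. exp (F i x) \<partial>\<mu> i) \<le> c"
      using e c by (subst (asm) nn_integral_eq_integral[OF ie]) auto
    have "(\<integral>x. F i x \<partial>\<mu> i) \<le> (\<integral>x. (ln (c * N) - 1) + exp (F i x) / (c * N) \<partial>\<mu> i)"
    proof (rule integral_mono[OF int[OF i]])
      show "integrable (\<mu> i) (\<lambda>x. (ln (c * N) - 1) + exp (F i x) / (c * N))"
        using ie by simp
      fix x
      have "1 + (F i x - ln (c * N)) \<le> exp (F i x - ln (c * N))" by (rule exp_ge_add_one_self)
      also have "\<dots> = exp (F i x) / (c * N)" using c N by (simp add: exp_diff)
      finally show "F i x \<le> (ln (c * N) - 1) + exp (F i x) / (c * N)" by simp
    qed
    also have "\<dots> = (ln (c * N) - 1) * measure (\<mu> i) (space (\<mu> i)) + (\<integral>x. exp (F i x) \<partial>\<mu> i) / (c * N)"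
      using ie by (subst Bochner_Integration.integral_add) auto
    also have "(\<integral>x. exp (F i x) \<partial>\<mu> i) / (c * N) \<le> c / (c * N)"
      using ee c N by (intro divide_right_mono) auto
    also have "c / (c * N) = 1 / N" using c by simp
    finally show ?thesis by simp
  qed
  then have "(\<Sum>i\<in>I. \<integral>x. F i x \<partial>\<mu> i) \<le> (\<Sum>i\<in>I. (ln (c * N) - 1) * measure (\<mu> i) (space (\<mu> i)) + 1 / N)"
    by (rule sum_mono)
  also have "\<dots> = ln (c * N)"
    using N by (simp add: sum.distrib sum_distrib_left[symmetric] mass N_def[symmetric])
  finally show ?thesis by (simp add: N_def)
qed

text \<open>Log-density of \<open>N(m, v)\<close> relative to \<open>q\<close>, where \<open>q\<close> is only given through its density
  relative to \<open>N(mu, s\<^sup>2)\<close>.\<close>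

definition llr :: "real measure \<Rightarrow> real \<Rightarrow> real \<Rightarrow> real \<Rightarrow> real \<Rightarrow> real \<Rightarrow> real" where
  "llr q mu s v m y = ln (s\<^sup>2 / v) / 2 - (y - m)\<^sup>2 / (2 * v) + (y - mu)\<^sup>2 / (2 * s\<^sup>2)
     - ln (enn2real (RN_deriv (gauss mu s) q y))"

locale KL_bounded = prob_space q for q :: "real measure" +
  fixes mu s P :: real
  assumes s_pos: "0 < s" and sets_q: "sets q = sets borel"
    and KL_le: "KL_div q (gauss mu s) \<le> ereal P"
    and square_integrable: "integrable q (\<lambda>y. (y - mu)\<^sup>2)"
begin

declare sets_q [measurable_cong]

definition "snd_moment = (\<integral>y. (y - mu)\<^sup>2 \<partial>q)"

lemma ac: "absolutely_continuous (gauss mu s) q"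
  and integrable_ln_RN: "integrable q (\<lambda>z. ln (enn2real (RN_deriv (gauss mu s) q z)))"
  and integral_ln_RN: "(\<integral>z. ln (enn2real (RN_deriv (gauss mu s) q z)) \<partial>q) \<le> P"
  using KL_le by (auto simp: KL_div_def split: if_splits)

lemma measurable_llr [measurable]: "llr q mu s v m \<in> borel_measurable borel"
  using borel_measurable_RN_deriv[of "gauss mu s" q] unfolding llr_def[abs_def] by measurable

lemma integrable_linear: "integrable q (\<lambda>y. y - mu)"
  by (rule square_integrable_imp_integrable) (use square_integrable in auto)

lemma integrable_centered: "integrable q (\<lambda>y. (y - m)\<^sup>2)"
proof -
  have "(\<lambda>y. (y - m)\<^sup>2) = (\<lambda>y. (y - mu)\<^sup>2 + 2 * (mu - m) * (y - mu) + (mu - m)\<^sup>2)"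
    by (auto simp: power2_eq_square algebra_simps)
  then show ?thesis using square_integrable integrable_linear by simp
qed

lemma integrable_llr: "integrable q (llr q mu s v m)"
  unfolding llr_def[abs_def] using integrable_centered integrable_ln_RN by simp

text \<open>Where \<open>q\<close> has positive density, \<open>exp (llr q mu s v m y)\<close> is
  the ratio of the N(m, v) density to that of \<open>q\<close>, so its integral is the N(m, v)-mass
  of that set. It can be below 1 because \<open>q\<close> may vanish where N(m, v) does not.\<close>

lemma nn_integral_exp_llr:
  assumes v: "0 < v"
  shows "(\<integral>\<^sup>+y. ennreal (exp (llr q mu s v m y)) \<partial>q) \<le> 1"
proof -
  interpret g: prob_space "gauss mu s" by (rule prob_space_gauss[OF s_pos])
  let ?r = "RN_deriv (gauss mu s) q"
  let ?a = "\<lambda>y. ln (s\<^sup>2 / v) / 2 - (y - m)\<^sup>2 / (2 * v) + (y - mu)\<^sup>2 / (2 * s\<^sup>2)"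
  have dens: "density (gauss mu s) ?r = q"
    by (rule g.density_RN_deriv[OF ac]) (simp add: sets_q)
  have fin: "AE y in gauss mu s. ?r y \<noteq> \<infinity>"
    by (rule g.RN_deriv_finite[OF sigma_finite_measure_axioms ac]) (simp add: sets_q)
  have "(\<integral>\<^sup>+y. ennreal (exp (llr q mu s v m y)) \<partial>q)
      = (\<integral>\<^sup>+y. ?r y * ennreal (exp (llr q mu s v m y)) \<partial>gauss mu s)"
    by (subst (1) dens[symmetric], subst nn_integral_density) auto
  also have "\<dots> \<le> (\<integral>\<^sup>+y. ennreal (exp (?a y)) \<partial>gauss mu s)"
  proof (rule nn_integral_mono_AE)
    show "AE y in gauss mu s. ?r y * ennreal (exp (llr q mu s v m y)) \<le> ennreal (exp (?a y))"
      using fin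
    proof eventually_elim
      case (elim y)
      then obtain r where r: "0 \<le> r" "?r y = ennreal r" by (cases "?r y") auto
      show ?case
      \<comment> \<open>At \<open>r = 0\<close> the convention \<open>ln 0 = 0\<close> makes
        \<open>llr\<close> meaningless as a log-ratio, but the factor \<open>r\<close> removes the
        point.\<close>
      proof (cases "r = 0")
        case False
        then have "r * exp (llr q mu s v m y) = exp (?a y)"
          using r by (simp add: llr_def exp_diff)
        then show ?thesis using r by (simp add: ennreal_mult'[symmetric])
      qed (simp add: r)
    qed
  qed
  also have "\<dots> = (\<integral>\<^sup>+y. ennreal (normal_density m (sqrt v) y) \<partial>lborel)"
    unfolding gauss_def
  proof (subst nn_integral_density, simp, simp, intro nn_integral_cong)
    fix y
    have "exp (ln (s\<^sup>2 / v) / 2) = s / sqrt v"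
      using s_pos v by (simp add: ln_sqrt[symmetric] real_sqrt_divide)
    then have 1: "exp (?a y) = s / sqrt v * exp (- ((y - m)\<^sup>2 / (2 * v))) * exp ((y - mu)\<^sup>2 / (2 * s\<^sup>2))"
      by (simp only: exp_diff exp_add exp_minus divide_inverse)
    have 2: "exp (- ((y - mu)\<^sup>2 / (2 * s\<^sup>2))) * exp ((y - mu)\<^sup>2 / (2 * s\<^sup>2)) = 1"
      by (simp add: exp_minus)
    have 3: "normal_density mu s y = exp (- ((y - mu)\<^sup>2 / (2 * s\<^sup>2))) / (sqrt (2 * pi) * s)"
      "normal_density m (sqrt v) y = exp (- ((y - m)\<^sup>2 / (2 * v))) / (sqrt (2 * pi) * sqrt v)"
      using s_pos v by (simp_all add: normal_density_def real_sqrt_mult)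
    have 4: "e1 / (p * s) * (s / w * e2 * e3) = (e1 * e3) * (e2 / (p * w))" for e1 e2 e3 p w :: real
      using s_pos by simp
    have "normal_density mu s y * exp (?a y) = normal_density m (sqrt v) y"
      unfolding 1 3 4 2 by simp
    then show "ennreal (normal_density mu s y) * ennreal (exp (?a y)) = ennreal (normal_density m (sqrt v) y)"
      by (simp add: ennreal_mult'[symmetric])
  qed
  also have "\<dots> = 1"
    using v by (subst nn_integral_eq_integral) auto
  finally show ?thesis .
qed

lemma integral_llr:
  "(\<integral>y. llr q mu s v m y \<partial>q) \<ge> ln (s\<^sup>2 / v) / 2 - (\<integral>y. (y - m)\<^sup>2 \<partial>q) / (2 * v) + snd_moment / (2 * s\<^sup>2) - P"
  unfolding llr_def[abs_def] snd_moment_def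
  using integrable_centered integrable_ln_RN integral_ln_RN prob_space by simp

text \<open>With a single index, \<open>variational_bound\<close> is Gibbs' inequality: the
  divergence of \<open>q\<close> from N(mu, v) is nonnegative for every \<open>v\<close>. Taking
  \<open>v\<close> equal to the second moment gives the bound on \<open>psi\<close>; a small
  \<open>v\<close> excludes a vanishing second moment. The second moment may exceed
  \<open>s^2\<close>, so \<open>psi\<close> is also evaluated beyond \<open>s\<close>.\<close>

lemma snd_moment_pos: "0 < snd_moment"
  and psi_snd_moment: "psi s (sqrt snd_moment) \<le> P"
proof -
  have *: "ln (s\<^sup>2 / v) / 2 - snd_moment / (2 * v) + snd_moment / (2 * s\<^sup>2) \<le> P" if v: "0 < v" for v
  proof -
    have "(\<Sum>i\<in>{()}. \<integral>y. llr q mu s v mu y \<partial>q) \<le> ln (1 * real (card {()}))"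
      by (rule variational_bound[where q=q])
        (use v nn_integral_exp_llr integrable_llr prob_space in \<open>auto intro: finite_measure_axioms\<close>)
    then show ?thesis using integral_llr[of v mu] by (simp add: snd_moment_def)
  qed
  have nonneg: "0 \<le> snd_moment" unfolding snd_moment_def by simp
  show pos: "0 < snd_moment"
  proof (rule ccontr)
    assume "\<not> 0 < snd_moment"
    then have "snd_moment = 0" using nonneg by simp
    \<comment> \<open>At second moment zero the left side of \<open>*\<close> is half of this
      logarithm; the chosen variance makes it \<open>P + 1\<close>.\<close>
    moreover have "ln (s\<^sup>2 / (s\<^sup>2 * exp (- 2 * P - 2))) = 2 * P + 2"
      using s_pos ln_div[of "s\<^sup>2" "s\<^sup>2 * exp (- 2 * P - 2)"] ln_mult[of "s\<^sup>2" "exp (- 2 * P - 2)"] by simp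
    ultimately show False using *[of "s\<^sup>2 * exp (- 2 * P - 2)"] s_pos by simp
  qed
  have "ln (s / sqrt snd_moment) = ln (s\<^sup>2 / snd_moment) / 2"
    using pos s_pos by (simp add: ln_div ln_sqrt ln_realpow)
  then show "psi s (sqrt snd_moment) \<le> P"
    using *[OF pos] pos s_pos by (simp add: psi_def diff_divide_distrib)
qed

end

section \<open>Decompositions of an i.i.d. block law\<close>

locale decomposition = KL_bounded q mu s P for q mu s P +
  fixes n :: nat and I :: "'i set" and \<mu> :: "'i \<Rightarrow> (nat \<Rightarrow> real) measure" and c :: real
  assumes n_pos: "0 < n" and I: "finite I" "I \<noteq> {}" and c_pos: "0 < c"
    and sets_\<mu>: "\<And>i. i \<in> I \<Longrightarrow> sets (\<mu> i) = sets (rec_space n)"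
    and dom: "\<And>i h. i \<in> I \<Longrightarrow> h \<in> borel_measurable (rec_space n) \<Longrightarrow>
        (\<integral>\<^sup>+x. h x \<partial>\<mu> i) \<le> ennreal c * (\<integral>\<^sup>+x. h x \<partial>PiM {..<n} (\<lambda>_. q))"
    and sum_\<mu>: "\<And>h. h \<in> borel_measurable (rec_space n) \<Longrightarrow>
        (\<Sum>i\<in>I. \<integral>\<^sup>+x. h x \<partial>\<mu> i) = (\<integral>\<^sup>+x. h x \<partial>PiM {..<n} (\<lambda>_. q))"
begin

abbreviation "qn \<equiv> PiM {..<n} (\<lambda>_. q)"

lemma sets_qn [simp, measurable_cong]: "sets qn = sets (rec_space n)"
  by (rule sets_rec_space_eq_PiM[OF sets_q])

sublocale qn: prob_space qn
  by (intro prob_space_PiM) (rule prob_space_axioms)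

lemma finite_\<mu>: "i \<in> I \<Longrightarrow> finite_measure (\<mu> i)"
proof (rule finite_measureI)
  assume i: "i \<in> I"
  have "(\<integral>\<^sup>+x. 1 \<partial>\<mu> i) \<le> ennreal c * (\<integral>\<^sup>+x. 1 \<partial>qn)" by (rule dom[OF i]) simp
  then show "emeasure (\<mu> i) (space (\<mu> i)) \<noteq> \<infinity>" by (auto simp: qn.emeasure_space_1 top_unique)
qed

text \<open>Domination by \<open>c\<close> times the block law transfers integrability, so the parts
  have moments whatever the encoder and decoder are.\<close>

lemma integrable_\<mu>:
  fixes h :: "_ \<Rightarrow> real"
  assumes i: "i \<in> I" and h: "integrable qn h"
  shows "integrable (\<mu> i) h"
proof (rule integrableI_bounded)
  have m: "h \<in> borel_measurable (rec_space n)"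
    using borel_measurable_integrable[OF h] by (simp add: measurable_cong_sets[OF sets_qn refl])
  then show "h \<in> borel_measurable (\<mu> i)" by (simp add: measurable_cong_sets[OF sets_\<mu>[OF i] refl])
  have "(\<integral>\<^sup>+x. ennreal (norm (h x)) \<partial>\<mu> i) \<le> ennreal c * (\<integral>\<^sup>+x. ennreal (norm (h x)) \<partial>qn)"
    using m by (intro dom[OF i]) measurable
  also have "\<dots> < \<infinity>"
    using h by (simp add: integrable_iff_bounded ennreal_mult_less_top)
  finally show "(\<integral>\<^sup>+x. ennreal (norm (h x)) \<partial>\<mu> i) < \<infinity>" .
qed

lemma sum_integral_\<mu>:
  fixes h :: "_ \<Rightarrow> real"
  assumes h: "integrable qn h"
  shows "(\<Sum>i\<in>I. \<integral>x. h x \<partial>\<mu> i) = (\<integral>x. h x \<partial>qn)"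
proof -
  have nonneg: "(\<Sum>i\<in>I. \<integral>x. g x \<partial>\<mu> i) = (\<integral>x. g x \<partial>qn)"
    if g: "integrable qn g" "\<And>x. 0 \<le> g x" for g :: "_ \<Rightarrow> real"
  proof -
    have m: "g \<in> borel_measurable (rec_space n)"
      using borel_measurable_integrable[OF g(1)] by (simp add: measurable_cong_sets[OF sets_qn refl])
    have "ennreal (\<Sum>i\<in>I. \<integral>x. g x \<partial>\<mu> i) = (\<Sum>i\<in>I. \<integral>\<^sup>+x. ennreal (g x) \<partial>\<mu> i)"
      using g by (subst sum_ennreal[symmetric]) (auto simp: nn_integral_eq_integral integrable_\<mu>)
    also have "\<dots> = (\<integral>\<^sup>+x. ennreal (g x) \<partial>qn)" using m by (intro sum_\<mu>) simp
    also have "\<dots> = ennreal (\<integral>x. g x \<partial>qn)" using g by (simp add: nn_integral_eq_integral)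
    finally show ?thesis using g(2) by (subst (asm) ennreal_inj) (auto intro!: sum_nonneg)
  qed
  have h1: "integrable qn (\<lambda>x. max 0 (h x))" and h2: "integrable qn (\<lambda>x. max 0 (- h x))"
    using h by auto
  have eq: "h = (\<lambda>x. max 0 (h x) - max 0 (- h x))" by (auto simp: max_def)
  have "(\<Sum>i\<in>I. \<integral>x. h x \<partial>\<mu> i) = (\<Sum>i\<in>I. (\<integral>x. max 0 (h x) \<partial>\<mu> i) - (\<integral>x. max 0 (- h x) \<partial>\<mu> i))"
    by (subst (1) eq, intro sum.cong refl Bochner_Integration.integral_diff integrable_\<mu> h1 h2)
  also have "\<dots> = (\<integral>x. h x \<partial>qn)"
    by (subst (3) eq) (simp add: sum_subtractf nonneg h1 h2)
  finally show ?thesis .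
qed

lemma mass_\<mu>: "(\<Sum>i\<in>I. measure (\<mu> i) (space (\<mu> i))) = 1"
  using sum_integral_\<mu>[of "\<lambda>_. 1"] by (simp add: qn.prob_space)

lemma integrable_component:
  fixes h :: "real \<Rightarrow> real"
  assumes "t < n" "integrable q h"
  shows "integrable qn (\<lambda>x. h (x t))" "(\<integral>x. h (x t) \<partial>qn) = (\<integral>y. h y \<partial>q)"
proof -
  have d: "distr qn q (\<lambda>x. x t) = q"
    using assms(1) by (intro distr_PiM_component prob_space_axioms) auto
  have m: "(\<lambda>x. x t) \<in> measurable qn q" using assms(1) by simp
  show "integrable qn (\<lambda>x. h (x t))"
    using integrable_distr_eq[OF m, of h] assms d by auto
  show "(\<integral>x. h (x t) \<partial>qn) = (\<integral>y. h y \<partial>q)"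
    using integral_distr[OF m, of h] assms d by auto
qed

text \<open>The test functions are log-likelihood ratios of product Gaussians with one common
  variance and means that depend on index and letter. Since the letters are i.i.d. under
  \<open>q\<close>, the exponential moment factorizes, and each factor is at most 1. The means stay
  free until \<open>conditional_mean_energy\<close>.\<close>

lemma block_bound:
  assumes v: "0 < v"
  shows "n * (ln (s\<^sup>2 / v) / 2 + snd_moment / (2 * s\<^sup>2) - P)
    - (\<Sum>t<n. \<Sum>i\<in>I. \<integral>x. (x t - m i t)\<^sup>2 \<partial>\<mu> i) / (2 * v) \<le> ln (c * card I)"
proof -
  define F where "F = (\<lambda>i (x :: nat \<Rightarrow> real). \<Sum>t<n. llr q mu s v (m i t) (x t))"
  have int1: "integrable qn (\<lambda>x. llr q mu s v m' (x t))" if "t < n" for m' t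
    using integrable_component(1)[OF that integrable_llr] .
  interpret P: product_sigma_finite "\<lambda>_::nat. q"
    by (simp add: product_sigma_finite_def sigma_finite_measure_axioms)
  have "(\<Sum>i\<in>I. \<integral>x. F i x \<partial>\<mu> i) \<le> ln (c * card I)"
  proof (rule variational_bound[where q=qn])
    fix i assume i: "i \<in> I"
    show "integrable (\<mu> i) (F i)" unfolding F_def
      by (intro Bochner_Integration.integrable_sum integrable_\<mu>[OF i] int1) auto
    have "(\<integral>\<^sup>+x. ennreal (exp (F i x)) \<partial>qn) = (\<integral>\<^sup>+x. (\<Prod>t<n. ennreal (exp (llr q mu s v (m i t) (x t)))) \<partial>qn)"
      by (simp add: F_def exp_sum prod_ennreal)
    also have "\<dots> = (\<Prod>t<n. \<integral>\<^sup>+y. ennreal (exp (llr q mu s v (m i t) y)) \<partial>q)"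
      by (rule P.product_nn_integral_prod) auto
    also have "\<dots> \<le> 1" using nn_integral_exp_llr[OF v] by (intro prod_le_1) auto
    finally show "(\<integral>\<^sup>+x. ennreal (exp (F i x)) \<partial>qn) \<le> 1" .
  next
    fix i and h :: "(nat \<Rightarrow> real) \<Rightarrow> ennreal"
    assume "i \<in> I" "h \<in> borel_measurable qn"
    then show "(\<integral>\<^sup>+x. h x \<partial>\<mu> i) \<le> ennreal c * (\<integral>\<^sup>+x. h x \<partial>qn)"
      by (intro dom) (auto simp: measurable_cong_sets[OF sets_qn refl])
  qed (use I c_pos sets_\<mu> finite_\<mu> mass_\<mu> in auto)
  moreover have "(\<Sum>i\<in>I. \<integral>x. F i x \<partial>\<mu> i) =
      (\<Sum>t<n. \<Sum>i\<in>I. \<integral>x. llr q mu s v (m i t) (x t) \<partial>\<mu> i)"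
    unfolding F_def
    by (subst sum.swap) (intro sum.cong refl Bochner_Integration.integral_sum integrable_\<mu> int1; simp)
  moreover have "(\<Sum>i\<in>I. \<integral>x. llr q mu s v (m i t) (x t) \<partial>\<mu> i) \<ge>
      ln (s\<^sup>2 / v) / 2 + snd_moment / (2 * s\<^sup>2) - P - (\<Sum>i\<in>I. \<integral>x. (x t - m i t)\<^sup>2 \<partial>\<mu> i) / (2 * v)"
    if t: "t < n" for t
  proof -
    \<comment> \<open>\<open>?B\<close> is the part of \<open>llr\<close> that does not involve the
      mean. Summed over \<open>I\<close> it becomes an integral against \<open>q\<close>, and only
      the squared deviations from \<open>m i t\<close> still depend on the index.\<close>
    let ?B = "\<lambda>y. llr q mu s v mu y + (y - mu)\<^sup>2 / (2 * v)"
    have B: "integrable q ?B" using integrable_llr square_integrable by simp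
    have c: "integrable qn (\<lambda>x. (x t - m i t)\<^sup>2)" for i
      using integrable_component(1)[OF t integrable_centered] .
    have "(\<Sum>i\<in>I. \<integral>x. llr q mu s v (m i t) (x t) \<partial>\<mu> i) =
      (\<Sum>i\<in>I. (\<integral>x. ?B (x t) \<partial>\<mu> i) - (\<integral>x. (x t - m i t)\<^sup>2 / (2 * v) \<partial>\<mu> i))"
    proof (intro sum.cong refl)
      fix i assume i: "i \<in> I"
      show "(\<integral>x. llr q mu s v (m i t) (x t) \<partial>\<mu> i) = (\<integral>x. ?B (x t) \<partial>\<mu> i) - (\<integral>x. (x t - m i t)\<^sup>2 / (2 * v) \<partial>\<mu> i)"
      proof (subst Bochner_Integration.integral_diff[symmetric])
        show "integrable (\<mu> i) (\<lambda>x. ?B (x t))"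
          by (rule integrable_\<mu>[OF i integrable_component(1)[OF t B]])
        show "integrable (\<mu> i) (\<lambda>x. (x t - m i t)\<^sup>2 / (2 * v))"
          using integrable_\<mu>[OF i c] by simp
      qed (auto simp: llr_def intro!: Bochner_Integration.integral_cong)
    qed
    also have "\<dots> = (\<Sum>i\<in>I. \<integral>x. ?B (x t) \<partial>\<mu> i) - (\<Sum>i\<in>I. \<integral>x. (x t - m i t)\<^sup>2 \<partial>\<mu> i) / (2 * v)"
      by (simp add: sum_subtractf sum_divide_distrib)
    also have "(\<Sum>i\<in>I. \<integral>x. ?B (x t) \<partial>\<mu> i) = (\<integral>y. ?B y \<partial>q)"
      using sum_integral_\<mu>[OF integrable_component(1)[OF t B]] integrable_component(2)[OF t B] by simp
    finally have "(\<Sum>i\<in>I. \<integral>x. llr q mu s v (m i t) (x t) \<partial>\<mu> i) =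
      (\<integral>y. ?B y \<partial>q) - (\<Sum>i\<in>I. \<integral>x. (x t - m i t)\<^sup>2 \<partial>\<mu> i) / (2 * v)" .
    moreover have "(\<integral>y. ?B y \<partial>q) \<ge> ln (s\<^sup>2 / v) / 2 + snd_moment / (2 * s\<^sup>2) - P"
    proof -
      have "(\<integral>y. ?B y \<partial>q) = (\<integral>y. llr q mu s v mu y \<partial>q) + (\<integral>y. (y - mu)\<^sup>2 \<partial>q) / (2 * v)"
        using integrable_llr square_integrable by simp
      then show ?thesis using integral_llr[of v mu] by simp
    qed
    ultimately show ?thesis by linarith
  qed
  then have "(\<Sum>t<n. ln (s\<^sup>2 / v) / 2 + snd_moment / (2 * s\<^sup>2) - P - (\<Sum>i\<in>I. \<integral>x. (x t - m i t)\<^sup>2 \<partial>\<mu> i) / (2 * v))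
     \<le> (\<Sum>t<n. \<Sum>i\<in>I. \<integral>x. llr q mu s v (m i t) (x t) \<partial>\<mu> i)"
    by (intro sum_mono) auto
  ultimately show ?thesis
    by (simp add: sum_subtractf sum_divide_distrib)
qed

text \<open>Unnormalized: division by the mass of \<open>\<mu> i\<close> gives the moments around
  \<open>mu\<close> conditional on index \<open>i\<close>.\<close>

definition "first i t = (\<integral>x. x t - mu \<partial>\<mu> i)"

definition "second i t = (\<integral>x. (x t - mu)\<^sup>2 \<partial>\<mu> i)"

lemma integrable_moments:
  assumes "i \<in> I" "t < n"
  shows "integrable (\<mu> i) (\<lambda>x. x t - mu)" "integrable (\<mu> i) (\<lambda>x. (x t - mu)\<^sup>2)"
  using integrable_component(1)[OF assms(2) integrable_linear]
    integrable_component(1)[OF assms(2) square_integrable]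
  by (auto intro: integrable_\<mu>[OF assms(1)])

lemma sum_second: "t < n \<Longrightarrow> (\<Sum>i\<in>I. second i t) = snd_moment"
  unfolding second_def snd_moment_def
  using integrable_component[OF _ square_integrable] by (simp add: sum_integral_\<mu>)

text \<open>The variance \<open>v\<close> makes the first term of \<open>block_bound\<close> equal to \<open>n (\<rho> + 1/2)\<close>;
  using one \<open>v\<close> for all coordinates makes a separate single-letterization superfluous.\<close>

lemma conditional_mean_energy:
  fixes \<rho> :: real
  assumes \<rho>: "ln (c * card I) \<le> n * \<rho>"
  shows "(\<Sum>t<n. \<Sum>i\<in>I. (first i t)\<^sup>2 / measure (\<mu> i) (space (\<mu> i))) \<le>
    n * (snd_moment - s\<^sup>2 * exp (snd_moment / s\<^sup>2 - 1 - 2 * P - 2 * \<rho>))"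
proof -
  define v where "v = s\<^sup>2 * exp (snd_moment / s\<^sup>2 - 1 - 2 * P - 2 * \<rho>)"
  have v: "0 < v" using s_pos by (simp add: v_def)
  define E where "E = (\<Sum>t<n. \<Sum>i\<in>I. (first i t)\<^sup>2 / measure (\<mu> i) (space (\<mu> i)))"
  \<comment> \<open>The conditional means minimize the quadratic terms of
    \<open>block_bound\<close>. At mass zero the quotient is 0 by convention, which is harmless
    because all integrals over that part vanish.\<close>
  define m where "m = (\<lambda>i t. mu + first i t / measure (\<mu> i) (space (\<mu> i)))"
  have "ln (s\<^sup>2 / v) = ln (s\<^sup>2) - ln v"
    using s_pos v by (simp add: ln_div)
  also have "ln v = ln (s\<^sup>2) + (snd_moment / s\<^sup>2 - 1 - 2 * P - 2 * \<rho>)"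
    using s_pos unfolding v_def by (subst ln_mult) simp_all
  finally have lnv: "ln (s\<^sup>2 / v) = - (snd_moment / s\<^sup>2 - 1 - 2 * P - 2 * \<rho>)" by simp
  have centered: "(a - (mu + b))\<^sup>2 = (a - mu)\<^sup>2 - 2 * b * (a - mu) + b\<^sup>2" for a b :: real
    by (simp add: power2_eq_square algebra_simps)
  have "(\<integral>x. (x t - m i t)\<^sup>2 \<partial>\<mu> i) = second i t - (first i t)\<^sup>2 / measure (\<mu> i) (space (\<mu> i))"
    if i: "i \<in> I" and t: "t < n" for i t
  proof -
    interpret finite_measure "\<mu> i" by (rule finite_\<mu>[OF i])
    let ?c = "first i t / measure (\<mu> i) (space (\<mu> i))"
    have eq: "(\<lambda>x. (x t - m i t)\<^sup>2) = (\<lambda>x. (x t - mu)\<^sup>2 - 2 * ?c * (x t - mu) + ?c\<^sup>2)"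
      using centered[of _ ?c] unfolding m_def by (simp add: fun_eq_iff)
    have centered: "(a - (mu + b))\<^sup>2 = (a - mu)\<^sup>2 - 2 * b * (a - mu) + b\<^sup>2" for a b :: real
    by (simp add: power2_eq_square algebra_simps)
  have "(\<integral>x. (x t - m i t)\<^sup>2 \<partial>\<mu> i) = second i t - 2 * ?c * first i t + ?c\<^sup>2 * measure (\<mu> i) (space (\<mu> i))"
      unfolding eq second_def first_def[symmetric] using integrable_moments[OF i t] by (simp add: first_def)
    then show ?thesis
      by (cases "measure (\<mu> i) (space (\<mu> i)) = 0") (simp_all add: power2_eq_square)
  qed
  then have "(\<Sum>t<n. \<Sum>i\<in>I. \<integral>x. (x t - m i t)\<^sup>2 \<partial>\<mu> i) = n * snd_moment - E"
    using sum_second by (simp add: sum_subtractf E_def)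
  then have "n * (ln (s\<^sup>2 / v) / 2 + snd_moment / (2 * s\<^sup>2) - P) - (n * snd_moment - E) / (2 * v) \<le> n * \<rho>"
    using block_bound[OF v, of m] \<rho> by simp
  then have "n * (1 / 2) \<le> (n * snd_moment - E) / (2 * v)"
    unfolding lnv by (simp add: algebra_simps diff_divide_distrib add_divide_distrib)
  then have "n * v \<le> n * snd_moment - E"
    using v by (simp add: field_simps)
  then show ?thesis unfolding E_def[symmetric] v_def[symmetric] by (simp add: algebra_simps)
qed

end

section \<open>The converse\<close>

lemma gauss_moments:
  assumes "0 < s"
  shows "has_bochner_integral (gauss mu s) (\<lambda>x. (x - mu)\<^sup>2) (s\<^sup>2)"
    "has_bochner_integral (gauss mu s) (\<lambda>x. (x - mu) ^ 4) (3 * s ^ 4)"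
proof -
  have 1: "fact (2 * 1) / ((2 / s\<^sup>2) ^ 1 * fact 1) = s\<^sup>2"
    "fact (2 * 2) / ((2 / s\<^sup>2) ^ 2 * fact 2) = 3 * s ^ 4"
    by (simp_all add: power_divide fact_numeral power_mult[symmetric])
  have 2: "has_bochner_integral (gauss mu s) (\<lambda>x. (x - mu) ^ (2 * k)) (fact (2 * k) / ((2 / s\<^sup>2) ^ k * fact k))" for k
    unfolding gauss_def using normal_moment_even[OF assms, of mu k]
    by (intro has_bochner_integral_density) auto
  show "has_bochner_integral (gauss mu s) (\<lambda>x. (x - mu)\<^sup>2) (s\<^sup>2)"
    "has_bochner_integral (gauss mu s) (\<lambda>x. (x - mu) ^ 4) (3 * s ^ 4)"
    using 2[of 1] 2[of 2] unfolding 1 by simp_all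
qed

text \<open>The quotient of the two normal densities is the Radon-Nikodym derivative only almost
  everywhere under the reference law; absolute continuity moves this to the law under which the
  logarithm is integrated. Its mean follows from the second moment alone.\<close>

lemma KL_div_gauss:
  assumes s: "0 < s" and s': "0 < s'"
  shows "KL_div (gauss mu s') (gauss mu s) = ereal (psi s s')"
proof -
  interpret g: prob_space "gauss mu s" by (rule prob_space_gauss[OF s])
  interpret g': prob_space "gauss mu s'" by (rule prob_space_gauss[OF s'])
  let ?f = "\<lambda>x. normal_density mu s' x / normal_density mu s x"
  have dens: "density (gauss mu s) (\<lambda>x. ennreal (?f x)) = gauss mu s'"
    unfolding gauss_def
    by (subst density_density_eq)
      (auto simp: ennreal_mult[symmetric] normal_density_pos[OF s] less_imp_neq[symmetric] intro!: density_cong)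
  have ac: "absolutely_continuous (gauss mu s) (gauss mu s')"
    using absolutely_continuousI_density[of "\<lambda>x. ennreal (?f x)" "gauss mu s"] by (simp add: dens)
  have "AE x in gauss mu s. ennreal (?f x) = RN_deriv (gauss mu s) (gauss mu s') x"
    by (rule g.RN_deriv_unique[OF _ dens]) simp
  then have "AE x in gauss mu s'. ennreal (?f x) = RN_deriv (gauss mu s) (gauss mu s') x"
    by (rule absolutely_continuous_AE[rotated, OF ac]) simp
  then have eq: "AE x in gauss mu s'. ln (enn2real (RN_deriv (gauss mu s) (gauss mu s') x)) =
      ln (s / s') - (x - mu)\<^sup>2 / (2 * s'\<^sup>2) + (x - mu)\<^sup>2 / (2 * s\<^sup>2)"
  proof eventually_elim
    case (elim x)
    have "ln (?f x) = ln (s / s') - (x - mu)\<^sup>2 / (2 * s'\<^sup>2) + (x - mu)\<^sup>2 / (2 * s\<^sup>2)"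
      using s s' by (simp add: normal_density_def ln_div ln_mult ln_sqrt ln_realpow real_sqrt_mult)
    then show ?case by (simp add: elim[symmetric])
  qed
  have "has_bochner_integral (gauss mu s')
      (\<lambda>x. ln (s / s') - (x - mu)\<^sup>2 / (2 * s'\<^sup>2) + (x - mu)\<^sup>2 / (2 * s\<^sup>2))
      (ln (s / s') - s'\<^sup>2 / (2 * s'\<^sup>2) + s'\<^sup>2 / (2 * s\<^sup>2))"
    using gauss_moments(1)[OF s', of mu]
    by (intro has_bochner_integral_add has_bochner_integral_diff has_bochner_integral_divide)
      (auto simp: has_bochner_integral_iff g'.prob_space[simplified])
  also have "ln (s / s') - s'\<^sup>2 / (2 * s'\<^sup>2) + s'\<^sup>2 / (2 * s\<^sup>2) = psi s s'"
    using s s' by (simp add: psi_def field_simps)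
  finally have "has_bochner_integral (gauss mu s')
      (\<lambda>x. ln (enn2real (RN_deriv (gauss mu s) (gauss mu s') x))) (psi s s')"
    using borel_measurable_RN_deriv[of "gauss mu s" "gauss mu s'"]
    by (subst has_bochner_integral_cong_AE[OF _ _ eq]) auto
  then show ?thesis
    by (simp add: KL_div_def ac has_bochner_integral_iff)
qed

text \<open>The sign condition on \<open>D\<close> matters because \<open>ennreal\<close> sends
  negative reals to 0.\<close>

lemma ereal_average_le_iff:
  assumes "0 < n" "0 \<le> D"
  shows "ereal (1 / real n) * enn2ereal S \<le> ereal D \<longleftrightarrow> S \<le> ennreal (n * D)"
proof (cases S)
  case (real r)
  then show ?thesis using assms by (auto simp: enn2ereal_ennreal field_simps)
next
  case top
  then show ?thesis using assms by (simp add: top_unique)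
qed

lemma KL_average_le_iff:
  assumes "0 < n"
  shows "ereal (1 / real n) * (\<Sum>t<n. KL_div q p) \<le> ereal P \<longleftrightarrow> KL_div q p \<le> ereal P"
proof (cases "KL_div q p")
  case (real r)
  then show ?thesis using assms by simp
next
  case PInf
  then have "(\<Sum>t<n. KL_div q p) = \<infinity>" using assms by (subst sum_Pinfty) auto
  then show ?thesis using PInf assms by simp
\<comment> \<open>The remaining value, minus infinity, is never taken by
  \<open>KL_div\<close>.\<close>
qed (auto simp: KL_div_def split: if_splits)

section \<open>The joint law split by seed and message\<close>

context coding_scheme begin

abbreviation "cj \<equiv> code_joint n mu s L enc dec"

lemma sum_pmf_enc:
  "(\<Sum>k<L. \<Sum>j<M. ennreal (pmf (enc x k) j / L)) = 1"
proof -
  have "(\<Sum>j<M. pmf (enc x k) j) = 1" for k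
    using sum_pmf_eq_1[OF finite_lessThan enc_subset, of x k] .
  then have "(\<Sum>k<L. \<Sum>j<M. pmf (enc x k) j / L) = 1"
    using L_pos by (simp add: sum_divide_distrib[symmetric])
  then show ?thesis by (simp add: sum_nonneg)
qed

lemma nn_integral_cj_fst:
  assumes h [measurable]: "h \<in> borel_measurable (rec_space n)"
  shows "(\<integral>\<^sup>+z. h (fst z) \<partial>cj) = (\<integral>\<^sup>+x. h x \<partial>src_block n mu s)"
proof -
  note pmf_enc_measurable [measurable]
  have "(\<integral>\<^sup>+z. h (fst z) \<partial>cj) = (\<Sum>k<L. \<Sum>j<M. \<integral>\<^sup>+x. ennreal (pmf (enc x k) j / L) * h x \<partial>src_block n mu s)"
    by (subst nn_integral_code_joint_sum) (simp_all add: prob_space.emeasure_space_1[OF prob_dec])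
  also have "\<dots> = (\<integral>\<^sup>+x. (\<Sum>k<L. \<Sum>j<M. ennreal (pmf (enc x k) j / L) * h x) \<partial>src_block n mu s)"
    by (simp add: nn_integral_sum)
  also have "\<dots> = (\<integral>\<^sup>+x. h x \<partial>src_block n mu s)"
    by (simp add: sum_distrib_right[symmetric] sum_pmf_enc del: sum_ennreal)
  finally show ?thesis .
qed

text \<open>The source law on the event that seed and message form the pair \<open>i\<close>,
  unnormalized so that the parts add up to the source law. The first component is the seed, whereas
  \<open>dec\<close> takes the message first.\<close>

definition enc_part :: "nat \<times> nat \<Rightarrow> (nat \<Rightarrow> real) measure" where
  "enc_part i = density (src_block n mu s) (\<lambda>x. ennreal (pmf (enc x (fst i)) (snd i) / L))"

definition weight :: "nat \<times> nat \<Rightarrow> real" where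
  "weight i = measure (enc_part i) (space (enc_part i))"

definition dec_part :: "nat \<times> nat \<Rightarrow> (nat \<Rightarrow> real) measure" where
  "dec_part i = scale_measure (ennreal (weight i)) (dec (snd i) (fst i))"

abbreviation "msgs \<equiv> {..<L} \<times> {..<M}"

lemma sets_enc_part [simp]: "sets (enc_part i) = sets (rec_space n)"
  by (simp add: enc_part_def)

lemma nn_integral_enc_part:
  "h \<in> borel_measurable (rec_space n) \<Longrightarrow>
   (\<integral>\<^sup>+x. h x \<partial>enc_part i) = (\<integral>\<^sup>+x. ennreal (pmf (enc x (fst i)) (snd i) / L) * h x \<partial>src_block n mu s)"
  using pmf_enc_measurable[measurable] unfolding enc_part_def by (subst nn_integral_density) auto

text \<open>The seed is uniform and independent of the source, and an encoder probability is at most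
  1.\<close>

lemma nn_integral_enc_part_le:
  assumes h [measurable]: "h \<in> borel_measurable (rec_space n)"
  shows "(\<integral>\<^sup>+x. h x \<partial>enc_part i) \<le> ennreal (1 / L) * (\<integral>\<^sup>+x. h x \<partial>src_block n mu s)"
proof -
  have "(\<integral>\<^sup>+x. h x \<partial>enc_part i) \<le> (\<integral>\<^sup>+x. ennreal (1 / L) * h x \<partial>src_block n mu s)"
    unfolding nn_integral_enc_part[OF h]
    by (intro nn_integral_mono mult_right_mono ennreal_leI divide_right_mono pmf_le_1) auto
  also have "\<dots> = ennreal (1 / L) * (\<integral>\<^sup>+x. h x \<partial>src_block n mu s)"
    by (rule nn_integral_cmult) measurable
  finally show ?thesis .
qed

lemma emeasure_enc_part: "emeasure (enc_part i) (space (enc_part i)) = ennreal (weight i)"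
proof -
  interpret prob_space "src_block n mu s" by (rule prob_space_src_block[OF s_pos])
  have "(\<integral>\<^sup>+x. 1 \<partial>enc_part i) \<le> ennreal (1 / L) * (\<integral>\<^sup>+x. 1 \<partial>src_block n mu s)"
    by (rule nn_integral_enc_part_le) simp
  then have "emeasure (enc_part i) (space (enc_part i)) < top"
    using emeasure_space_1 by (auto intro: le_less_trans)
  then show ?thesis unfolding weight_def by (intro emeasure_eq_ennreal_measure) auto
qed

lemma nn_integral_cj:
  assumes h: "h \<in> borel_measurable (rec_space n \<Otimes>\<^sub>M rec_space n)"
  shows "(\<integral>\<^sup>+z. h z \<partial>cj) = (\<Sum>i\<in>msgs. \<integral>\<^sup>+x. \<integral>\<^sup>+y. h (x, y) \<partial>dec (snd i) (fst i) \<partial>enc_part i)"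
  by (simp add: nn_integral_code_joint_sum[OF h] sum.cartesian_product nn_integral_enc_part
      measurable_nn_integral_dec[OF h] split_beta)

lemma nn_integral_cj_snd:
  assumes h [measurable]: "h \<in> borel_measurable (rec_space n)"
  shows "(\<integral>\<^sup>+z. h (snd z) \<partial>cj) = (\<Sum>i\<in>msgs. \<integral>\<^sup>+y. h y \<partial>dec_part i)"
  by (subst nn_integral_cj)
    (auto simp: dec_part_def nn_integral_scale_measure measurable_cong_sets[OF sets_dec refl]
      emeasure_enc_part mult.commute intro!: sum.cong)

end

locale achieving_code = coding_scheme +
  fixes R Rc P D :: real and q :: "real measure"
  assumes rate: "ln (real M) / real n \<le> R" and rate_c: "ln (real L) / real n \<le> Rc"
    and D_nonneg: "0 \<le> D"
    and distortion: "(\<Sum>t<n. \<integral>\<^sup>+ z. ennreal ((fst z t - snd z t)\<^sup>2) \<partial>cj) \<le> ennreal (n * D)"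
    and prob_q: "prob_space q" and sets_q: "sets q = sets borel"
    and KL: "KL_div q (gauss mu s) \<le> ereal P"
    and iid: "distr cj (rec_space n) snd = PiM {..<n} (\<lambda>_. q)"
begin

declare sets_q [measurable_cong]

lemma sets_qn [simp, measurable_cong]: "sets (PiM {..<n} (\<lambda>_. q)) = sets (rec_space n)"
  by (rule sets_rec_space_eq_PiM[OF sets_q])

lemma measurable_snd_cj: "snd \<in> measurable cj (rec_space n)"
  by (simp add: measurable_cong_sets[OF sets_code_joint refl])

lemma sum_dec_part:
  assumes h: "h \<in> borel_measurable (rec_space n)"
  shows "(\<Sum>i\<in>msgs. \<integral>\<^sup>+y. h y \<partial>dec_part i) = (\<integral>\<^sup>+y. h y \<partial>PiM {..<n} (\<lambda>_. q))"
  using nn_integral_cj_snd[OF h] nn_integral_distr[OF measurable_snd_cj, of h] h by (simp add: iid)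

lemma sum_enc_part:
  assumes h: "h \<in> borel_measurable (rec_space n)"
  shows "(\<Sum>i\<in>msgs. \<integral>\<^sup>+x. h x \<partial>enc_part i) = (\<integral>\<^sup>+x. h x \<partial>src_block n mu s)"
proof -
  have h2: "(\<lambda>z. h (fst z)) \<in> borel_measurable (rec_space n \<Otimes>\<^sub>M rec_space n)"
    using h by measurable
  show ?thesis
    using nn_integral_cj_fst[OF h] nn_integral_cj[OF h2]
    by (simp add: prob_space.emeasure_space_1[OF prob_dec])
qed

lemma nn_integral_qn_component:
  assumes t: "t < n" and h: "h \<in> borel_measurable borel"
  shows "(\<integral>\<^sup>+y. h (y t) \<partial>PiM {..<n} (\<lambda>_. q)) = (\<integral>\<^sup>+y. h y \<partial>q)"
  using t h by (intro nn_integral_PiM_component prob_q) (auto simp: measurable_cong_sets[OF sets_q refl])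

text \<open>The source letter counts as a reproduction of itself at divergence zero, so one energy
  bound serves both sides of the code.\<close>

sublocale G: KL_bounded "gauss mu s" mu s 0
proof -
  interpret prob_space "gauss mu s" by (rule prob_space_gauss[OF s_pos])
  show "KL_bounded (gauss mu s) mu s 0"
    by unfold_locales
      (use s_pos KL_div_gauss[OF s_pos s_pos] gauss_moments(1)[OF s_pos, of mu] in
        \<open>auto simp: psi_def has_bochner_integral_iff\<close>)
qed

lemma snd_moment_gauss: "G.snd_moment = s\<^sup>2"
  unfolding G.snd_moment_def using gauss_moments(1)[OF s_pos, of mu] by (simp add: has_bochner_integral_iff)

text \<open>Finite distortion and finite source variance force a finite second moment of the
  reproduction. All reproduction letters have the same law, so the letter at index 0
  suffices.\<close>

sublocale Q: KL_bounded q mu s P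
proof -
  interpret prob_space q by (rule prob_q)
  have m0: "(\<lambda>x. x 0) \<in> borel_measurable (rec_space n)"
    by (rule measurable_rec_space_component[OF n_pos])
  have m1 [measurable]: "(\<lambda>z. fst z 0) \<in> borel_measurable cj" "(\<lambda>z. snd z 0) \<in> borel_measurable cj"
    using measurable_compose[OF measurable_fst m0] measurable_compose[OF measurable_snd m0]
    by (simp_all add: measurable_cong_sets[OF sets_code_joint refl])
  have "(\<integral>\<^sup>+y. ennreal ((y - mu)\<^sup>2) \<partial>q) = (\<integral>\<^sup>+z. ennreal ((snd z 0 - mu)\<^sup>2) \<partial>cj)"
    using n_pos m0 by (subst nn_integral_cj_snd) (simp_all add: sum_dec_part nn_integral_qn_component[symmetric])
  also have "\<dots> \<le> (\<integral>\<^sup>+z. 2 * ennreal ((fst z 0 - snd z 0)\<^sup>2) + 2 * ennreal ((fst z 0 - mu)\<^sup>2) \<partial>cj)"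
  proof (rule nn_integral_mono)
    fix z :: "(nat \<Rightarrow> real) \<times> (nat \<Rightarrow> real)"
    have "(snd z 0 - mu)\<^sup>2 \<le> 2 * (fst z 0 - snd z 0)\<^sup>2 + 2 * (fst z 0 - mu)\<^sup>2"
      using zero_le_power2[of "2 * fst z 0 - snd z 0 - mu"] by (simp add: power2_eq_square algebra_simps)
    then have "ennreal ((snd z 0 - mu)\<^sup>2) \<le> ennreal (2 * (fst z 0 - snd z 0)\<^sup>2 + 2 * (fst z 0 - mu)\<^sup>2)"
      by (rule ennreal_leI)
    also have "\<dots> = 2 * ennreal ((fst z 0 - snd z 0)\<^sup>2) + 2 * ennreal ((fst z 0 - mu)\<^sup>2)"
      by (simp add: ennreal_mult)
    finally show "ennreal ((snd z 0 - mu)\<^sup>2) \<le> 2 * ennreal ((fst z 0 - snd z 0)\<^sup>2) + 2 * ennreal ((fst z 0 - mu)\<^sup>2)" .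
  qed
  also have "\<dots> = 2 * (\<integral>\<^sup>+z. ennreal ((fst z 0 - snd z 0)\<^sup>2) \<partial>cj) + 2 * (\<integral>\<^sup>+z. ennreal ((fst z 0 - mu)\<^sup>2) \<partial>cj)"
    by (simp add: nn_integral_add nn_integral_cmult)
  also have "\<dots> < top"
  proof -
    have "(\<integral>\<^sup>+z. ennreal ((fst z 0 - snd z 0)\<^sup>2) \<partial>cj) \<le> (\<Sum>t<n. \<integral>\<^sup>+ z. ennreal ((fst z t - snd z t)\<^sup>2) \<partial>cj)"
      using n_pos by (intro member_le_sum[where f="\<lambda>t. \<integral>\<^sup>+ z. ennreal ((fst z t - snd z t)\<^sup>2) \<partial>cj"]) auto
    also have "\<dots> < top" using distortion by (rule le_less_trans) simp
    finally have 1: "(\<integral>\<^sup>+z. ennreal ((fst z 0 - snd z 0)\<^sup>2) \<partial>cj) < top" .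
    have "(\<integral>\<^sup>+z. ennreal ((fst z 0 - mu)\<^sup>2) \<partial>cj) = (\<integral>\<^sup>+x. ennreal ((x 0 - mu)\<^sup>2) \<partial>src_block n mu s)"
      using nn_integral_cj_fst[of "\<lambda>x. ennreal ((x 0 - mu)\<^sup>2)"] m0 by simp
    also have "\<dots> = (\<integral>\<^sup>+x. ennreal ((x - mu)\<^sup>2) \<partial>gauss mu s)"
      by (rule nn_integral_block_component[OF s_pos n_pos]) measurable
    also have "\<dots> < top"
      using G.square_integrable by (subst nn_integral_eq_integral) auto
    finally show ?thesis using 1 by (simp add: ennreal_mult_less_top)
  qed
  finally have "(\<integral>\<^sup>+y. ennreal ((y - mu)\<^sup>2) \<partial>q) < top" .
  then have "integrable q (\<lambda>y. (y - mu)\<^sup>2)"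
    by (intro integrableI_nonneg) auto
  then show "KL_bounded q mu s P"
    by unfold_locales (use s_pos KL sets_q in auto)
qed

lemma msgs: "finite msgs" "msgs \<noteq> {}"
  using L_pos M_pos by (auto simp: lessThan_empty_iff)

sublocale A: decomposition "gauss mu s" mu s 0 n msgs enc_part "1 / L"
  by unfold_locales
    (use n_pos L_pos msgs nn_integral_enc_part_le sum_enc_part in \<open>auto simp: src_block_def\<close>)

sublocale B: decomposition q mu s P n msgs dec_part 1
proof
  fix i and h :: "(nat \<Rightarrow> real) \<Rightarrow> ennreal"
  assume i: "i \<in> msgs" and h: "h \<in> borel_measurable (rec_space n)"
  have "(\<integral>\<^sup>+y. h y \<partial>dec_part i) \<le> (\<Sum>i\<in>msgs. \<integral>\<^sup>+y. h y \<partial>dec_part i)"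
    using i msgs by (intro member_le_sum) auto
  then show "(\<integral>\<^sup>+y. h y \<partial>dec_part i) \<le> ennreal 1 * (\<integral>\<^sup>+y. h y \<partial>PiM {..<n} (\<lambda>_. q))"
    by (simp add: sum_dec_part[OF h])
qed (use n_pos msgs sum_dec_part in \<open>auto simp: dec_part_def sets_dec\<close>)

lemma integral_dec_part:
  fixes h :: "_ \<Rightarrow> real"
  assumes w: "0 < weight i" and h: "integrable (dec_part i) h"
  shows "integrable (dec (snd i) (fst i)) h"
    "(\<integral>y. h y \<partial>dec_part i) = weight i * (\<integral>y. h y \<partial>dec (snd i) (fst i))"
proof -
  let ?d = "dec (snd i) (fst i)"
  have eq: "dec_part i = density ?d (\<lambda>_. ennreal (weight i))"
    unfolding dec_part_def
    by (rule measure_eqI) (auto simp: emeasure_density nn_integral_cmult_indicator)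
  have m: "h \<in> borel_measurable ?d" using borel_measurable_integrable[OF h] by (simp add: dec_part_def)
  then have "integrable ?d (\<lambda>x. weight i *\<^sub>R h x)"
    using h w unfolding eq by (subst (asm) integrable_density) auto
  then show "integrable ?d h" using w by simp
  show "(\<integral>y. h y \<partial>dec_part i) = weight i * (\<integral>y. h y \<partial>?d)"
    using m w unfolding eq by (subst integral_density) auto
qed

lemma measure_dec_part: "measure (dec_part i) (space (dec_part i)) = weight i"
  using prob_space.emeasure_space_1[OF prob_dec, of "snd i" "fst i"]
  by (simp add: measure_def dec_part_def weight_def space_scale_measure)

text \<open>Given the pair, the cross term of the squared error is a product of conditional means.
  Pairs of weight zero are treated apart because the decoder law there is arbitrary and may lack
  moments.\<close>

lemma distortion_term:
  assumes i: "i \<in> msgs" and t: "t < n"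
  shows "(\<integral>\<^sup>+x. \<integral>\<^sup>+y. ennreal ((x t - y t)\<^sup>2) \<partial>dec (snd i) (fst i) \<partial>enc_part i) =
    ennreal (A.second i t - 2 * (A.first i t * B.first i t / weight i) + B.second i t)"
    and "0 \<le> A.second i t - 2 * (A.first i t * B.first i t / weight i) + B.second i t"
proof -
  let ?d = "dec (snd i) (fst i)" and ?e = "enc_part i" and ?V = "A.second i t - 2 * (A.first i t * B.first i t / weight i) + B.second i t"
  let ?W = "\<integral>\<^sup>+x. \<integral>\<^sup>+y. ennreal ((x t - y t)\<^sup>2) \<partial>?d \<partial>?e"
  have *: "?W =
    ennreal (?V) \<and>
    0 \<le> ?V"
  proof (cases "weight i = 0")
    case True
    then have "AE x in ?e. False"
      using emeasure_enc_part[of i] by (intro AE_I[OF _ _ sets.top]) auto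
    then have "?W = (\<integral>\<^sup>+x. 0 \<partial>?e)"
      by (intro nn_integral_cong_AE) (auto elim!: eventually_mono)
    moreover from \<open>AE x in ?e. False\<close> have "A.second i t = 0"
      by (auto simp: A.second_def intro!: integral_eq_zero_AE elim!: eventually_mono)
    ultimately have 1: "?W = 0" "A.second i t = 0"
      by simp_all
    have "emeasure (dec_part i) (space (dec_part i)) = 0"
      using True by (simp add: dec_part_def)
    then have "AE x in dec_part i. False"
      by (intro AE_I[OF _ _ sets.top]) auto
    then have "B.second i t = 0"
      by (auto simp: B.second_def intro!: integral_eq_zero_AE elim!: eventually_mono)
    then show ?thesis using 1 True by simp
  next
    case False
    then have w: "0 < weight i" by (simp add: weight_def less_le)
    interpret d: prob_space ?d by (rule prob_dec)
    interpret e: finite_measure ?e by (rule A.finite_\<mu>[OF i])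
    define b1 where "b1 = B.first i t / weight i"
    define b2 where "b2 = B.second i t / weight i"
    note iB = B.integrable_moments[OF i t] and iA = A.integrable_moments[OF i t]
    have b1: "(\<integral>y. y t - mu \<partial>?d) = b1" and b2: "(\<integral>y. (y t - mu)\<^sup>2 \<partial>?d) = b2"
      using integral_dec_part(2)[OF w iB(1)] integral_dec_part(2)[OF w iB(2)] w
      by (simp_all add: b1_def b2_def B.first_def B.second_def)
    note d1 = integral_dec_part(1)[OF w iB(1)] and d2 = integral_dec_part(1)[OF w iB(2)]
    have expand: "(\<lambda>y. (x - y t)\<^sup>2) = (\<lambda>y. (x - mu)\<^sup>2 - (2 * (x - mu)) * (y t - mu) + (y t - mu)\<^sup>2)"
      for x :: real by (auto simp: power2_eq_square algebra_simps)
    have in_d1: "integrable ?d (\<lambda>y. (x - y t)\<^sup>2)" for x :: real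
      unfolding expand using d1 d2 by simp
    have in_d2: "(\<integral>y. (x - y t)\<^sup>2 \<partial>?d) = (x - mu)\<^sup>2 - (2 * b1) * (x - mu) + b2" for x :: real
    proof -
      have "has_bochner_integral ?d (\<lambda>y. (x - mu)\<^sup>2 - (2 * (x - mu)) * (y t - mu) + (y t - mu)\<^sup>2)
          ((x - mu)\<^sup>2 - (2 * (x - mu)) * b1 + b2)"
        using d1 d2 b1 b2 d.prob_space
        by (intro has_bochner_integral_add has_bochner_integral_diff has_bochner_integral_mult_right)
          (auto simp: has_bochner_integral_iff)
      then show ?thesis
        unfolding expand by (simp only: has_bochner_integral_integral_eq mult_ac)
    qed
    have nn: "0 \<le> (x - mu)\<^sup>2 - (2 * b1) * (x - mu) + b2" for x :: real
      unfolding in_d2[symmetric] by simp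
    have in_e: "integrable ?e (\<lambda>x. (x t - mu)\<^sup>2 - (2 * b1) * (x t - mu) + b2)"
      using iA by simp
    have eq: "(\<integral>x. (x t - mu)\<^sup>2 - (2 * b1) * (x t - mu) + b2 \<partial>?e) = A.second i t - 2 * b1 * A.first i t + weight i * b2"
      using iA by (simp add: A.second_def A.first_def weight_def)
    have "?W =
      (\<integral>\<^sup>+x. ennreal ((x t - mu)\<^sup>2 - (2 * b1) * (x t - mu) + b2) \<partial>?e)"
      using in_d1 in_d2 by (intro nn_integral_cong) (simp add: nn_integral_eq_integral)
    also have "\<dots> = ennreal (\<integral>x. (x t - mu)\<^sup>2 - (2 * b1) * (x t - mu) + b2 \<partial>?e)"
      using nn by (intro nn_integral_eq_integral in_e) auto
    also note eq
    finally have "?W = ennreal (A.second i t - 2 * b1 * A.first i t + weight i * b2)" .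
    moreover have "0 \<le> A.second i t - 2 * b1 * A.first i t + weight i * b2"
      unfolding eq[symmetric] using nn by simp
    moreover have "A.second i t - 2 * b1 * A.first i t + weight i * b2 =
        ?V"
      using w by (simp add: b1_def b2_def)
    ultimately show ?thesis by simp
  qed
  then show "?W =
    ennreal (?V)"
    "0 \<le> ?V"
    by auto
qed

lemma distortion_real:
  "n * (s\<^sup>2 + Q.snd_moment) - 2 * (\<Sum>t<n. \<Sum>i\<in>msgs. A.first i t * B.first i t / weight i) \<le> n * D"
proof -
  let ?V = "\<lambda>i t. A.second i t - 2 * (A.first i t * B.first i t / weight i) + B.second i t"
  have m: "(\<lambda>z. ennreal ((fst z t - snd z t)\<^sup>2)) \<in> borel_measurable (rec_space n \<Otimes>\<^sub>M rec_space n)"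
    if "t < n" for t
    using measurable_compose[OF measurable_fst measurable_rec_space_component[OF that]]
      measurable_compose[OF measurable_snd measurable_rec_space_component[OF that]]
    by measurable
  have "ennreal (\<Sum>t<n. \<Sum>i\<in>msgs. ?V i t) =
    (\<Sum>t<n. \<Sum>i\<in>msgs. ennreal (?V i t))"
    using distortion_term(2) by (subst sum_ennreal[symmetric]) (auto simp: sum_nonneg)
  also have "\<dots> = (\<Sum>t<n. \<integral>\<^sup>+ z. ennreal ((fst z t - snd z t)\<^sup>2) \<partial>cj)"
  proof (intro sum.cong refl)
    fix t assume t: "t \<in> {..<n}"
    then have m: "(\<lambda>z. ennreal ((fst z t - snd z t)\<^sup>2)) \<in> borel_measurable (rec_space n \<Otimes>\<^sub>M rec_space n)"
      by (intro m) simp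
    show "(\<Sum>i\<in>msgs. ennreal (?V i t)) =
      (\<integral>\<^sup>+ z. ennreal ((fst z t - snd z t)\<^sup>2) \<partial>cj)"
      unfolding nn_integral_cj[OF m] fst_conv snd_conv
      by (intro sum.cong refl distortion_term(1)[symmetric]) (use t in auto)
  qed
  also note distortion
  finally have "(\<Sum>t<n. \<Sum>i\<in>msgs. ?V i t) \<le> n * D"
    using D_nonneg by (subst (asm) ennreal_le_iff) auto
  moreover have "(\<Sum>i\<in>msgs. A.second i t) = s\<^sup>2" "(\<Sum>i\<in>msgs. B.second i t) = Q.snd_moment" if "t < n" for t
    using A.sum_second[OF that] B.sum_second[OF that] by (simp_all add: snd_moment_gauss)
  ultimately show ?thesis
    by (simp add: sum.distrib sum_subtractf sum_distrib_left algebra_simps)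
qed

lemma distortion_lower_bound:
  defines "\<sigma> \<equiv> sqrt Q.snd_moment"
  shows "s\<^sup>2 + \<sigma>\<^sup>2 - 2 * s * \<sigma> * sqrt ((1 - exp (-2 * R)) * (1 - exp (-2 * (R + Rc + P - psi s \<sigma>)))) \<le> D"
proof -
  define S where "S = Q.snd_moment"
  have S: "0 < S" using Q.snd_moment_pos by (simp add: S_def)
  have \<sigma>: "\<sigma>\<^sup>2 = S" "0 < \<sigma>" using S by (simp_all add: \<sigma>_def S_def)
  let ?T = "{..<n} \<times> msgs"
  have lnM: "ln (1 / L * card msgs) \<le> n * R"
    using rate n_pos L_pos by (simp add: field_simps)
  have lnLM: "ln (1 * real (card msgs)) \<le> n * (R + Rc)"
    using rate rate_c n_pos L_pos M_pos by (simp add: field_simps ln_mult)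
  have a: "(\<Sum>t<n. \<Sum>i\<in>msgs. (A.first i t)\<^sup>2 / weight i) \<le> n * (s\<^sup>2 * (1 - exp (-2 * R)))"
    using A.conditional_mean_energy[OF lnM] s_pos by (simp add: snd_moment_gauss weight_def algebra_simps)
  \<comment> \<open>By the definition of \<open>psi\<close> and \<open>S = \<sigma>^2\<close>, the
    quantity \<open>s^2 * exp (S / s^2 - 1)\<close> equals
    \<open>\<sigma>^2 * exp (2 * psi s \<sigma>)\<close>.\<close>
  have "S - s\<^sup>2 * exp (S / s\<^sup>2 - 1 - 2 * P - 2 * (R + Rc)) = \<sigma>\<^sup>2 * (1 - exp (-2 * (R + Rc + P - psi s \<sigma>)))"
  proof -
    have "exp (-2 * (R + Rc + P - psi s \<sigma>)) = exp (2 * ln (s / \<sigma>) + (S / s\<^sup>2 - 1 - 2 * P - 2 * (R + Rc)))"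
      using s_pos \<sigma> by (simp add: psi_def field_simps)
    also have "\<dots> = (s / \<sigma>)\<^sup>2 * exp (S / s\<^sup>2 - 1 - 2 * P - 2 * (R + Rc))"
      using s_pos \<sigma>(2) by (simp add: exp_add exp_double)
    finally show ?thesis using \<sigma> S by (simp add: power_divide algebra_simps)
  qed
  then have b: "(\<Sum>t<n. \<Sum>i\<in>msgs. (B.first i t)\<^sup>2 / weight i) \<le> n * (\<sigma>\<^sup>2 * (1 - exp (-2 * (R + Rc + P - psi s \<sigma>))))"
    using B.conditional_mean_energy[OF lnLM] by (simp add: measure_dec_part S_def)
  have wn: "0 \<le> weight i" for i by (simp add: weight_def)
  have sq: "(x / sqrt (weight i))\<^sup>2 = x\<^sup>2 / weight i" for x i
    using wn[of i] by (simp add: power_divide)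
  \<comment> \<open>A single Cauchy-Schwarz inequality over letters and pairs jointly, with the
    weight split evenly between the two factors.\<close>
  have "(\<Sum>t<n. \<Sum>i\<in>msgs. A.first i t * B.first i t / weight i) =
    (\<Sum>p\<in>?T. (A.first (snd p) (fst p) / sqrt (weight (snd p))) * (B.first (snd p) (fst p) / sqrt (weight (snd p))))"
    using wn by (simp add: sum.cartesian_product split_beta)
  also have "\<dots> \<le> (\<Sum>p\<in>?T. \<bar>A.first (snd p) (fst p) / sqrt (weight (snd p))\<bar> * \<bar>B.first (snd p) (fst p) / sqrt (weight (snd p))\<bar>)"
    by (intro sum_mono) (metis abs_ge_self abs_mult)
  also have "\<dots> \<le> sqrt (\<Sum>t<n. \<Sum>i\<in>msgs. (A.first i t)\<^sup>2 / weight i) * sqrt (\<Sum>t<n. \<Sum>i\<in>msgs. (B.first i t)\<^sup>2 / weight i)"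
    by (rule order_trans[OF L2_set_mult_ineq]) (simp add: L2_set_def sq sum.cartesian_product split_beta)
  also have "\<dots> \<le> sqrt (n * (s\<^sup>2 * (1 - exp (-2 * R)))) * sqrt (n * (\<sigma>\<^sup>2 * (1 - exp (-2 * (R + Rc + P - psi s \<sigma>)))))"
    using a b wn by (intro mult_mono real_sqrt_le_mono real_sqrt_ge_zero sum_nonneg divide_nonneg_nonneg order_trans[OF _ a]) auto
  also have "\<dots> = n * (s * \<sigma> * sqrt ((1 - exp (-2 * R)) * (1 - exp (-2 * (R + Rc + P - psi s \<sigma>)))))"
    using s_pos \<sigma>(2) by (simp add: real_sqrt_mult mult.assoc mult.left_commute)
  finally have "n * (s\<^sup>2 + \<sigma>\<^sup>2 - 2 * s * \<sigma> * sqrt ((1 - exp (-2 * R)) * (1 - exp (-2 * (R + Rc + P - psi s \<sigma>))))) \<le> n * D"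
    using distortion_real \<sigma>(1) unfolding S_def by (simp add: algebra_simps)
  then show ?thesis using n_pos by simp
qed

end

section \<open>The function \<open>psi\<close> and its inverse\<close>

lemma psi_strict_antimono:
  assumes "0 < a" "a < b" "b \<le> s"
  shows "psi s b < psi s a"
proof -
  have "a\<^sup>2 < b\<^sup>2" using assms by (intro power_strict_mono) auto
  have "ln (a\<^sup>2 / b\<^sup>2) \<noteq> a\<^sup>2 / b\<^sup>2 - 1"
    using ln_eq_minus_one[of "a\<^sup>2 / b\<^sup>2"] \<open>a\<^sup>2 < b\<^sup>2\<close> assms by auto
  then have "ln (a\<^sup>2 / b\<^sup>2) < a\<^sup>2 / b\<^sup>2 - 1"
    using ln_le_minus_one[of "a\<^sup>2 / b\<^sup>2"] assms by simp
  then have 1: "2 * ln a - 2 * ln b < a\<^sup>2 / b\<^sup>2 - 1"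
    using assms by (simp add: ln_div ln_realpow)
  \<comment> \<open>Here \<open>b \<le> s\<close> enters: enlarging the quadratic difference by
    replacing \<open>s\<close> with \<open>b\<close> leaves exactly the gap in
    \<open>ln x < x - 1\<close> at \<open>x = a^2 / b^2\<close>.\<close>
  have "(b\<^sup>2 - a\<^sup>2) / s\<^sup>2 \<le> (b\<^sup>2 - a\<^sup>2) / b\<^sup>2"
    using assms \<open>a\<^sup>2 < b\<^sup>2\<close> by (intro divide_left_mono power_mono mult_pos_pos) auto
  also have "\<dots> = 1 - a\<^sup>2 / b\<^sup>2" using assms by (simp add: field_simps)
  finally have "b\<^sup>2 / s\<^sup>2 - a\<^sup>2 / s\<^sup>2 \<le> 1 - a\<^sup>2 / b\<^sup>2" by (simp add: diff_divide_distrib)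
  then show ?thesis using 1 assms by (simp add: psi_def ln_div diff_divide_distrib)
qed

text \<open>An instance of \<open>ln x \<le> x - 1\<close> that also covers \<open>a\<close> above
  \<open>s\<close>, where the converse uses it.\<close>

lemma psi_nonneg:
  assumes "0 < s" "0 < a"
  shows "0 \<le> psi s a"
  using ln_le_minus_one[of "a\<^sup>2 / s\<^sup>2"] assms
  by (simp add: psi_def ln_div ln_realpow diff_divide_distrib)

lemma psi_self: "0 < s \<Longrightarrow> psi s s = 0"
  by (simp add: psi_def)

lemma sigmaP:
  assumes s: "0 < s" and P: "0 \<le> P"
  shows "0 < sigmaP s P" "sigmaP s P \<le> s" "psi s (sigmaP s P) = P"
proof -
  \<comment> \<open>Left end for the intermediate value theorem: the logarithm contributes
    \<open>P + 1\<close> and the quadratic term costs at most 1/2.\<close>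
  define a where "a = s * exp (- P - 1)"
  have a: "0 < a" "a \<le> s" using s P by (auto simp: a_def)
  have "psi s a = P + 1 + (a\<^sup>2 / s\<^sup>2 - 1) / 2"
    using s by (simp add: psi_def a_def ln_div ln_mult diff_divide_distrib)
  moreover have "P \<le> P + 1 + (x - 1) / 2" if "0 \<le> x" for x :: real
    using that by (simp add: field_simps)
  ultimately have "P \<le> psi s a" by simp
  moreover have "continuous_on {a..s} (psi s)"
    unfolding psi_def[abs_def] using a s by (intro continuous_intros) auto
  ultimately obtain x where x: "a \<le> x" "x \<le> s" "psi s x = P"
    using IVT2'[of "psi s" s P a] a P psi_self[OF s] by auto
  have "\<exists>!x. 0 < x \<and> x \<le> s \<and> psi s x = P"
  proof (rule ex1I[of _ x])
    show "0 < x \<and> x \<le> s \<and> psi s x = P" using x a by simp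
    fix y assume "0 < y \<and> y \<le> s \<and> psi s y = P"
    then show "y = x"
      using psi_strict_antimono[of x y s] psi_strict_antimono[of y x s] x a by (cases x y rule: linorder_cases) auto
  qed
  from theI'[OF this] show "0 < sigmaP s P" "sigmaP s P \<le> s" "psi s (sigmaP s P) = P"
    by (auto simp: sigmaP_def)
qed

lemma psi_le_iff:
  assumes "0 < s" "0 \<le> P" "0 < a" "a \<le> s"
  shows "psi s a \<le> P \<longleftrightarrow> sigmaP s P \<le> a"
  using psi_strict_antimono[of a "sigmaP s P" s] psi_strict_antimono[of "sigmaP s P" a s]
    sigmaP[OF assms(1,2)] assms by (cases a "sigmaP s P" rule: linorder_cases) auto

lemma (in coding_scheme) distr_component_cj:
  assumes q: "prob_space q" "sets q = sets borel"
    and iid: "distr cj (rec_space n) snd = PiM {..<n} (\<lambda>_. q)" and t: "t < n"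
  shows "distr cj borel (\<lambda>z. snd z t) = q"
proof -
  have m: "snd \<in> measurable cj (rec_space n)"
    by (simp add: measurable_cong_sets[OF sets_code_joint refl])
  have "distr cj borel (\<lambda>z. snd z t) = distr (distr cj (rec_space n) snd) borel (\<lambda>y. y t)"
    by (subst distr_distr[OF measurable_rec_space_component[OF t] m]) (simp add: comp_def)
  also have "\<dots> = distr (PiM {..<n} (\<lambda>_. q)) q (\<lambda>y. y t)"
    unfolding iid by (rule distr_cong) (simp_all add: q)
  also have "\<dots> = q"
    using t q by (intro distr_PiM_component) auto
  finally show ?thesis .
qed

lemma D_lower_le_achievable:
  assumes s: "0 < s" and R: "0 \<le> R" "0 \<le> Rc" and P: "0 \<le> P" and ach: "achievable mu s R Rc P D"
  shows "D_lower R Rc P s \<le> D"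
proof -
  obtain n L M enc dec q where valid: "valid_code n mu s L M enc dec"
    and rates: "ln (real M) / real n \<le> R" "ln (real L) / real n \<le> Rc"
    and dist: "ereal (1 / real n) *
          enn2ereal (\<Sum>t<n. \<integral>\<^sup>+ z. ennreal ((fst z t - snd z t)\<^sup>2) \<partial>(code_joint n mu s L enc dec)) \<le> ereal D"
    and KL: "ereal (1 / real n) *
          (\<Sum>t<n. KL_div (distr (code_joint n mu s L enc dec) borel (\<lambda>z. snd z t)) (gauss mu s)) \<le> ereal P"
    and q: "prob_space q" "sets q = sets (borel :: real measure)"
    and iid: "distr (code_joint n mu s L enc dec) (rec_space n) snd = PiM {..<n} (\<lambda>_. q)"
    using ach unfolding achievable_def by (elim exE conjE) (rule that)
  interpret coding_scheme n L M mu s enc dec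
    by unfold_locales (use valid s in auto)
  have "0 \<le> ereal D"
    by (rule order_trans[OF _ dist]) simp
  then have D: "0 \<le> D" by simp
  have "KL_div q (gauss mu s) \<le> ereal P"
    using KL KL_average_le_iff[OF n_pos] by (simp add: distr_component_cj[OF q iid])
  then interpret achieving_code n L M mu s enc dec R Rc P D q
    by (intro achieving_code.intro achieving_code_axioms.intro coding_scheme_axioms rates D
        ereal_average_le_iff[OF n_pos D, THEN iffD1, OF dist] q iid)
  define \<sigma> where "\<sigma> = sqrt Q.snd_moment"
  have \<sigma>: "0 < \<sigma>" "psi s \<sigma> \<le> P"
    using Q.snd_moment_pos Q.psi_snd_moment by (simp_all add: \<sigma>_def)
  define c where "c = (\<lambda>x. sqrt ((1 - exp (-2 * R)) * (1 - exp (-2 * (R + Rc + P - psi s x)))))"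
  define f where "f = (\<lambda>x. s\<^sup>2 + x\<^sup>2 - 2 * s * x * c x)"
  have c: "c x \<le> 1" if "psi s x \<le> P" for x
  proof -
    have "(1 - exp (-2 * R)) * (1 - exp (-2 * (R + Rc + P - psi s x))) \<le> 1 * 1"
      using R that by (intro mult_mono) auto
    then show ?thesis by (simp add: c_def)
  qed
  \<comment> \<open>Boundedness from below is what makes \<open>Inf\<close> a lower bound; the
    objective is a square plus a term that is nonnegative as long as the correlation factor is at
    most 1.\<close>
  have bdd: "bdd_below (f ` {sigmaP s P..s})"
  proof (rule bdd_belowI2[where m=0])
    fix x assume x: "x \<in> {sigmaP s P..s}"
    then have "0 < x" "psi s x \<le> P" using sigmaP(1)[OF s P] psi_le_iff[OF s P] by auto
    then have "0 \<le> 2 * s * x * (1 - c x)" using s c by simp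
    moreover have "f x = (s - x)\<^sup>2 + 2 * s * x * (1 - c x)"
      by (simp add: f_def power2_eq_square algebra_simps)
    ultimately show "0 \<le> f x" by simp
  qed
  have D_lower: "D_lower R Rc P s \<le> f x" if "sigmaP s P \<le> x" "x \<le> s" for x
  proof -
    have "D_lower R Rc P s = Inf (f ` {sigmaP s P..s})"
      unfolding D_lower_def f_def c_def ..
    also have "\<dots> \<le> f x" using that by (intro cInf_lower bdd) auto
    finally show ?thesis .
  qed
  have bound: "f \<sigma> \<le> D"
    using distortion_lower_bound unfolding f_def c_def \<sigma>_def .
  show ?thesis
  proof (cases "\<sigma> \<le> s")
    case True
    then show ?thesis using D_lower[of \<sigma>] bound psi_le_iff[OF s P \<sigma>(1)] \<sigma> by auto
  next
    case False
    \<comment> \<open>\<open>psi\<close> is smallest at \<open>s\<close>, so lowering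
      \<open>\<sigma>\<close> to \<open>s\<close> raises the correlation factor; for a fixed factor
      of at most 1 the quadratic increases beyond \<open>s\<close>.\<close>
    have "c \<sigma> \<le> c s"
      unfolding c_def using R psi_nonneg[OF s \<sigma>(1)] psi_self[OF s]
      by (intro real_sqrt_le_mono mult_left_mono) auto
    then have "s * \<sigma> * c \<sigma> \<le> s * \<sigma> * c s" using s \<sigma> by simp
    then have "f \<sigma> \<ge> s\<^sup>2 + \<sigma>\<^sup>2 - 2 * s * \<sigma> * c s"
      by (simp add: f_def algebra_simps)
    moreover have "s\<^sup>2 + \<sigma>\<^sup>2 - 2 * s * \<sigma> * c s - f s = (\<sigma> - s) * (\<sigma> - s + 2 * s * (1 - c s))"
      by (simp add: f_def power2_eq_square algebra_simps)
    moreover have "0 \<le> (\<sigma> - s) * (\<sigma> - s + 2 * s * (1 - c s))"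
      using False s c[of s] psi_self[OF s] P by (intro mult_nonneg_nonneg add_nonneg_nonneg) auto
    ultimately have "f s \<le> f \<sigma>" by simp
    then show ?thesis using D_lower[of s] bound sigmaP(2)[OF s P] by simp
  qed
qed

section \<open>Soft covering\<close>

lemma integral_PiM_component:
  fixes h :: "'u \<Rightarrow> 'b::{banach, second_countable_topology}"
  assumes "prob_space N" "i \<in> I" "h \<in> borel_measurable N"
  shows "(\<integral>c. h (c i) \<partial>PiM I (\<lambda>_. N)) = (\<integral>u. h u \<partial>N)"
proof -
  have "distr (PiM I (\<lambda>_. N)) N (\<lambda>c. c i) = N"
    using assms by (intro distr_PiM_component) auto
  then show ?thesis
    using integral_distr[of "\<lambda>c. c i" "PiM I (\<lambda>_. N)" N h] assms by simp
qed

lemma second_moment_PiM_sum: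
  fixes Z :: "'u \<Rightarrow> real"
  assumes N: "prob_space N" and I: "finite I" and J: "J \<subseteq> I"
    and Z [measurable]: "Z \<in> borel_measurable N" and B: "\<And>u. \<bar>Z u\<bar> \<le> B"
    and mean: "(\<integral>u. Z u \<partial>N) = 0"
  shows "(\<integral>c. (\<Sum>i\<in>J. Z (c i))\<^sup>2 \<partial>PiM I (\<lambda>_. N)) = card J * (\<integral>u. (Z u)\<^sup>2 \<partial>N)"
proof -
  interpret N: prob_space N by (rule N)
  interpret product_prob_space "\<lambda>_. N" I
    by unfold_locales
  let ?P = "PiM I (\<lambda>_. N)"
  have J': "finite J" using J I by (rule finite_subset)
  have meas: "(\<lambda>c. Z (c i)) \<in> borel_measurable ?P" if "i \<in> J" for i
    using that J by (intro measurable_compose[OF _ Z] measurable_component_singleton) auto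
  have bound: "\<bar>Z u * Z v\<bar> \<le> B * B" for u v
    unfolding abs_mult using B[of u] B[of v] by (intro mult_mono) (auto intro: order_trans[OF abs_ge_zero])
  have int: "integrable ?P (\<lambda>c. Z (c i) * Z (c j))" if "i \<in> J" "j \<in> J" for i j
    by (rule P.integrable_const_bound[where B="B * B"])
      (use bound meas that in auto)
  have cross: "(\<integral>c. Z (c i) * Z (c j) \<partial>?P) = (if i = j then (\<integral>u. (Z u)\<^sup>2 \<partial>N) else 0)"
    if ij: "i \<in> J" "j \<in> J" for i j
  proof (cases "i = j")
    case True
    then show ?thesis
      using integral_PiM_component[OF N, of i I "\<lambda>u. Z u * Z u"] ij J by (auto simp: power2_eq_square)
  next
    case False
    \<comment> \<open>Writing the cross term as a product over all of \<open>I\<close>, with factor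
      1 away from \<open>i\<close> and \<open>j\<close>, makes the product integral formula
      applicable.\<close>
    define h where "h = (\<lambda>l u. if l = i \<or> l = j then Z u else 1)"
    have intZ: "integrable N Z" by (rule N.integrable_const_bound[where B=B]) (use B in auto)
    have prod2: "(\<Prod>l\<in>I. F l) = F i * F j" if "\<And>l. l \<noteq> i \<Longrightarrow> l \<noteq> j \<Longrightarrow> F l = 1" for F :: "_ \<Rightarrow> real"
    proof -
      have "(\<Prod>l\<in>I. F l) = (\<Prod>l\<in>{i, j}. F l)"
        using ij J I that by (intro prod.mono_neutral_right) auto
      then show ?thesis using False by simp
    qed
    have "(\<integral>c. Z (c i) * Z (c j) \<partial>?P) = (\<integral>c. (\<Prod>l\<in>I. h l (c l)) \<partial>?P)"
      by (subst prod2) (auto simp: h_def)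
    also have "\<dots> = (\<Prod>l\<in>I. \<integral>u. h l u \<partial>N)"
    proof (rule product_integral_prod[OF I])
      show "integrable N (h l)" for l
        unfolding h_def using intZ by (cases "l = i \<or> l = j") simp_all
    qed
    also have "\<dots> = 0"
      by (subst prod2) (auto simp: h_def mean N.prob_space)
    finally show ?thesis using False by simp
  qed
  have "(\<integral>c. (\<Sum>i\<in>J. Z (c i))\<^sup>2 \<partial>?P) = (\<integral>c. (\<Sum>i\<in>J. \<Sum>j\<in>J. Z (c i) * Z (c j)) \<partial>?P)"
    by (simp add: power2_eq_square sum_product)
  also have "\<dots> = (\<Sum>i\<in>J. \<Sum>j\<in>J. \<integral>c. Z (c i) * Z (c j) \<partial>?P)"
    using int by (simp add: Bochner_Integration.integral_sum)
  also have "\<dots> = card J * (\<integral>u. (Z u)\<^sup>2 \<partial>N)"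
    using J' by (simp add: cross)
  finally show ?thesis .
qed

text \<open>Truncating \<open>F\<close> at \<open>T\<close> bounds its variance by \<open>T\<close>,
  since its mean is at most 1; averaging over \<open>J\<close> and passing from second to first
  moment gives \<open>sqrt (T / card J)\<close>. The mass lost by truncation is the tail term.
  Truncation only lowers the average, so it is compatible with the one-sided deficit.
  \<open>J\<close> is smaller than \<open>I\<close> when the codewords of a single seed are
  meant.\<close>

lemma soft_covering_pointwise:
  fixes F :: "'u \<Rightarrow> real"
  assumes N: "prob_space N" and I: "finite I" and J: "J \<subseteq> I" "J \<noteq> {}"
    and F [measurable]: "F \<in> borel_measurable N" and nonneg: "\<And>u. 0 \<le> F u"
    and one: "(\<integral>\<^sup>+u. ennreal (F u) \<partial>N) = 1" and T: "0 < T"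
  shows "(\<integral>\<^sup>+c. ennreal (max 0 (1 - (\<Sum>i\<in>J. F (c i)) / card J)) \<partial>PiM I (\<lambda>_. N))
    \<le> ennreal (sqrt (T / card J)) + (\<integral>\<^sup>+u. ennreal (F u * indicator {u. T < F u} u) \<partial>N)"
proof -
  interpret N: prob_space N by (rule N)
  let ?P = "PiM I (\<lambda>_. N)"
  interpret P: prob_space ?P by (intro prob_space_PiM N)
  have J': "finite J" "0 < card J" using J finite_subset[OF J(1) I] by (auto simp: card_gt_0_iff)
  define Y where "Y = (\<lambda>u. F u * indicator {u. F u \<le> T} u)"
  have Y [measurable]: "Y \<in> borel_measurable N" unfolding Y_def by measurable
  have Y0: "0 \<le> Y u" and YT: "Y u \<le> T" and YF: "Y u \<le> F u" for u
    using nonneg T by (auto simp: Y_def indicator_def)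
  have intF: "integrable N F" by (rule integrableI_nonneg) (use nonneg one in auto)
  have intY: "integrable N Y"
    by (rule N.integrable_const_bound[where B=T]) (use Y0 YT in auto)
  have oneF: "(\<integral>u. F u \<partial>N) = 1"
    using one nonneg by (subst (asm) nn_integral_eq_integral[OF intF]) auto
  define m where "m = (\<integral>u. Y u \<partial>N)"
  have m: "0 \<le> m" "m \<le> 1"
    unfolding m_def oneF[symmetric] using Y0 YF by (auto intro!: integral_mono intY intF)
  have tail: "(\<integral>\<^sup>+u. ennreal (F u * indicator {u. T < F u} u) \<partial>N) = ennreal (1 - m)"
  proof -
    have eq: "F u * indicator {u. T < F u} u = F u - Y u" for u by (auto simp: Y_def indicator_def)
    have "(\<integral>\<^sup>+u. ennreal (F u - Y u) \<partial>N) = ennreal (\<integral>u. F u - Y u \<partial>N)"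
      using YF by (intro nn_integral_eq_integral) (auto simp: intF intY)
    then show ?thesis by (simp add: eq intF intY oneF m_def)
  qed
  define Z where "Z = (\<lambda>u. m - Y u)"
  have Z [measurable]: "Z \<in> borel_measurable N" unfolding Z_def by measurable
  have Zb: "\<bar>Z u\<bar> \<le> m + T" for u using Y0[of u] YT[of u] m by (auto simp: Z_def)
  have Z0: "(\<integral>u. Z u \<partial>N) = 0" using intY by (simp add: Z_def m_def N.prob_space)
  have Z2: "(\<integral>u. (Z u)\<^sup>2 \<partial>N) \<le> T"
  proof -
    have intYY: "integrable N (\<lambda>u. (Y u)\<^sup>2)"
      by (rule N.integrable_const_bound[where B="T\<^sup>2"]) (use Y0 YT in \<open>auto intro: power_mono\<close>)
    have "(\<integral>u. (Z u)\<^sup>2 \<partial>N) = (\<integral>u. (Y u)\<^sup>2 \<partial>N) - m\<^sup>2"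
      using N.variance_eq[OF intY intYY] by (simp add: Z_def m_def power2_commute)
    also have "\<dots> \<le> (\<integral>u. (Y u)\<^sup>2 \<partial>N)" by simp
    also have "\<dots> \<le> (\<integral>u. T * Y u \<partial>N)"
      using intYY intY Y0 YT by (intro integral_mono) (auto simp: power2_eq_square intro!: mult_right_mono)
    also have "\<dots> \<le> T * 1" using intY m T by (simp add: m_def[symmetric])
    finally show ?thesis by simp
  qed
  define W where "W = (\<lambda>c. (\<Sum>i\<in>J. Z (c i)) / card J)"
  have Wm [measurable]: "W \<in> borel_measurable ?P"
    unfolding W_def using J(1)
    by (intro borel_measurable_divide borel_measurable_sum measurable_compose[OF _ Z] measurable_component_singleton) auto
  have Wb: "\<bar>W c\<bar> \<le> m + T" for c
  proof -
    have "\<bar>\<Sum>i\<in>J. Z (c i)\<bar> \<le> (\<Sum>i\<in>J. \<bar>Z (c i)\<bar>)" by (rule sum_abs)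
    also have "\<dots> \<le> card J * (m + T)" using Zb by (intro sum_bounded_above) auto
    finally show ?thesis using J' by (simp add: W_def field_simps)
  qed
  have intW: "integrable ?P (\<lambda>c. \<bar>W c\<bar>)" "integrable ?P (\<lambda>c. \<bar>W c\<bar>\<^sup>2)"
    using Wb power_mono[OF Wb abs_ge_zero, of _ 2]
    by (auto intro: P.integrable_const_bound[where B="m + T"] P.integrable_const_bound[where B="(m + T)\<^sup>2"])
  have "(\<integral>c. \<bar>W c\<bar>\<^sup>2 \<partial>?P) = (\<integral>u. (Z u)\<^sup>2 \<partial>N) / card J"
    using second_moment_PiM_sum[OF N I J(1) Z Zb Z0] J'
    by (simp add: W_def power_divide power2_eq_square)
  also have "\<dots> \<le> T / card J" using Z2 by (intro divide_right_mono) auto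
  finally have W2: "(\<integral>c. \<bar>W c\<bar>\<^sup>2 \<partial>?P) \<le> T / card J" .
  have "(\<integral>c. \<bar>W c\<bar> \<partial>?P)\<^sup>2 \<le> (\<integral>c. \<bar>W c\<bar>\<^sup>2 \<partial>?P)"
    using P.variance_eq[OF intW] P.variance_positive[of "\<lambda>c. \<bar>W c\<bar>"] by simp
  then have W1: "(\<integral>c. \<bar>W c\<bar> \<partial>?P) \<le> sqrt (T / card J)"
    using W2 by (intro real_le_rsqrt) simp
  have "(\<integral>\<^sup>+c. ennreal (max 0 (1 - (\<Sum>i\<in>J. F (c i)) / card J)) \<partial>?P) \<le> (\<integral>\<^sup>+c. ennreal \<bar>W c\<bar> + ennreal (1 - m) \<partial>?P)"
  proof (rule nn_integral_mono)
    fix c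
    have "W c = m - (\<Sum>i\<in>J. Y (c i)) / card J"
      using J J' by (simp add: W_def Z_def sum_subtractf diff_divide_distrib)
    moreover have "(\<Sum>i\<in>J. Y (c i)) / card J \<le> (\<Sum>i\<in>J. F (c i)) / card J"
      using YF by (intro divide_right_mono sum_mono) auto
    ultimately have "max 0 (1 - (\<Sum>i\<in>J. F (c i)) / card J) \<le> \<bar>W c\<bar> + (1 - m)"
      using m by auto
    then show "ennreal (max 0 (1 - (\<Sum>i\<in>J. F (c i)) / card J)) \<le> ennreal \<bar>W c\<bar> + ennreal (1 - m)"
      using m by (simp add: ennreal_plus[symmetric] ennreal_leI del: ennreal_plus)
  qed
  also have "\<dots> = ennreal (\<integral>c. \<bar>W c\<bar> \<partial>?P) + ennreal (1 - m)"
    using intW(1) by (simp add: nn_integral_add nn_integral_eq_integral P.emeasure_space_1)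
  also have "\<dots> \<le> ennreal (sqrt (T / card J)) + ennreal (1 - m)"
    using W1 by (intro add_right_mono ennreal_leI)
  finally show ?thesis by (simp add: tail)
qed

text \<open>The codebook integral is outermost because one codebook is selected afterwards; Fubini's
  theorem reduces to a fixed \<open>x\<close>.\<close>

lemma soft_covering:
  fixes F :: "'a \<times> 'u \<Rightarrow> real"
  assumes M: "prob_space M" and N: "prob_space N" and I: "finite I" and J: "J \<subseteq> I" "J \<noteq> {}"
    and F [measurable]: "F \<in> borel_measurable (M \<Otimes>\<^sub>M N)" and nonneg: "\<And>z. 0 \<le> F z"
    and one: "\<And>x. x \<in> space M \<Longrightarrow> (\<integral>\<^sup>+u. ennreal (F (x, u)) \<partial>N) = 1" and T: "0 < T"
  shows "(\<integral>\<^sup>+c. \<integral>\<^sup>+x. ennreal (max 0 (1 - (\<Sum>i\<in>J. F (x, c i)) / card J)) \<partial>M \<partial>PiM I (\<lambda>_. N))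
    \<le> ennreal (sqrt (T / card J)) + (\<integral>\<^sup>+x. \<integral>\<^sup>+u. ennreal (F (x, u) * indicator {z. T < F z} (x, u)) \<partial>N \<partial>M)"
proof -
  let ?g = "\<lambda>x c. ennreal (max 0 (1 - (\<Sum>i\<in>J. F (x, c i)) / card J))" and ?h = "\<lambda>x. \<integral>\<^sup>+u. ennreal (F (x, u) * indicator {z. T < F z} (x, u)) \<partial>N"
  interpret M: prob_space M by (rule M)
  interpret N: prob_space N by (rule N)
  let ?P = "PiM I (\<lambda>_. N)"
  interpret P: prob_space ?P by (intro prob_space_PiM N)
  interpret MP: pair_sigma_finite M ?P ..
  have comp [measurable]: "(\<lambda>z. F (fst z, snd z i)) \<in> borel_measurable (M \<Otimes>\<^sub>M ?P)" if "i \<in> J" for i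
  proof (rule measurable_compose[OF measurable_Pair F])
    show "(\<lambda>z. snd z i) \<in> M \<Otimes>\<^sub>M ?P \<rightarrow>\<^sub>M N"
      using that J by (intro measurable_compose[OF measurable_snd measurable_component_singleton]) auto
  qed simp
  have meas: "(\<lambda>(x, c). ?g x c) \<in> borel_measurable (M \<Otimes>\<^sub>M ?P)"
    unfolding split_beta by measurable
  have "(\<integral>\<^sup>+c. \<integral>\<^sup>+x. ?g x c \<partial>M \<partial>?P)
    = (\<integral>\<^sup>+x. \<integral>\<^sup>+c. ?g x c \<partial>?P \<partial>M)"
    using MP.Fubini'[OF meas] by simp
  also have "\<dots> \<le> (\<integral>\<^sup>+x. ennreal (sqrt (T / card J)) + ?h x \<partial>M)"
  proof (rule nn_integral_mono)
    fix x assume x: "x \<in> space M"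
    have "(\<lambda>u. F (x, u)) \<in> borel_measurable N"
      by (rule measurable_compose[OF measurable_Pair1'[OF x] F])
    from soft_covering_pointwise[OF N I J this nonneg one[OF x] T]
    show "(\<integral>\<^sup>+c. ?g x c \<partial>?P) \<le>
      ennreal (sqrt (T / card J)) + ?h x"
      by (simp add: indicator_def)
  qed
  also have "\<dots> = ennreal (sqrt (T / card J)) + (\<integral>\<^sup>+x. ?h x \<partial>M)"
    by (subst nn_integral_add) (auto simp: M.emeasure_space_1)
  finally show ?thesis .
qed

section \<open>Codes from a codebook\<close>

lemma (in coding_scheme) distr_snd_eqI:
  assumes sets: "sets Q = sets (rec_space n)"
    and eq: "\<And>\<phi> :: _ \<Rightarrow> ennreal. \<phi> \<in> borel_measurable (rec_space n) \<Longrightarrow> (\<integral>\<^sup>+z. \<phi> (snd z) \<partial>cj) = (\<integral>\<^sup>+y. \<phi> y \<partial>Q)"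
  shows "distr cj (rec_space n) snd = Q"
proof (rule measure_eqI)
  have m: "snd \<in> measurable cj (rec_space n)"
    unfolding measurable_cong_sets[OF sets_code_joint refl] by (rule measurable_snd)
  show "sets (distr cj (rec_space n) snd) = sets Q" by (simp add: sets)
  fix A assume "A \<in> sets (distr cj (rec_space n) snd)"
  then have A: "A \<in> sets (rec_space n)" by simp
  have "emeasure (distr cj (rec_space n) snd) A = (\<integral>\<^sup>+y. indicator A y \<partial>distr cj (rec_space n) snd)"
    using A by simp
  also have "\<dots> = (\<integral>\<^sup>+z. indicator A (snd z) \<partial>cj)"
    using A by (intro nn_integral_distr m) simp
  also have "\<dots> = emeasure Q A" using A sets by (subst eq) auto
  finally show "emeasure (distr cj (rec_space n) snd) A = emeasure Q A" .
qed

text \<open>The codeword of message \<open>j\<close> under seed \<open>k\<close> enters only through the densities \<open>f (k, j)\<close> and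
  \<open>g (k, j)\<close> of source and reproduction given that codeword, relative to the target laws
  \<open>p\<close> and \<open>q\<close>.\<close>

locale codebook =
  fixes n L M :: nat and mu s \<sigma> :: real and f g :: "nat \<times> nat \<Rightarrow> (nat \<Rightarrow> real) \<Rightarrow> real"
  assumes n_pos: "0 < n" and L_pos: "0 < L" and M_pos: "0 < M" and s_pos: "0 < s" and \<sigma>_pos: "0 < \<sigma>"
    and f_meas [measurable]: "\<And>i. f i \<in> borel_measurable (rec_space n)"
    and g_meas [measurable]: "\<And>i. g i \<in> borel_measurable (rec_space n)"
    and f_nonneg: "\<And>i x. 0 \<le> f i x" and g_nonneg: "\<And>i y. 0 \<le> g i y"
    and f_one: "\<And>i. (\<integral>\<^sup>+x. ennreal (f i x) \<partial>src_block n mu s) = 1"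
    and g_one: "\<And>i. (\<integral>\<^sup>+y. ennreal (g i y) \<partial>src_block n mu \<sigma>) = 1"
begin

abbreviation "p \<equiv> src_block n mu s"
abbreviation "q \<equiv> src_block n mu \<sigma>"
abbreviation "msgs \<equiv> {..<L} \<times> {..<M}"

sublocale p: prob_space p by (rule prob_space_src_block[OF s_pos])
sublocale q: prob_space q by (rule prob_space_src_block[OF \<sigma>_pos])

text \<open>The encoder is a likelihood encoder whose weights are capped so that
  \<open>e i x \<le> f i x / (L M)\<close>; the missing mass goes to the extra message \<open>M\<close>. The decoder
  thins \<open>g i\<close> by \<open>r\<close>, which keeps the total output density \<open>G\<close> of the
  accepted part below 1, and in all other cases draws from \<open>h\<close>, the normalized deficit \<open>1 - G\<close>.
  Hence the output law is exactly \<open>q\<close>, and the accepted part is dominated by the ideal joint law.\<close>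

definition "Q k x = (\<Sum>j<M. f (k, j) x) / M"
definition "Qh y = (\<Sum>i\<in>msgs. g i y) / (L * M)"
definition "r y = 1 / max 1 (Qh y)"
definition "e i x = f i x / (L * M * max 1 (Q (fst i) x))"
definition "w i = (\<integral>x. e i x \<partial>p)"
definition "b i = (\<integral>y. g i y * r y \<partial>q)"
definition "G y = (\<Sum>i\<in>msgs. w i * (g i y * r y))"
definition "\<delta> = 1 - (\<Sum>i\<in>msgs. w i * b i)"
definition "h y = (if \<delta> = 0 then 1 else (1 - G y) / \<delta>)"
definition "bad x = 1 - (\<Sum>i\<in>msgs. e i x * b i)"

text \<open>\<open>e\<close> contains the seed probability \<open>1 / L\<close>; conditioning on the
  seed cancels it, hence the factor \<open>L\<close>.\<close>

definition "enc x k = embed_pmf (\<lambda>j. if j < M then L * e (k, j) x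
   else if j = M then 1 - Q k x / max 1 (Q k x) else 0)"
definition "dec j k = density q (\<lambda>y. ennreal (if j < M then g (k, j) y * r y + (1 - b (k, j)) * h y else h y))"

lemma measurable_defs [measurable]:
  "Q k \<in> borel_measurable (rec_space n)" "Qh \<in> borel_measurable (rec_space n)"
  "r \<in> borel_measurable (rec_space n)" "e i \<in> borel_measurable (rec_space n)"
  "G \<in> borel_measurable (rec_space n)" "h \<in> borel_measurable (rec_space n)"
  "bad \<in> borel_measurable (rec_space n)"
proof -
  show [measurable]: "Q k \<in> borel_measurable (rec_space n)" for k unfolding Q_def[abs_def] by measurable
  show [measurable]: "Qh \<in> borel_measurable (rec_space n)" unfolding Qh_def[abs_def] by measurable
  show [measurable]: "r \<in> borel_measurable (rec_space n)" unfolding r_def[abs_def] by measurable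
  show [measurable]: "e i \<in> borel_measurable (rec_space n)" for i unfolding e_def[abs_def] by measurable
  show [measurable]: "G \<in> borel_measurable (rec_space n)" unfolding G_def[abs_def] by measurable
  show "h \<in> borel_measurable (rec_space n)" unfolding h_def[abs_def] by measurable
  show "bad \<in> borel_measurable (rec_space n)" unfolding bad_def[abs_def] by measurable
qed

lemma Q_nonneg: "0 \<le> Q k x" and Qh_nonneg: "0 \<le> Qh y"
  unfolding Q_def Qh_def using f_nonneg g_nonneg by (auto intro!: divide_nonneg_nonneg sum_nonneg)

lemma r_bounds: "0 \<le> r y" "r y \<le> 1"
  by (auto simp: r_def divide_simps)

lemma e_nonneg: "0 \<le> e i x"
  unfolding e_def using f_nonneg by (auto intro!: divide_nonneg_nonneg mult_nonneg_nonneg)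

lemma e_le: "e i x \<le> f i x / (L * M)"
  unfolding e_def using L_pos M_pos f_nonneg by (intro divide_left_mono) auto

lemma sum_e: "(\<Sum>j<M. L * e (k, j) x) = Q k x / max 1 (Q k x)"
  using L_pos M_pos by (simp add: e_def Q_def sum_divide_distrib mult.assoc)

lemma Q_ratio_le: "Q k x / max 1 (Q k x) \<le> 1"
  using Q_nonneg[of k x] by (auto simp: divide_simps max_def)

lemma integrable_f: "integrable p (f i)" and integral_f: "(\<integral>x. f i x \<partial>p) = 1"
proof -
  show i: "integrable p (f i)" by (rule integrableI_nonneg) (use f_nonneg f_one in auto)
  show "(\<integral>x. f i x \<partial>p) = 1"
    using f_one[of i] f_nonneg by (subst (asm) nn_integral_eq_integral[OF i]) auto
qed

lemma integrable_g: "integrable q (g i)" and integral_g: "(\<integral>y. g i y \<partial>q) = 1"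
proof -
  show i: "integrable q (g i)" by (rule integrableI_nonneg) (use g_nonneg g_one in auto)
  show "(\<integral>y. g i y \<partial>q) = 1"
    using g_one[of i] g_nonneg by (subst (asm) nn_integral_eq_integral[OF i]) auto
qed

lemma integrable_e: "integrable p (e i)"
proof (rule Bochner_Integration.integrable_bound)
  show "integrable p (\<lambda>x. f i x / (L * M))" using integrable_f by simp
  show "AE x in p. norm (e i x) \<le> norm (f i x / (L * M))"
    using e_le e_nonneg f_nonneg by auto
qed simp

lemma gr_le: "g i y * r y \<le> g i y" and gr_nonneg: "0 \<le> g i y * r y"
  using r_bounds g_nonneg[of i y] by (auto simp: mult_left_le)

lemma integrable_gr: "integrable q (\<lambda>y. g i y * r y)"
proof (rule Bochner_Integration.integrable_bound[OF integrable_g[of i]])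
  show "AE y in q. norm (g i y * r y) \<le> norm (g i y)"
    using gr_le gr_nonneg g_nonneg by auto
qed simp

lemma w_bounds: "0 \<le> w i" "w i \<le> 1 / (L * M)"
proof -
  show "0 \<le> w i" unfolding w_def using e_nonneg by simp
  have "w i \<le> (\<integral>x. f i x / (L * M) \<partial>p)"
    unfolding w_def using e_le integrable_e integrable_f by (intro integral_mono) auto
  then show "w i \<le> 1 / (L * M)" by (simp add: integral_f)
qed

lemma b_bounds: "0 \<le> b i" "b i \<le> 1"
proof -
  show "0 \<le> b i" unfolding b_def using gr_nonneg by simp
  have "b i \<le> (\<integral>y. g i y \<partial>q)"
    unfolding b_def using gr_le integrable_gr integrable_g by (intro integral_mono) auto
  then show "b i \<le> 1" by (simp add: integral_g)
qed

lemma G_bounds: "0 \<le> G y" "G y \<le> 1"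
proof -
  show "0 \<le> G y" unfolding G_def by (intro sum_nonneg mult_nonneg_nonneg[OF w_bounds(1) gr_nonneg])
  have "G y \<le> (\<Sum>i\<in>msgs. 1 / (L * M) * (g i y * r y))"
    unfolding G_def using w_bounds gr_nonneg by (intro sum_mono mult_right_mono) auto
  also have "\<dots> = Qh y * r y"
    by (simp add: Qh_def sum_distrib_right sum_divide_distrib)
  also have "\<dots> \<le> 1" using Qh_nonneg[of y] by (auto simp: r_def max_def divide_simps)
  finally show "G y \<le> 1" .
qed

lemma integrable_G: "integrable q G" and integral_G: "(\<integral>y. 1 - G y \<partial>q) = \<delta>"
proof -
  show i: "integrable q G" unfolding G_def[abs_def] using integrable_gr by simp
  have "(\<integral>y. G y \<partial>q) = (\<Sum>i\<in>msgs. w i * b i)"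
    unfolding G_def[abs_def] b_def using integrable_gr by (simp add: Bochner_Integration.integral_sum)
  then show "(\<integral>y. 1 - G y \<partial>q) = \<delta>" using i by (simp add: \<delta>_def q.prob_space[simplified])
qed

lemma \<delta>_nonneg: "0 \<le> \<delta>"
  unfolding integral_G[symmetric] using G_bounds by simp

lemma h_nonneg: "0 \<le> h y"
  using G_bounds[of y] \<delta>_nonneg by (simp add: h_def)

text \<open>If \<open>\<delta> = 0\<close>, the nonnegative function \<open>1 - G\<close> has
  integral zero and vanishes almost everywhere, so the default value 1 in \<open>h_def\<close> does
  no harm.\<close>

lemma \<delta>_h: "AE y in q. \<delta> * h y = 1 - G y"
proof (cases "\<delta> = 0")
  case True
  then have "AE y in q. 1 - G y = 0"
    using integral_nonneg_eq_0_iff_AE[of q "\<lambda>y. 1 - G y"] integral_G integrable_G G_bounds by auto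
  then show ?thesis using True by simp
qed (simp add: h_def)

lemma h_one: "(\<integral>\<^sup>+y. ennreal (h y) \<partial>q) = 1"
proof (cases "\<delta> = 0")
  case True
  then show ?thesis by (simp add: h_def q.emeasure_space_1[simplified])
next
  case False
  then have "integrable q h" "(\<integral>y. h y \<partial>q) = 1"
    unfolding h_def[abs_def] using integrable_G integral_G by simp_all
  then show ?thesis using h_nonneg by (simp add: nn_integral_eq_integral)
qed

lemma sum_e_msgs: "(\<Sum>i\<in>msgs. e i x) + (\<Sum>k<L. (1 - Q k x / max 1 (Q k x)) / L) = 1"
proof -
  have "(\<Sum>i\<in>msgs. e i x) = (\<Sum>k<L. \<Sum>j<M. e (k, j) x)"
    by (simp add: sum.cartesian_product)
  also have "\<dots> = (\<Sum>k<L. Q k x / max 1 (Q k x) / L)"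
    using L_pos by (simp add: sum_e[symmetric] sum_distrib_left[symmetric])
  finally show ?thesis
    using L_pos by (simp add: sum.distrib[symmetric] add_divide_distrib[symmetric] sum_divide_distrib[symmetric]
        sum_subtractf diff_divide_distrib)
qed

text \<open>\<open>bad x\<close> is the probability, given the source block, that the reproduction
  is drawn from \<open>h\<close>. The first sum collects rejections by thinning, the second the use
  of the extra message.\<close>

lemma bad_eq: "bad x = (\<Sum>i\<in>msgs. e i x * (1 - b i)) + (\<Sum>k<L. (1 - Q k x / max 1 (Q k x)) / L)"
  using sum_e_msgs[of x] by (simp add: bad_def right_diff_distrib sum_subtractf)

lemma bad_bounds: "0 \<le> bad x" "bad x \<le> 1"
proof -
  show "0 \<le> bad x" unfolding bad_eq using e_nonneg b_bounds Q_ratio_le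
    by (intro add_nonneg_nonneg sum_nonneg mult_nonneg_nonneg divide_nonneg_nonneg) auto
  show "bad x \<le> 1" unfolding bad_def using e_nonneg b_bounds by (auto intro!: sum_nonneg)
qed

text \<open>The total probability of a repair thus equals the missing output mass in
  \<open>integral_G\<close>; this balance makes the repaired output law exact.\<close>

lemma integrable_bad: "integrable p bad" and integral_bad: "(\<integral>x. bad x \<partial>p) = \<delta>"
  unfolding bad_def[abs_def] \<delta>_def w_def using integrable_e
  by (simp_all add: p.prob_space[simplified] Bochner_Integration.integral_sum)

lemma pmf_enc: "pmf (enc x k) j = (if j < M then L * e (k, j) x
   else if j = M then 1 - Q k x / max 1 (Q k x) else 0)"
  and set_enc: "set_pmf (enc x k) \<subseteq> {..<Suc M}"
proof -
  let ?F = "\<lambda>j. if j < M then L * e (k, j) x else if j = M then 1 - Q k x / max 1 (Q k x) else 0"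
  have nonneg: "0 \<le> ?F j" for j
    using e_nonneg Q_ratio_le[of k x] by simp
  have "(\<integral>\<^sup>+j. ennreal (?F j) \<partial>count_space UNIV) = (\<Sum>j\<in>{..<Suc M}. ennreal (?F j))"
    by (rule nn_integral_count_space') auto
  also have "\<dots> = ennreal (\<Sum>j<Suc M. ?F j)"
    using nonneg by (intro sum_ennreal)
  also have "(\<Sum>j<Suc M. ?F j) = 1"
    using sum_e[of k x] by simp
  finally have one: "(\<integral>\<^sup>+j. ennreal (?F j) \<partial>count_space UNIV) = 1" by simp
  show "pmf (enc x k) j = ?F j"
    unfolding enc_def by (rule pmf_embed_pmf[OF nonneg one])
  show "set_pmf (enc x k) \<subseteq> {..<Suc M}"
    unfolding enc_def set_embed_pmf[OF nonneg one] by auto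
qed

lemma nn_integral_gr_bh:
  assumes [measurable]: "\<psi> \<in> borel_measurable (rec_space n)"
  shows "(\<integral>\<^sup>+y. \<psi> y \<partial>dec j k) = (if j < M then
      (\<integral>\<^sup>+y. \<psi> y * ennreal (g (k, j) y * r y) \<partial>q) + ennreal (1 - b (k, j)) * (\<integral>\<^sup>+y. \<psi> y * ennreal (h y) \<partial>q)
     else (\<integral>\<^sup>+y. \<psi> y * ennreal (h y) \<partial>q))"
proof (cases "j < M")
  case True
  have "(\<integral>\<^sup>+y. \<psi> y \<partial>dec j k) = (\<integral>\<^sup>+y. \<psi> y * ennreal (g (k, j) y * r y) + ennreal (1 - b (k, j)) * (\<psi> y * ennreal (h y)) \<partial>q)"
    unfolding dec_def using True gr_nonneg h_nonneg b_bounds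
    by (subst nn_integral_density) (auto simp: ennreal_plus ennreal_mult distrib_left mult_ac intro!: nn_integral_cong)
  also have "\<dots> = (\<integral>\<^sup>+y. \<psi> y * ennreal (g (k, j) y * r y) \<partial>q) + ennreal (1 - b (k, j)) * (\<integral>\<^sup>+y. \<psi> y * ennreal (h y) \<partial>q)"
    by (simp add: nn_integral_add nn_integral_cmult)
  finally show ?thesis using True by simp
next
  case False
  then show ?thesis unfolding dec_def by (subst nn_integral_density) (auto simp: mult.commute)
qed

lemma valid: "valid_code n mu s L (Suc M) enc dec"
  unfolding valid_code_def
proof (intro conjI allI)
  show "set_pmf (enc x k) \<subseteq> {..<Suc M}" for x k by (rule set_enc)
  show "(\<lambda>x. pmf (enc x k) j) \<in> borel_measurable p" for k j
    unfolding pmf_enc by measurable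
  show "sets (dec j k) = sets (rec_space n)" for j k by (simp add: dec_def)
  show "prob_space (dec j k)" for j k
  proof
    have "emeasure (dec j k) (space (dec j k)) = (\<integral>\<^sup>+y. 1 \<partial>dec j k)" by simp
    also have "\<dots> = 1"
    proof (cases "j < M")
      case True
      have "(\<integral>\<^sup>+y. ennreal (g (k, j) y * r y) \<partial>q) = ennreal (b (k, j))"
        unfolding b_def using gr_nonneg by (intro nn_integral_eq_integral integrable_gr) auto
      then show ?thesis
        using True b_bounds by (subst nn_integral_gr_bh) (simp_all add: h_one ennreal_plus[symmetric] del: ennreal_plus)
    next
      case False
      then show ?thesis by (subst nn_integral_gr_bh) (simp_all add: h_one)
    qed
    finally show "emeasure (dec j k) (space (dec j k)) = 1" .
  qed
qed (use n_pos L_pos in auto)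

sublocale C: coding_scheme n L "Suc M" mu s enc dec
  by unfold_locales (rule valid s_pos)+

abbreviation "cj \<equiv> code_joint n mu s L enc dec"

text \<open>A draw from \<open>h\<close> ignores seed and message, so all failures merge into one
  term in which source and reproduction are integrated independently.\<close>

lemma nn_integral_mixture:
  assumes \<psi> [measurable]: "\<psi> \<in> borel_measurable (rec_space n \<Otimes>\<^sub>M rec_space n)"
  shows "(\<integral>\<^sup>+z. \<psi> z \<partial>cj) =
    (\<Sum>i\<in>msgs. \<integral>\<^sup>+x. ennreal (e i x) * (\<integral>\<^sup>+y. \<psi> (x, y) * ennreal (g i y * r y) \<partial>q) \<partial>p)
    + (\<integral>\<^sup>+x. ennreal (bad x) * (\<integral>\<^sup>+y. \<psi> (x, y) * ennreal (h y) \<partial>q) \<partial>p)"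
proof -
  define A where "A = (\<lambda>i x. \<integral>\<^sup>+y. \<psi> (x, y) * ennreal (g i y * r y) \<partial>q)"
  define H where "H = (\<lambda>x. \<integral>\<^sup>+y. \<psi> (x, y) * ennreal (h y) \<partial>q)"
  have A_meas [measurable]: "A i \<in> borel_measurable (rec_space n)" for i
    unfolding A_def by measurable
  have H_meas [measurable]: "H \<in> borel_measurable (rec_space n)"
    unfolding H_def by measurable
  have "(\<integral>\<^sup>+z. \<psi> z \<partial>cj) = (\<integral>\<^sup>+x. (\<Sum>k<L. \<Sum>j<Suc M. ennreal (pmf (enc x k) j / L) * (\<integral>\<^sup>+y. \<psi> (x, y) \<partial>dec j k)) \<partial>p)"
    by (rule C.nn_integral_code_joint[OF \<psi>])
  also have "\<dots> = (\<integral>\<^sup>+x. (\<Sum>i\<in>msgs. ennreal (e i x) * A i x) + ennreal (bad x) * H x \<partial>p)"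
  proof (rule nn_integral_cong)
    fix x assume x: "x \<in> space p"
    have d: "(\<integral>\<^sup>+y. \<psi> (x, y) \<partial>dec j k) = (if j < M then A (k, j) x + ennreal (1 - b (k, j)) * H x else H x)" for j k
      unfolding A_def H_def using x by (intro nn_integral_gr_bh) (simp add: measurable_compose[OF measurable_Pair1' \<psi>])
    have "(\<Sum>k<L. \<Sum>j<Suc M. ennreal (pmf (enc x k) j / L) * (\<integral>\<^sup>+y. \<psi> (x, y) \<partial>dec j k)) =
      (\<Sum>k<L. (\<Sum>j<M. ennreal (e (k, j) x) * (A (k, j) x + ennreal (1 - b (k, j)) * H x))
        + ennreal ((1 - Q k x / max 1 (Q k x)) / L) * H x)"
      unfolding d pmf_enc using L_pos by simp
    also have "\<dots> = (\<Sum>k<L. \<Sum>j<M. ennreal (e (k, j) x) * A (k, j) x)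
        + ((\<Sum>k<L. \<Sum>j<M. ennreal (e (k, j) x * (1 - b (k, j)))) + (\<Sum>k<L. ennreal ((1 - Q k x / max 1 (Q k x)) / L))) * H x"
      using e_nonneg b_bounds
      by (simp add: sum.distrib distrib_left distrib_right sum_distrib_right ennreal_mult mult.assoc add.assoc del: sum_ennreal)
    also have "(\<Sum>k<L. \<Sum>j<M. ennreal (e (k, j) x * (1 - b (k, j)))) = (\<Sum>i\<in>msgs. ennreal (e i x * (1 - b i)))"
      by (simp add: sum.cartesian_product split_beta del: sum_ennreal)
    also have "\<dots> = ennreal (\<Sum>i\<in>msgs. e i x * (1 - b i))"
      using e_nonneg b_bounds by (intro sum_ennreal mult_nonneg_nonneg) auto
    also have "(\<Sum>k<L. ennreal ((1 - Q k x / max 1 (Q k x)) / L)) = ennreal (\<Sum>k<L. (1 - Q k x / max 1 (Q k x)) / L)"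
      using Q_ratio_le by (intro sum_ennreal divide_nonneg_nonneg) auto
    also have "ennreal (\<Sum>i\<in>msgs. e i x * (1 - b i)) + \<dots> = ennreal (bad x)"
      unfolding bad_eq using e_nonneg b_bounds Q_ratio_le
      by (intro ennreal_plus[symmetric] sum_nonneg mult_nonneg_nonneg divide_nonneg_nonneg) auto
    also have "(\<Sum>k<L. \<Sum>j<M. ennreal (e (k, j) x) * A (k, j) x) = (\<Sum>i\<in>msgs. ennreal (e i x) * A i x)"
      by (simp add: sum.cartesian_product split_beta)
    finally show "(\<Sum>k<L. \<Sum>j<Suc M. ennreal (pmf (enc x k) j / L) * (\<integral>\<^sup>+y. \<psi> (x, y) \<partial>dec j k)) =
      (\<Sum>i\<in>msgs. ennreal (e i x) * A i x) + ennreal (bad x) * H x" .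
  qed
  also have "\<dots> = (\<Sum>i\<in>msgs. \<integral>\<^sup>+x. ennreal (e i x) * A i x \<partial>p) + (\<integral>\<^sup>+x. ennreal (bad x) * H x \<partial>p)"
    by (simp add: nn_integral_add nn_integral_sum)
  finally show ?thesis unfolding A_def H_def .
qed

lemma nn_integral_e: "(\<integral>\<^sup>+x. ennreal (e i x) \<partial>p) = ennreal (w i)"
  unfolding w_def using e_nonneg by (intro nn_integral_eq_integral integrable_e) auto

lemma nn_integral_bad: "(\<integral>\<^sup>+x. ennreal (bad x) \<partial>p) = ennreal \<delta>"
  unfolding integral_bad[symmetric] using bad_bounds by (intro nn_integral_eq_integral integrable_bad) auto

text \<open>The accepted part has output density \<open>G\<close>, and the repair adds
  \<open>\<delta> * h y = 1 - G y\<close> almost everywhere.\<close>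

lemma nn_integral_cj_output:
  assumes \<phi> [measurable]: "\<phi> \<in> borel_measurable (rec_space n)"
  shows "(\<integral>\<^sup>+z. \<phi> (snd z) \<partial>cj) = (\<integral>\<^sup>+y. \<phi> y \<partial>q)"
proof -
  have "(\<integral>\<^sup>+z. \<phi> (snd z) \<partial>cj) = (\<Sum>i\<in>msgs. ennreal (w i) * (\<integral>\<^sup>+y. \<phi> y * ennreal (g i y * r y) \<partial>q))
      + ennreal \<delta> * (\<integral>\<^sup>+y. \<phi> y * ennreal (h y) \<partial>q)"
    by (subst nn_integral_mixture) (simp_all add: nn_integral_multc nn_integral_e nn_integral_bad)
  also have "\<dots> = (\<integral>\<^sup>+y. (\<Sum>i\<in>msgs. ennreal (w i) * (\<phi> y * ennreal (g i y * r y))) + ennreal \<delta> * (\<phi> y * ennreal (h y)) \<partial>q)"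
    by (simp add: nn_integral_add nn_integral_sum nn_integral_cmult)
  also have "\<dots> = (\<integral>\<^sup>+y. \<phi> y \<partial>q)"
  proof (rule nn_integral_cong_AE)
    show "AE y in q. (\<Sum>i\<in>msgs. ennreal (w i) * (\<phi> y * ennreal (g i y * r y))) + ennreal \<delta> * (\<phi> y * ennreal (h y)) = \<phi> y"
      using \<delta>_h
    proof eventually_elim
      case (elim y)
      have "(\<Sum>i\<in>msgs. ennreal (w i) * (\<phi> y * ennreal (g i y * r y))) = \<phi> y * (\<Sum>i\<in>msgs. ennreal (w i * (g i y * r y)))"
        unfolding ennreal_mult[OF w_bounds(1) gr_nonneg] sum_distrib_left
        by (intro sum.cong refl) (simp only: mult_ac)
      also have "(\<Sum>i\<in>msgs. ennreal (w i * (g i y * r y))) = ennreal (G y)"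
        unfolding G_def by (intro sum_ennreal mult_nonneg_nonneg[OF w_bounds(1) gr_nonneg])
      also have "ennreal \<delta> * (\<phi> y * ennreal (h y)) = \<phi> y * ennreal (1 - G y)"
        unfolding elim[symmetric] using \<delta>_nonneg h_nonneg by (simp add: ennreal_mult mult_ac)
      moreover have "ennreal (G y) + ennreal (1 - G y) = 1"
        using G_bounds[of y] by (simp add: ennreal_plus[symmetric] del: ennreal_plus)
      ultimately show ?case by (simp add: distrib_left[symmetric])
    qed
  qed
  finally show ?thesis .
qed

lemma distr_cj_output: "distr cj (rec_space n) snd = q"
  by (rule C.distr_snd_eqI) (simp_all add: nn_integral_cj_output)

text \<open>Uncapping the encoder and unthinning the decoder can only enlarge the accepted part,
  which leaves the ideal joint law. On the repaired part, splitting \<open>d\<close> into a function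
  of \<open>x\<close> plus one of \<open>y\<close> reduces everything to the two marginal defects
  \<open>bad\<close> and \<open>1 - G\<close>.\<close>

lemma nn_integral_cj_le:
  assumes d [measurable]: "d \<in> borel_measurable (rec_space n \<Otimes>\<^sub>M rec_space n)"
    and \<alpha> [measurable]: "\<alpha> \<in> borel_measurable (rec_space n)" and \<beta> [measurable]: "\<beta> \<in> borel_measurable (rec_space n)"
    and le: "\<And>x y. d (x, y) \<le> \<alpha> x + \<beta> y"
  shows "(\<integral>\<^sup>+z. d z \<partial>cj) \<le> ennreal (1 / (L * M)) *
      (\<Sum>i\<in>msgs. \<integral>\<^sup>+x. ennreal (f i x) * (\<integral>\<^sup>+y. d (x, y) * ennreal (g i y) \<partial>q) \<partial>p)
    + ((\<integral>\<^sup>+x. ennreal (bad x) * \<alpha> x \<partial>p) + (\<integral>\<^sup>+y. \<beta> y * ennreal (1 - G y) \<partial>q))"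
proof -
  let ?W = "\<Sum>i\<in>msgs. \<integral>\<^sup>+x. ennreal (e i x) * (\<integral>\<^sup>+y. d (x, y) * ennreal (g i y * r y) \<partial>q) \<partial>p" and ?H = "\<integral>\<^sup>+y. \<beta> y * ennreal (h y) \<partial>q"
  have "?W \<le>
    (\<Sum>i\<in>msgs. \<integral>\<^sup>+x. ennreal (1 / (L * M)) * (ennreal (f i x) * (\<integral>\<^sup>+y. d (x, y) * ennreal (g i y) \<partial>q)) \<partial>p)"
  proof (intro sum_mono nn_integral_mono)
    fix i x
    have "ennreal (e i x) \<le> ennreal (1 / (L * M)) * ennreal (f i x)"
      using e_le[of i x] f_nonneg by (subst ennreal_mult[symmetric]) (auto intro!: ennreal_leI)
    then show "ennreal (e i x) * (\<integral>\<^sup>+y. d (x, y) * ennreal (g i y * r y) \<partial>q) \<le>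
      ennreal (1 / (L * M)) * (ennreal (f i x) * (\<integral>\<^sup>+y. d (x, y) * ennreal (g i y) \<partial>q))"
      unfolding mult.assoc[symmetric] by (intro mult_mono nn_integral_mono mult_left_mono ennreal_leI gr_le) auto
  qed
  also have "\<dots> = ennreal (1 / (L * M)) * (\<Sum>i\<in>msgs. \<integral>\<^sup>+x. ennreal (f i x) * (\<integral>\<^sup>+y. d (x, y) * ennreal (g i y) \<partial>q) \<partial>p)"
    by (simp add: sum_distrib_left nn_integral_cmult)
  finally have 1: "?W \<le> \<dots>" .
  have "(\<integral>\<^sup>+x. ennreal (bad x) * (\<integral>\<^sup>+y. d (x, y) * ennreal (h y) \<partial>q) \<partial>p) \<le>
    (\<integral>\<^sup>+x. ennreal (bad x) * (\<alpha> x + ?H) \<partial>p)"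
  proof (intro nn_integral_mono mult_left_mono)
    fix x
    have "(\<integral>\<^sup>+y. d (x, y) * ennreal (h y) \<partial>q) \<le> (\<integral>\<^sup>+y. \<alpha> x * ennreal (h y) + \<beta> y * ennreal (h y) \<partial>q)"
      unfolding distrib_right[symmetric] by (intro nn_integral_mono mult_right_mono le) auto
    also have "\<dots> = \<alpha> x + ?H"
      by (simp add: nn_integral_add nn_integral_cmult h_one)
    finally show "(\<integral>\<^sup>+y. d (x, y) * ennreal (h y) \<partial>q) \<le> \<dots>" .
  qed auto
  also have "\<dots> = (\<integral>\<^sup>+x. ennreal (bad x) * \<alpha> x \<partial>p) + ennreal \<delta> * ?H"
    by (simp add: distrib_left nn_integral_add nn_integral_multc nn_integral_bad)
  also have "ennreal \<delta> * ?H = (\<integral>\<^sup>+y. \<beta> y * ennreal (\<delta> * h y) \<partial>q)"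
    using \<delta>_nonneg h_nonneg by (subst nn_integral_cmult[symmetric]) (auto simp: ennreal_mult mult_ac)
  also have "\<dots> = (\<integral>\<^sup>+y. \<beta> y * ennreal (1 - G y) \<partial>q)"
    using \<delta>_h by (intro nn_integral_cong_AE) auto
  finally show ?thesis
    unfolding nn_integral_mixture[OF d] using 1 by (intro add_mono)
qed

end

section \<open>Gaussian integrals and codes with Gaussian output\<close>

lemma nn_integral_gauss_square:
  assumes s: "0 < s" and c: "0 \<le> c"
  shows "(\<integral>\<^sup>+x. ennreal ((a + b * x)\<^sup>2 + c) \<partial>gauss m s) = ennreal ((a + b * m)\<^sup>2 + b\<^sup>2 * s\<^sup>2 + c)"
proof -
  interpret prob_space "gauss m s" by (rule prob_space_gauss[OF s])
  have odd: "has_bochner_integral (gauss m s) (\<lambda>x. x - m) 0"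
    using normal_moment_odd[OF s, of m 0] unfolding gauss_def
    by (intro has_bochner_integral_density) auto
  have "has_bochner_integral (gauss m s)
      (\<lambda>x. ((a + b * m)\<^sup>2 + c) + (2 * (a + b * m) * b) * (x - m) + b\<^sup>2 * (x - m)\<^sup>2)
      (((a + b * m)\<^sup>2 + c) + (2 * (a + b * m) * b) * 0 + b\<^sup>2 * s\<^sup>2)"
    using prob_space
    by (intro has_bochner_integral_add has_bochner_integral_mult_right odd gauss_moments(1)[OF s])
      (auto simp: has_bochner_integral_iff)
  moreover have "(\<lambda>x. ((a + b * m)\<^sup>2 + c) + (2 * (a + b * m) * b) * (x - m) + b\<^sup>2 * (x - m)\<^sup>2) = (\<lambda>x. (a + b * x)\<^sup>2 + c)"
    by (auto simp: power2_eq_square algebra_simps)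
  ultimately have "has_bochner_integral (gauss m s) (\<lambda>x. (a + b * x)\<^sup>2 + c) ((a + b * m)\<^sup>2 + b\<^sup>2 * s\<^sup>2 + c)"
    by (simp add: add_ac)
  then show ?thesis
    using c by (subst nn_integral_eq_integral) (auto simp: has_bochner_integral_iff simp del: ennreal_plus)
qed

text \<open>Only the factor at \<open>t\<close> interacts with a function of letter
  \<open>t\<close>; the other densities integrate to 1.\<close>

lemma nn_integral_tilted:
  fixes h :: "nat \<Rightarrow> 'a \<Rightarrow> ennreal"
  assumes N: "prob_space N" and t: "t < n"
    and h: "\<And>i. h i \<in> borel_measurable N" and one: "\<And>i. (\<integral>\<^sup>+x. h i x \<partial>N) = 1"
    and \<phi>: "\<phi> \<in> borel_measurable N"
  shows "(\<integral>\<^sup>+x. (\<Prod>i<n. h i (x i)) * \<phi> (x t) \<partial>PiM {..<n} (\<lambda>_. N)) = (\<integral>\<^sup>+x. h t x * \<phi> x \<partial>N)"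
proof -
  interpret N: prob_space N by (rule N)
  interpret product_sigma_finite "\<lambda>_::nat. N" ..
  have "(\<Prod>i<n. h i (x i)) * \<phi> (x t) = (\<Prod>i<n. h i (x i) * (if i = t then \<phi> (x i) else 1))" for x :: "nat \<Rightarrow> 'a"
    using t by (simp add: prod.distrib prod.delta)
  then have "(\<integral>\<^sup>+x. (\<Prod>i<n. h i (x i)) * \<phi> (x t) \<partial>PiM {..<n} (\<lambda>_. N))
      = (\<Prod>i<n. \<integral>\<^sup>+x. h i x * (if i = t then \<phi> x else 1) \<partial>N)"
    using h \<phi>
    by (simp add: product_nn_integral_prod[where f="\<lambda>i x. h i x * (if i = t then \<phi> x else 1)"])
  also have "\<dots> = (\<Prod>i<n. if i = t then \<integral>\<^sup>+x. h i x * \<phi> x \<partial>N else 1)"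
    by (intro prod.cong) (auto simp: one)
  also have "\<dots> = (\<integral>\<^sup>+x. h t x * \<phi> x \<partial>N)"
    using t by (simp add: prod.delta)
  finally show ?thesis .
qed

lemma (in coding_scheme) achievable_gauss_output:
  fixes R Rc P D \<sigma> :: real
  assumes rate: "ln (real M) / real n \<le> R" and rate_c: "ln (real L) / real n \<le> Rc"
    and \<sigma>: "0 < \<sigma>" "psi s \<sigma> \<le> P" and D: "0 \<le> D"
    and out_law: "distr cj (rec_space n) snd = src_block n mu \<sigma>"
    and dist: "(\<Sum>t<n. \<integral>\<^sup>+z. ennreal ((fst z t - snd z t)\<^sup>2) \<partial>cj) \<le> ennreal (n * D)"
  shows "achievable mu s R Rc P D"
  unfolding achievable_def
proof (intro exI conjI)
  show "valid_code n mu s L M enc dec" by (rule valid)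
  show "ereal (1 / real n) * enn2ereal (\<Sum>t<n. \<integral>\<^sup>+z. ennreal ((fst z t - snd z t)\<^sup>2) \<partial>cj) \<le> ereal D"
    using dist ereal_average_le_iff[OF n_pos D] by simp
  show q: "prob_space (gauss mu \<sigma>)" "sets (gauss mu \<sigma>) = sets borel"
    using prob_space_gauss[OF \<sigma>(1)] by auto
  show iid: "distr cj (rec_space n) snd = PiM {..<n} (\<lambda>_. gauss mu \<sigma>)"
    using out_law by (simp add: src_block_def)
  have "(\<Sum>t<n. KL_div (distr cj borel (\<lambda>z. snd z t)) (gauss mu s)) = (\<Sum>t<n. KL_div (gauss mu \<sigma>) (gauss mu s))"
    by (intro sum.cong refl) (simp add: distr_component_cj[OF q iid])
  also have "ereal (1 / real n) * \<dots> \<le> ereal P"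
    using KL_average_le_iff[OF n_pos] KL_div_gauss[OF s_pos \<sigma>(1)] \<sigma>(2) n_pos by simp
  finally show "ereal (1 / real n) * (\<Sum>t<n. KL_div (distr cj borel (\<lambda>z. snd z t)) (gauss mu s)) \<le> ereal P" .
qed (use rate rate_c in auto)

text \<open>At rate zero there is no positive rate below \<open>R\<close> for random coding. One
  letter, one message and a reproduction independent of the source suffice, and \<open>xi\<close>
  vanishes at \<open>R = 0\<close>.\<close>

lemma achievable_rate_zero:
  assumes s: "0 < s" and R: "0 \<le> R" "0 \<le> Rc" and \<sigma>: "0 < \<sigma>" "psi s \<sigma> \<le> P" and D: "s\<^sup>2 + \<sigma>\<^sup>2 \<le> D"
  shows "achievable mu s R Rc P D"
proof -
  let ?q = "src_block 1 mu \<sigma>"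
  interpret q: prob_space ?q by (rule prob_space_src_block[OF \<sigma>(1)])
  interpret p: prob_space "src_block 1 mu s" by (rule prob_space_src_block[OF s])
  interpret coding_scheme 1 1 1 mu s "\<lambda>_ _. return_pmf 0" "\<lambda>_ _. ?q"
    by unfold_locales (use s q.prob_space_axioms in \<open>auto simp: valid_code_def\<close>)
  have joint: "(\<integral>\<^sup>+z. \<psi> z \<partial>cj) = (\<integral>\<^sup>+x. \<integral>\<^sup>+y. \<psi> (x, y) \<partial>?q \<partial>src_block 1 mu s)"
    if "\<psi> \<in> borel_measurable (rec_space 1 \<Otimes>\<^sub>M rec_space 1)" for \<psi>
    using nn_integral_code_joint[OF that] by simp
  have out_law: "distr cj (rec_space 1) snd = ?q"
  proof (rule distr_snd_eqI)
    fix \<phi> :: "(nat \<Rightarrow> real) \<Rightarrow> ennreal" assume [measurable]: "\<phi> \<in> borel_measurable (rec_space 1)"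
    have "(\<integral>\<^sup>+z. \<phi> (snd z) \<partial>cj) = (\<integral>\<^sup>+x. \<integral>\<^sup>+y. \<phi> (snd (x, y)) \<partial>?q \<partial>src_block 1 mu s)"
      by (rule joint) measurable
    then show "(\<integral>\<^sup>+z. \<phi> (snd z) \<partial>cj) = (\<integral>\<^sup>+y. \<phi> y \<partial>?q)"
      by (simp only: snd_conv nn_integral_const p.emeasure_space_1 mult_1_right)
  qed (rule sets_src_block)
  note tm = measurable_rec_space_component[OF zero_less_one]
  have inner: "(\<integral>\<^sup>+y. ennreal ((x - y)\<^sup>2) \<partial>gauss mu \<sigma>) = ennreal ((x - mu)\<^sup>2 + \<sigma>\<^sup>2)" for x
    using nn_integral_gauss_square[OF \<sigma>(1), where c=0 and a=x and b="-1" and m=mu] by simp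
  have meas: "(\<lambda>z. ennreal ((fst z 0 - snd z 0)\<^sup>2)) \<in> borel_measurable (rec_space 1 \<Otimes>\<^sub>M rec_space 1)"
    using measurable_compose[OF measurable_fst tm] measurable_compose[OF measurable_snd tm] by measurable
  have "(\<integral>\<^sup>+z. ennreal ((fst z 0 - snd z 0)\<^sup>2) \<partial>cj) = (\<integral>\<^sup>+x. \<integral>\<^sup>+y. ennreal ((x 0 - y 0)\<^sup>2) \<partial>?q \<partial>src_block 1 mu s)"
    by (subst joint[OF meas]) simp
  also have "\<dots> = (\<integral>\<^sup>+x. ennreal ((x 0 - mu)\<^sup>2 + \<sigma>\<^sup>2) \<partial>src_block 1 mu s)"
    using nn_integral_block_component[OF \<sigma>(1) zero_less_one, of "\<lambda>y. ennreal ((x - y)\<^sup>2)" mu for x]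
    by (simp add: inner)
  also have "\<dots> = (\<integral>\<^sup>+x. ennreal ((x - mu)\<^sup>2 + \<sigma>\<^sup>2) \<partial>gauss mu s)"
    by (rule nn_integral_block_component[OF s zero_less_one]) measurable
  also have "\<dots> = ennreal (s\<^sup>2 + \<sigma>\<^sup>2)"
    using nn_integral_gauss_square[OF s, where c="\<sigma>\<^sup>2" and a="- mu" and b=1 and m=mu] by simp
  finally have dist: "(\<integral>\<^sup>+z. ennreal ((fst z 0 - snd z 0)\<^sup>2) \<partial>cj) = ennreal (s\<^sup>2 + \<sigma>\<^sup>2)" .
  have "0 \<le> D" using order_trans[OF _ D, of 0] by simp
  moreover have "(\<Sum>t<1. \<integral>\<^sup>+z. ennreal ((fst z t - snd z t)\<^sup>2) \<partial>cj) \<le> ennreal (real 1 * D)"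
    using dist ennreal_leI[OF D] by simp
  ultimately show ?thesis
    using R by (intro achievable_gauss_output[OF _ _ \<sigma> _ out_law]) simp_all
qed

section \<open>Cost and size of the defect\<close>

context codebook begin

text \<open>Pointwise \<open>a \<le> K + a\<^sup>2 / K\<close> with \<open>a = (x t - mu)\<^sup>2\<close>: a small mass \<open>\<delta>\<close> can only carry
  a small second moment because the fourth moment is finite.\<close>

lemma nn_integral_le_truncated:
  assumes s': "0 < s'" and t: "t < n" and K: "0 < K"
    and c [measurable]: "c \<in> borel_measurable (rec_space n)" and c01: "\<And>x. 0 \<le> c x \<and> c x \<le> 1"
    and int: "(\<integral>\<^sup>+x. ennreal (c x) \<partial>src_block n mu s') = ennreal \<delta>"
  shows "(\<integral>\<^sup>+x. ennreal (c x * (2 * (x t - mu)\<^sup>2)) \<partial>src_block n mu s') \<le> ennreal (2 * K * \<delta> + 6 * s' ^ 4 / K)"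
proof -
  have tm [measurable]: "(\<lambda>x. x t) \<in> borel_measurable (rec_space n)"
    by (rule measurable_rec_space_component[OF t])
  have "(\<integral>\<^sup>+x. ennreal (c x * (2 * (x t - mu)\<^sup>2)) \<partial>src_block n mu s') \<le>
    (\<integral>\<^sup>+x. ennreal (2 * K) * ennreal (c x) + ennreal (2 / K) * ennreal ((x t - mu) ^ 4) \<partial>src_block n mu s')"
  proof (rule nn_integral_mono)
    fix x
    define a where "a = (x t - mu)\<^sup>2"
    have "0 \<le> (a - K)\<^sup>2 + a * K" using K by (simp add: a_def)
    then have "a * K \<le> K * K + a * a" by (simp add: power2_eq_square algebra_simps)
    then have "a \<le> K + a\<^sup>2 / K" using K by (simp add: field_simps power2_eq_square)
    then have "c x * a \<le> c x * (K + a\<^sup>2 / K)" using c01 by (intro mult_left_mono) auto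
    also have "\<dots> \<le> K * c x + a\<^sup>2 / K"
      using c01[of x] K mult_right_mono[of "c x" 1 "a\<^sup>2 / K"] by (simp add: algebra_simps)
    finally have "c x * (2 * a) \<le> 2 * K * c x + 2 / K * a\<^sup>2" by simp
    then have "ennreal (c x * (2 * a)) \<le> ennreal (2 * K * c x + 2 / K * a\<^sup>2)" by (rule ennreal_leI)
    also have "\<dots> = ennreal (2 * K) * ennreal (c x) + ennreal (2 / K) * ennreal (a\<^sup>2)"
      using K c01[of x] by (simp add: ennreal_mult[symmetric] ennreal_plus[symmetric] del: ennreal_plus)
    also have "a\<^sup>2 = (x t - mu) ^ 4" by (simp add: a_def power_mult[symmetric])
    finally show "ennreal (c x * (2 * (x t - mu)\<^sup>2)) \<le>
      ennreal (2 * K) * ennreal (c x) + ennreal (2 / K) * ennreal ((x t - mu) ^ 4)" by (simp add: a_def)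
  qed
  also have "\<dots> = ennreal (2 * K) * ennreal \<delta> + ennreal (2 / K) * (\<integral>\<^sup>+x. ennreal ((x t - mu) ^ 4) \<partial>src_block n mu s')"
    by (simp add: nn_integral_add nn_integral_cmult int)
  also have "(\<integral>\<^sup>+x. ennreal ((x t - mu) ^ 4) \<partial>src_block n mu s') = (\<integral>\<^sup>+x. ennreal ((x - mu) ^ 4) \<partial>gauss mu s')"
    by (rule nn_integral_block_component[OF s' t]) measurable
  also have "\<dots> = ennreal (3 * s' ^ 4)"
    using gauss_moments(2)[OF s', of mu] by (subst nn_integral_eq_integral) (auto simp: has_bochner_integral_iff)
  also have "ennreal (2 * K) * ennreal \<delta> + ennreal (2 / K) * ennreal (3 * s' ^ 4) = ennreal (2 * K * \<delta> + 6 * s' ^ 4 / K)"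
    using K \<delta>_nonneg by (simp add: ennreal_mult[symmetric] ennreal_plus[symmetric] del: ennreal_plus)
  finally show ?thesis .
qed

text \<open>The squared error is at most twice the sum of the squared deviations from
  \<open>mu\<close>, and each deviation is weighted by a defect of mass \<open>\<delta>\<close>.
  \<open>K\<close> is free: it is fixed first to make the fourth-moment term small, and
  \<open>\<delta>\<close> is then made small relative to it.\<close>

lemma distortion_bound:
  assumes t: "t < n" and K: "0 < K"
  shows "(\<integral>\<^sup>+z. ennreal ((fst z t - snd z t)\<^sup>2) \<partial>cj) \<le> ennreal (1 / (L * M)) *
      (\<Sum>i\<in>msgs. \<integral>\<^sup>+x. ennreal (f i x) * (\<integral>\<^sup>+y. ennreal ((x t - y t)\<^sup>2) * ennreal (g i y) \<partial>q) \<partial>p)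
    + ennreal (4 * K * \<delta> + 6 * (s ^ 4 + \<sigma> ^ 4) / K)"
proof -
  let ?A = "\<integral>\<^sup>+x. ennreal (bad x) * ennreal (2 * (x t - mu)\<^sup>2) \<partial>p" and ?B = "\<integral>\<^sup>+y. ennreal (2 * (y t - mu)\<^sup>2) * ennreal (1 - G y) \<partial>q"
  note tm = measurable_rec_space_component[OF t]
  have [measurable]: "(\<lambda>z. ennreal ((fst z t - snd z t)\<^sup>2)) \<in> borel_measurable (rec_space n \<Otimes>\<^sub>M rec_space n)"
    using measurable_compose[OF measurable_fst tm] measurable_compose[OF measurable_snd tm] by measurable
  have [measurable]: "(\<lambda>x. ennreal (2 * (x t - mu)\<^sup>2)) \<in> borel_measurable (rec_space n)"
    using tm by measurable
  have le: "ennreal ((x - y)\<^sup>2) \<le> ennreal (2 * (x - mu)\<^sup>2) + ennreal (2 * (y - mu)\<^sup>2)" for x y :: real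
  proof -
    have "(x - y)\<^sup>2 \<le> 2 * (x - mu)\<^sup>2 + 2 * (y - mu)\<^sup>2"
      using zero_le_power2[of "x + y - 2 * mu"] by (simp add: power2_eq_square algebra_simps)
    then show ?thesis by (simp add: ennreal_plus[symmetric] ennreal_leI del: ennreal_plus)
  qed
  have "?A \<le> ennreal (2 * K * \<delta> + 6 * s ^ 4 / K)"
    using nn_integral_le_truncated[OF s_pos t K, of bad] bad_bounds
    by (simp add: ennreal_mult nn_integral_bad)
  moreover have "?B \<le> ennreal (2 * K * \<delta> + 6 * \<sigma> ^ 4 / K)"
  proof -
    have "(\<integral>\<^sup>+y. ennreal (1 - G y) \<partial>q) = ennreal \<delta>"
      unfolding integral_G[symmetric] using G_bounds integrable_G by (intro nn_integral_eq_integral) auto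
    then show ?thesis
      using nn_integral_le_truncated[OF \<sigma>_pos t K, of "\<lambda>y. 1 - G y"] G_bounds
      by (simp add: ennreal_mult mult.commute)
  qed
  ultimately have "?A +
      ?B \<le>
      ennreal (2 * K * \<delta> + 6 * s ^ 4 / K) + ennreal (2 * K * \<delta> + 6 * \<sigma> ^ 4 / K)"
    by (rule add_mono)
  also have "\<dots> = ennreal (4 * K * \<delta> + 6 * (s ^ 4 + \<sigma> ^ 4) / K)"
    using K \<delta>_nonneg s_pos \<sigma>_pos
    by (subst ennreal_plus[symmetric]) (auto simp: add_divide_distrib algebra_simps)
  finally have *: "?A +
      ?B \<le> \<dots>" .
  have "(\<integral>\<^sup>+z. ennreal ((fst z t - snd z t)\<^sup>2) \<partial>cj) \<le> ennreal (1 / (L * M)) *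
      (\<Sum>i\<in>msgs. \<integral>\<^sup>+x. ennreal (f i x) * (\<integral>\<^sup>+y. ennreal ((fst (x, y) t - snd (x, y) t)\<^sup>2) * ennreal (g i y) \<partial>q) \<partial>p)
    + (?A +
      ?B)"
    by (rule nn_integral_cj_le) (measurable, simp only: fst_conv snd_conv le)
  then show ?thesis
    unfolding fst_conv snd_conv by (rule order_trans) (rule add_left_mono[OF *])
qed

text \<open>With \<open>a i = L * M * w i\<close> and \<open>b i\<close> the fractions kept by
  encoder and decoder, both in [0, 1], the inequality \<open>a i * b i \<ge> a i + b i - 1\<close>
  separates the two losses. Since \<open>u / max 1 u = 1 - max 0 (1 - u)\<close>, each loss is a
  covering deficit: one averaged over seeds, one for the whole codebook.\<close>

lemma \<delta>_le:
  "ennreal \<delta> \<le> ennreal (1 / L) * (\<Sum>k<L. \<integral>\<^sup>+x. ennreal (max 0 (1 - Q k x)) \<partial>p)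
    + (\<integral>\<^sup>+y. ennreal (max 0 (1 - Qh y)) \<partial>q)"
proof -
  let ?a = "\<lambda>k. \<integral>x. max 0 (1 - Q k x) \<partial>p"
  let ?b = "\<integral>y. max 0 (1 - Qh y) \<partial>q"
  define a where "a = (\<lambda>i. L * M * w i)"
  have LM: "0 < real L * real M" using L_pos M_pos by simp
  have intQ: "integrable p (Q k)" for k unfolding Q_def[abs_def] using integrable_f by simp
  have intQh: "integrable q Qh" unfolding Qh_def[abs_def] using integrable_g by simp
  have intm: "integrable p (\<lambda>x. max 0 (1 - Q k x))" for k using intQ by simp
  have intmh: "integrable q (\<lambda>x. max 0 (1 - Qh x))" using intQh by simp
  have ratio: "u / max 1 u = 1 - max 0 (1 - u)" if "0 \<le> u" for u :: real
    using that by (auto simp: max_def)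
  have a: "0 \<le> a i" "a i \<le> 1" for i
    using w_bounds[of i] LM by (auto simp: a_def field_simps)
  have prod: "a i + b i - 1 \<le> a i * b i" for i
    using mult_nonneg_nonneg[of "1 - a i" "1 - b i"] a[of i] b_bounds[of i] by (simp add: algebra_simps)
  have suma: "(\<Sum>i\<in>msgs. a i) = L * M - M * (\<Sum>k<L. ?a k)"
  proof -
    have "(\<Sum>j<M. a (k, j)) = M * (1 - ?a k)" for k
    proof -
      have "(\<Sum>j<M. a (k, j)) = M * (\<integral>x. (\<Sum>j<M. L * e (k, j) x) \<partial>p)"
        using integrable_e by (simp add: a_def w_def sum_distrib_left[symmetric] Bochner_Integration.integral_sum mult_ac)
      also have "(\<lambda>x. \<Sum>j<M. L * e (k, j) x) = (\<lambda>x. 1 - max 0 (1 - Q k x))"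
        unfolding sum_e using ratio[OF Q_nonneg] by simp
      also have "(\<integral>x. 1 - max 0 (1 - Q k x) \<partial>p) = 1 - ?a k"
        using intm by (simp add: p.prob_space[simplified])
      finally show ?thesis .
    qed
    then have "(\<Sum>k<L. \<Sum>j<M. a (k, j)) = (\<Sum>k<L. M * (1 - ?a k))" by simp
    then show ?thesis
      by (simp add: sum.cartesian_product right_diff_distrib sum_subtractf sum_distrib_left mult_ac)
  qed
  have sumb: "(\<Sum>i\<in>msgs. b i) = L * M * (1 - ?b)"
  proof -
    have "(\<Sum>i\<in>msgs. b i) = (\<integral>y. (\<Sum>i\<in>msgs. g i y * r y) \<partial>q)"
      using integrable_gr by (simp add: b_def Bochner_Integration.integral_sum)
    also have "(\<lambda>y. \<Sum>i\<in>msgs. g i y * r y) = (\<lambda>y. L * M * (1 - max 0 (1 - Qh y)))"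
    proof
      fix y
      have "(\<Sum>i\<in>msgs. g i y * r y) = L * M * (Qh y / max 1 (Qh y))"
        unfolding sum_distrib_right[symmetric] r_def using LM by (simp add: Qh_def)
      then show "(\<Sum>i\<in>msgs. g i y * r y) = L * M * (1 - max 0 (1 - Qh y))"
        by (simp only: ratio[OF Qh_nonneg])
    qed
    also have "(\<integral>y. L * M * (1 - max 0 (1 - Qh y)) \<partial>q) = L * M * (1 - ?b)"
      using intmh by (simp add: q.prob_space[simplified])
    finally show ?thesis .
  qed
  have "L * M * \<delta> = L * M - (\<Sum>i\<in>msgs. a i * b i)"
    by (simp add: \<delta>_def a_def right_diff_distrib sum_distrib_left mult_ac)
  also have "\<dots> \<le> L * M - (\<Sum>i\<in>msgs. a i + b i - 1)"
    using prod by (intro diff_left_mono sum_mono)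
  also have "\<dots> = M * (\<Sum>k<L. ?a k) + L * M * ?b"
    by (simp add: sum_subtractf sum.distrib suma sumb algebra_simps)
  also have "\<dots> = L * M * (1 / L * (\<Sum>k<L. ?a k) + ?b)"
    using L_pos by (simp add: algebra_simps)
  finally have "\<delta> \<le> 1 / L * (\<Sum>k<L. ?a k) + ?b"
    using LM by (simp add: mult_le_cancel_left_pos)
  then have "ennreal \<delta> \<le> ennreal (1 / L * (\<Sum>k<L. ?a k) + ?b)"
    by (rule ennreal_leI)
  also have "\<dots> = ennreal (1 / L) * ennreal (\<Sum>k<L. ?a k) + ennreal ?b"
    by (subst ennreal_plus) (auto simp: ennreal_mult[symmetric] sum_nonneg simp del: ennreal_plus)
  also have "ennreal (\<Sum>k<L. ?a k) = (\<Sum>k<L. \<integral>\<^sup>+x. ennreal (max 0 (1 - Q k x)) \<partial>p)"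
    unfolding nn_integral_eq_integral[OF intm AE_I2[OF max.cobounded1]]
    by (intro sum_ennreal[symmetric]) simp
  also have "ennreal ?b = (\<integral>\<^sup>+y. ennreal (max 0 (1 - Qh y)) \<partial>q)"
    by (rule nn_integral_eq_integral[OF intmh AE_I2[OF max.cobounded1], symmetric])
  finally show ?thesis .
qed

end

section \<open>Random coding\<close>

text \<open>\<open>F\<close> plays the joint density of a letter and a standard Gaussian codeword
  letter relative to the product of their laws; the two normalizations say that both marginals are
  kept.\<close>

locale kernel =
  fixes mu s :: real and F :: "real \<Rightarrow> real \<Rightarrow> real"
  assumes s_pos: "0 < s"
    and F_meas [measurable]: "case_prod F \<in> borel_measurable (borel \<Otimes>\<^sub>M borel)"
    and F_nonneg: "\<And>x u. 0 \<le> F x u"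
    and F_fst: "\<And>u. (\<integral>\<^sup>+x. ennreal (F x u) \<partial>gauss mu s) = 1"
    and F_snd: "\<And>x. (\<integral>\<^sup>+u. ennreal (F x u) \<partial>gauss 0 1) = 1"
begin

lemma measurable_F [measurable (raw)]:
  assumes "f \<in> borel_measurable A" "g \<in> borel_measurable A"
  shows "(\<lambda>w. F (f w) (g w)) \<in> borel_measurable A"
  using measurable_compose[OF measurable_Pair[OF assms] F_meas] by simp

definition block :: "nat \<Rightarrow> (nat \<Rightarrow> real) \<times> (nat \<Rightarrow> real) \<Rightarrow> real" where
  "block n z = (\<Prod>t<n. F (fst z t) (snd z t))"

lemma block_nonneg: "0 \<le> block n z"
  unfolding block_def using F_nonneg by (intro prod_nonneg) auto

lemma measurable_block [measurable]: "block n \<in> borel_measurable (rec_space n \<Otimes>\<^sub>M rec_space n)"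
  unfolding block_def[abs_def]
proof (intro borel_measurable_prod measurable_F)
  fix t assume "t \<in> {..<n}"
  then have "t < n" by simp
  note tm = measurable_rec_space_component[OF this]
  show "(\<lambda>z. fst z t) \<in> borel_measurable (rec_space n \<Otimes>\<^sub>M rec_space n)"
    "(\<lambda>z. snd z t) \<in> borel_measurable (rec_space n \<Otimes>\<^sub>M rec_space n)"
    using measurable_compose[OF measurable_fst tm] measurable_compose[OF measurable_snd tm] by auto
qed

lemma measurable_block_fst: "(\<lambda>x. block n (x, u)) \<in> borel_measurable (rec_space n)"
  unfolding block_def fst_conv snd_conv
  by (intro borel_measurable_prod measurable_F measurable_rec_space_component) auto

lemma sigma_finite_gauss: "0 < s' \<Longrightarrow> product_sigma_finite (\<lambda>_::nat. gauss m s')"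
  using prob_space_gauss[of s' m]
  by (simp add: product_sigma_finite_def prob_space_def finite_measure.axioms(1))

lemma block_fst: "(\<integral>\<^sup>+x. ennreal (block n (x, u)) \<partial>src_block n mu s) = 1"
proof -
  interpret product_sigma_finite "\<lambda>_::nat. gauss mu s" by (rule sigma_finite_gauss[OF s_pos])
  show ?thesis
    unfolding block_def src_block_def using F_nonneg
    by (simp add: prod_ennreal[symmetric] product_nn_integral_prod[where f="\<lambda>t x. ennreal (F x (u t))"] F_fst)
qed

lemma block_snd: "(\<integral>\<^sup>+u. ennreal (block n (x, u)) \<partial>src_block n 0 1) = 1"
proof -
  interpret product_sigma_finite "\<lambda>_::nat. gauss 0 1" by (rule sigma_finite_gauss) simp
  show ?thesis
    unfolding block_def src_block_def using F_nonneg
    by (simp add: prod_ennreal[symmetric] product_nn_integral_prod[where f="\<lambda>t u. ennreal (F (x t) u)"] F_snd)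
qed

lemma nn_integral_block_powr:
  "(\<integral>\<^sup>+x. \<integral>\<^sup>+u. ennreal (block n (x, u) powr a) \<partial>src_block n 0 1 \<partial>src_block n mu s) =
    (\<integral>\<^sup>+x. \<integral>\<^sup>+u. ennreal (F x u powr a) \<partial>gauss 0 1 \<partial>gauss mu s) ^ n"
proof -
  interpret u: product_sigma_finite "\<lambda>_::nat. gauss 0 1" by (rule sigma_finite_gauss) simp
  interpret x: product_sigma_finite "\<lambda>_::nat. gauss mu s" by (rule sigma_finite_gauss[OF s_pos])
  interpret g: prob_space "gauss 0 1" by (rule prob_space_gauss) simp
  have "block n z powr a = (\<Prod>t<n. F (fst z t) (snd z t) powr a)" for z
    unfolding block_def using F_nonneg by (simp add: prod_powr_distrib)
  then have "(\<integral>\<^sup>+u. ennreal (block n (x, u) powr a) \<partial>src_block n 0 1) =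
    (\<Prod>t<n. \<integral>\<^sup>+u. ennreal (F (x t) u powr a) \<partial>gauss 0 1)" for x
    unfolding src_block_def
    by (simp add: prod_ennreal[symmetric] u.product_nn_integral_prod[where f="\<lambda>t u. ennreal (F (x t) u powr a)"])
  then show ?thesis
    unfolding src_block_def
    by (simp add: x.product_nn_integral_prod[where f="\<lambda>t x. \<integral>\<^sup>+u. ennreal (F x u powr a) \<partial>gauss 0 1"])
qed

text \<open>A Chernoff bound for the tail of \<open>soft_covering\<close>: where
  \<open>v > T\<close> one has \<open>v \<le> T powr (- a) * v powr (1 + a)\<close>. The moment of
  order \<open>1 + a\<close>, an exponential of a Renyi divergence, factorizes over letters and
  gives \<open>E ^ n\<close>.\<close>

lemma covering:
  assumes I: "finite I" and J: "J \<subseteq> I" "J \<noteq> {}" and T: "0 < T" and a: "0 < a"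
    and E: "0 \<le> E" "(\<integral>\<^sup>+x. \<integral>\<^sup>+u. ennreal (F x u powr (1 + a)) \<partial>gauss 0 1 \<partial>gauss mu s) \<le> ennreal E"
  shows "(\<integral>\<^sup>+c. \<integral>\<^sup>+x. ennreal (max 0 (1 - (\<Sum>i\<in>J. block n (x, c i)) / card J)) \<partial>src_block n mu s
      \<partial>PiM I (\<lambda>_. src_block n 0 1))
    \<le> ennreal (sqrt (T / card J) + T powr (- a) * E ^ n)"
proof -
  let ?p = "src_block n mu s" and ?u = "src_block n 0 1"
  let ?tail = "\<integral>\<^sup>+x. \<integral>\<^sup>+u. ennreal (block n (x, u) * indicator {z. T < block n z} (x, u)) \<partial>?u \<partial>?p"
  interpret p: prob_space ?p by (rule prob_space_src_block[OF s_pos])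
  interpret u: prob_space ?u by (rule prob_space_src_block) simp
  have bm [measurable]: "block n \<in> borel_measurable (?p \<Otimes>\<^sub>M ?u)" by measurable
  have "?tail \<le>
    (\<integral>\<^sup>+x. \<integral>\<^sup>+u. ennreal (T powr (- a)) * ennreal (block n (x, u) powr (1 + a)) \<partial>?u \<partial>?p)"
  proof (intro nn_integral_mono)
    fix x u
    define v where "v = block n (x, u)"
    have "v * indicator {z. T < block n z} (x, u) \<le> T powr (- a) * v powr (1 + a)"
    proof (cases "T < v")
      case True
      have "1 \<le> (v / T) powr a" using True T a by (intro ge_one_powr_ge_zero) auto
      then have "v * 1 \<le> v * (v / T) powr a" using True T by (intro mult_left_mono) auto
      also have "\<dots> = T powr (- a) * v powr (1 + a)"
        using True T powr_divide[of v T a] by (simp add: powr_minus powr_add divide_inverse)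
      finally show ?thesis using True by (simp add: v_def)
    qed (simp add: v_def)
    then show "ennreal (block n (x, u) * indicator {z. T < block n z} (x, u)) \<le>
      ennreal (T powr (- a)) * ennreal (block n (x, u) powr (1 + a))"
      by (subst ennreal_mult[symmetric]) (auto simp: v_def intro!: ennreal_leI)
  qed
  also have "\<dots> = ennreal (T powr (- a)) * (\<integral>\<^sup>+x. \<integral>\<^sup>+u. ennreal (block n (x, u) powr (1 + a)) \<partial>?u \<partial>?p)"
    using measurable_Pair1'[of _ ?p ?u] by (simp add: nn_integral_cmult cong: nn_integral_cong)
  also have "\<dots> \<le> ennreal (T powr (- a)) * ennreal (E ^ n)"
    unfolding nn_integral_block_powr ennreal_power[OF E(1), symmetric]
    by (intro mult_left_mono power_mono E(2)) auto
  finally have tail: "?tail \<le>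
    ennreal (T powr (- a) * E ^ n)" using E by (simp add: ennreal_mult)
  have "(\<integral>\<^sup>+c. \<integral>\<^sup>+x. ennreal (max 0 (1 - (\<Sum>i\<in>J. block n (x, c i)) / card J)) \<partial>?p \<partial>PiM I (\<lambda>_. ?u)) \<le>
    ennreal (sqrt (T / card J)) + ?tail"
    by (rule soft_covering[OF p.prob_space_axioms u.prob_space_axioms I J bm block_nonneg block_snd T])
  also have "\<dots> \<le> ennreal (sqrt (T / card J)) + ennreal (T powr (- a) * E ^ n)"
    by (intro add_left_mono tail)
  also have "\<dots> = ennreal (sqrt (T / card J) + T powr (- a) * E ^ n)"
    using T E by (intro ennreal_plus[symmetric]) auto
  finally show ?thesis .
qed

lemma measurable_covering:
  assumes J: "J \<subseteq> I"
  shows "(\<lambda>c. \<integral>\<^sup>+x. ennreal (max 0 (1 - (\<Sum>i\<in>J. block n (x, c i)) / r)) \<partial>src_block n mu s)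
    \<in> borel_measurable (PiM I (\<lambda>_. src_block n 0 1))"
proof -
  let ?p = "src_block n mu s" and ?C = "PiM I (\<lambda>_. src_block n 0 1)"
  interpret p: prob_space ?p by (rule prob_space_src_block[OF s_pos])
  have [measurable]: "(\<lambda>z. block n (snd z, fst z i)) \<in> borel_measurable (?C \<Otimes>\<^sub>M ?p)" if "i \<in> J" for i
  proof (rule measurable_compose[OF measurable_Pair measurable_block])
    have "(\<lambda>z. fst z i) \<in> ?C \<Otimes>\<^sub>M ?p \<rightarrow>\<^sub>M src_block n 0 1"
      using that J by (intro measurable_compose[OF measurable_fst measurable_component_singleton]) auto
    then show "(\<lambda>z. fst z i) \<in> ?C \<Otimes>\<^sub>M ?p \<rightarrow>\<^sub>M rec_space n"
      by (subst (asm) measurable_cong_sets[OF refl sets_src_block])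
    show "snd \<in> ?C \<Otimes>\<^sub>M ?p \<rightarrow>\<^sub>M rec_space n" by simp
  qed
  have "(\<lambda>(c, x). ennreal (max 0 (1 - (\<Sum>i\<in>J. block n (x, c i)) / r))) \<in> borel_measurable (?C \<Otimes>\<^sub>M ?p)"
    unfolding split_beta by measurable
  then show ?thesis by measurable
qed

end

text \<open>\<open>F\<close> and \<open>G\<close> share the codeword letter, given which source and
  reproduction are conditionally independent; \<open>\<Delta>\<close> bounds the distortion of this
  ideal triple.\<close>

locale test_channel = X: kernel mu s F + Y: kernel mu \<sigma> G for mu s \<sigma> F G +
  fixes \<Delta> :: real
  assumes \<Delta>_nonneg: "0 \<le> \<Delta>"
    and \<Delta>: "(\<integral>\<^sup>+u. \<integral>\<^sup>+x. ennreal (F x u) * (\<integral>\<^sup>+y. ennreal ((x - y)\<^sup>2) * ennreal (G y u) \<partial>gauss mu \<sigma>)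
      \<partial>gauss mu s \<partial>gauss 0 1) \<le> ennreal \<Delta>"
begin

definition D1 where "D1 x u = (\<integral>\<^sup>+y. ennreal ((x - y)\<^sup>2) * ennreal (G y u) \<partial>gauss mu \<sigma>)"
definition D2 where "D2 u = (\<integral>\<^sup>+x. ennreal (F x u) * D1 x u \<partial>gauss mu s)"

lemma measurable_D1: "case_prod D1 \<in> borel_measurable (borel \<Otimes>\<^sub>M borel)"
proof -
  interpret prob_space "gauss mu \<sigma>" by (rule prob_space_gauss[OF Y.s_pos])
  show ?thesis unfolding D1_def split_beta by measurable
qed

lemma measurable_D1' [measurable (raw)]:
  assumes "f \<in> borel_measurable A" "g \<in> borel_measurable A"
  shows "(\<lambda>w. D1 (f w) (g w)) \<in> borel_measurable A"
  using measurable_compose[OF measurable_Pair[OF assms] measurable_D1] by simp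

lemma measurable_D2 [measurable]: "D2 \<in> borel_measurable borel"
proof -
  interpret prob_space "gauss mu s" by (rule prob_space_gauss[OF X.s_pos])
  show ?thesis unfolding D2_def[abs_def] by measurable
qed

lemma block_distortion:
  assumes t: "t < n"
  shows "(\<integral>\<^sup>+x. ennreal (X.block n (x, u)) * (\<integral>\<^sup>+y. ennreal ((x t - y t)\<^sup>2) * ennreal (Y.block n (y, u)) \<partial>src_block n mu \<sigma>)
      \<partial>src_block n mu s) = D2 (u t)"
proof -
  have 1: "(\<integral>\<^sup>+y. ennreal ((v - y t)\<^sup>2) * ennreal (Y.block n (y, u)) \<partial>src_block n mu \<sigma>) = D1 v (u t)" for v
  proof -
    have "(\<integral>\<^sup>+y. ennreal ((v - y t)\<^sup>2) * ennreal (Y.block n (y, u)) \<partial>src_block n mu \<sigma>) =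
      (\<integral>\<^sup>+y. (\<Prod>i<n. ennreal (G (y i) (u i))) * ennreal ((v - y t)\<^sup>2) \<partial>src_block n mu \<sigma>)"
      using Y.F_nonneg by (simp add: Y.block_def prod_ennreal mult.commute)
    also have "\<dots> = (\<integral>\<^sup>+y. ennreal (G y (u t)) * ennreal ((v - y)\<^sup>2) \<partial>gauss mu \<sigma>)"
      unfolding src_block_def
      by (rule nn_integral_tilted[OF prob_space_gauss[OF Y.s_pos] t, where h="\<lambda>i y. ennreal (G y (u i))"])
        (simp_all add: Y.F_fst)
    finally show ?thesis by (simp add: D1_def mult.commute)
  qed
  have "(\<integral>\<^sup>+x. ennreal (X.block n (x, u)) * D1 (x t) (u t) \<partial>src_block n mu s) =
      (\<integral>\<^sup>+x. (\<Prod>i<n. ennreal (F (x i) (u i))) * D1 (x t) (u t) \<partial>src_block n mu s)"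
    using X.F_nonneg by (simp add: X.block_def prod_ennreal)
  also have "\<dots> = (\<integral>\<^sup>+x. ennreal (F x (u t)) * D1 x (u t) \<partial>gauss mu s)"
    unfolding src_block_def
    by (rule nn_integral_tilted[OF prob_space_gauss[OF X.s_pos] t, where h="\<lambda>i y. ennreal (F y (u i))"])
      (simp_all add: X.F_fst)
  finally show ?thesis by (simp add: 1 D2_def)
qed

text \<open>\<open>T1\<close> is the threshold for covering the source with the \<open>M\<close>
  codewords of one seed, \<open>T2\<close> the one for covering the output with all
  \<open>L * M\<close> codewords. The rate counts \<open>Suc M\<close> because of the extra
  message.\<close>

lemma random_coding:
  fixes n L M :: nat and K T1 T2 a eX eY R Rc P D :: real
  defines "\<epsilon> \<equiv> (sqrt (T1 / M) + T1 powr (- a) * eX ^ n) + (sqrt (T2 / (L * M)) + T2 powr (- a) * eY ^ n)"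
  assumes pos: "0 < n" "0 < L" "0 < M" "0 < K" "0 < T1" "0 < T2" "0 < a" "0 \<le> eX" "0 \<le> eY"
    and eX: "(\<integral>\<^sup>+x. \<integral>\<^sup>+u. ennreal (F x u powr (1 + a)) \<partial>gauss 0 1 \<partial>gauss mu s) \<le> ennreal eX"
    and eY: "(\<integral>\<^sup>+y. \<integral>\<^sup>+u. ennreal (G y u powr (1 + a)) \<partial>gauss 0 1 \<partial>gauss mu \<sigma>) \<le> ennreal eY"
    and rate: "ln (real (Suc M)) / real n \<le> R" and rate_c: "ln (real L) / real n \<le> Rc"
    and P: "psi s \<sigma> \<le> P"
    and D: "\<Delta> + 4 * K * \<epsilon> + 6 * (s ^ 4 + \<sigma> ^ 4) / K < D"
  shows "achievable mu s R Rc P D"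
proof -
  let ?I = "{..<L} \<times> {..<M}" and ?p = "src_block n mu s" and ?q = "src_block n mu \<sigma>"
  let ?S = "\<lambda>t c. ennreal (1 / real (L * M)) * (\<Sum>i\<in>?I. D2 (c i t))" and ?x = "sqrt (T1 / M) + T1 powr (- a) * eX ^ n"
    and ?y = "sqrt (T2 / (L * M)) + T2 powr (- a) * eY ^ n"
  let ?C = "PiM ?I (\<lambda>_. src_block n 0 1)"
  interpret U: prob_space "src_block n 0 1" by (rule prob_space_src_block) simp
  interpret C: prob_space ?C by (intro prob_space_PiM U.prob_space_axioms)
  define A where "A = (\<lambda>(k::nat) c. \<integral>\<^sup>+x. ennreal (max 0 (1 - (\<Sum>i\<in>{k} \<times> {..<M}. X.block n (x, c i)) / M)) \<partial>?p)"
  define B where "B = (\<lambda>c. \<integral>\<^sup>+y. ennreal (max 0 (1 - (\<Sum>i\<in>?I. Y.block n (y, c i)) / real (L * M))) \<partial>?q)"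
  define d where "d = (\<lambda>c. ennreal (1 / real L) * (\<Sum>k<L. A k c) + B c)"
  define c0 where "c0 = 6 * (s ^ 4 + \<sigma> ^ 4) / K"
  have c0: "0 \<le> c0" using pos by (simp add: c0_def)
  \<comment> \<open>\<open>\<Phi>\<close> bounds the total distortion of the code built from
    codebook \<open>c\<close>. Putting ideal distortion and defect into one functional means that a
    single expectation selects a codebook good for both.\<close>
  define \<Phi> where "\<Phi> = (\<lambda>c. (\<Sum>t<n. ?S t c)
    + ennreal (real n) * (ennreal (4 * K) * d c + ennreal c0))"
  have \<epsilon>: "0 \<le> \<epsilon>" using pos by (simp add: \<epsilon>_def)
  have "0 \<le> 4 * K * \<epsilon>" using pos \<epsilon> by simp
  then have D0: "0 < D" using D c0 \<Delta>_nonneg pos unfolding c0_def[symmetric] by (cases "\<Delta> + 4 * K * \<epsilon> + c0 = 0") auto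
  have Am [measurable]: "A k \<in> borel_measurable ?C" if "k < L" for k
    unfolding A_def using that by (intro X.measurable_covering) auto
  have Bm [measurable]: "B \<in> borel_measurable ?C"
    unfolding B_def by (intro Y.measurable_covering) auto
  have dm [measurable]: "d \<in> borel_measurable ?C"
    unfolding d_def by measurable
  have cm: "(\<lambda>u. D2 (u t)) \<in> borel_measurable (src_block n 0 1)" if "t < n" for t
    using measurable_compose[OF measurable_rec_space_component[OF that] measurable_D2] by simp
  have D2m [measurable]: "(\<lambda>c. D2 (c i t)) \<in> borel_measurable ?C" if "t < n" "i \<in> ?I" for i t
    using measurable_compose[OF measurable_component_singleton[OF that(2)] cm[OF that(1)]] .
  have EA: "(\<integral>\<^sup>+c. A k c \<partial>?C) \<le> ennreal ?x" if k: "k < L" for k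
    using X.covering[where I="?I" and J="{k} \<times> {..<M}" and T=T1 and a=a and E=eX and n=n] k pos eX
    unfolding A_def by (auto simp: lessThan_empty_iff)
  have EB: "(\<integral>\<^sup>+c. B c \<partial>?C) \<le> ennreal ?y"
    using Y.covering[where I="?I" and J="?I" and T=T2 and a=a and E=eY and n=n] pos eY
    unfolding B_def by (auto simp: lessThan_empty_iff)
  have Ed: "(\<integral>\<^sup>+c. d c \<partial>?C) \<le> ennreal \<epsilon>"
  proof -
    have "(\<integral>\<^sup>+c. d c \<partial>?C) = ennreal (1 / real L) * (\<Sum>k<L. \<integral>\<^sup>+c. A k c \<partial>?C) + (\<integral>\<^sup>+c. B c \<partial>?C)"
      unfolding d_def using nn_integral_sum[of "{..<L}" A ?C] Am
      by (simp add: nn_integral_add nn_integral_cmult)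
    also have "\<dots> \<le> ennreal (1 / real L) * (\<Sum>k<L. ennreal ?x)
        + ennreal ?y"
      by (intro add_mono mult_left_mono sum_mono EA EB) auto
    also have "(\<Sum>k<L. ennreal ?x) = ennreal (real L * ?x)"
      using pos by (subst sum_ennreal) auto
    also have "ennreal (1 / real L) * \<dots> = ennreal ?x"
      using pos by (subst ennreal_mult[symmetric]) auto
    also have "\<dots> + ennreal ?y = ennreal \<epsilon>"
      unfolding \<epsilon>_def using pos by (intro ennreal_plus[symmetric]) auto
    finally show ?thesis .
  qed
  have ED: "(\<integral>\<^sup>+c. ?S t c \<partial>?C) \<le> ennreal \<Delta>" if t: "t < n" for t
  proof -
    have "(\<integral>\<^sup>+c. D2 (c i t) \<partial>?C) \<le> ennreal \<Delta>" if i: "i \<in> ?I" for i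
    proof -
      have "(\<integral>\<^sup>+c. D2 (c i t) \<partial>?C) = (\<integral>\<^sup>+u. D2 (u t) \<partial>src_block n 0 1)"
        using nn_integral_PiM_component[OF U.prob_space_axioms i cm[OF t]] .
      also have "\<dots> = (\<integral>\<^sup>+u. D2 u \<partial>gauss 0 1)"
        by (rule nn_integral_block_component[OF _ t]) auto
      also have "\<dots> \<le> ennreal \<Delta>" using \<Delta> by (simp add: D2_def D1_def)
      finally show ?thesis .
    qed
    then have "(\<Sum>i\<in>?I. \<integral>\<^sup>+c. D2 (c i t) \<partial>?C) \<le> (\<Sum>i\<in>?I. ennreal \<Delta>)" by (rule sum_mono)
    also have "\<dots> = ennreal (real L * real M * \<Delta>)"
      using \<Delta>_nonneg by (subst sum_ennreal) auto
    finally have "ennreal (1 / real (L * M)) * (\<Sum>i\<in>?I. \<integral>\<^sup>+c. D2 (c i t) \<partial>?C) \<le> ennreal (1 / real (L * M)) * ennreal (real L * real M * \<Delta>)"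
      by (rule mult_left_mono) simp
    also have "\<dots> = ennreal \<Delta>"
      using pos \<Delta>_nonneg by (subst ennreal_mult[symmetric]) auto
    finally show ?thesis
      using t by (simp add: nn_integral_cmult nn_integral_sum)
  qed
  have "(\<integral>\<^sup>+c. \<Phi> c \<partial>?C) = (\<Sum>t<n. \<integral>\<^sup>+c. ?S t c \<partial>?C)
      + ennreal (real n) * (ennreal (4 * K) * (\<integral>\<^sup>+c. d c \<partial>?C) + ennreal c0)"
  proof -
    have "(\<integral>\<^sup>+c. \<Phi> c \<partial>?C) = (\<integral>\<^sup>+c. (\<Sum>t<n. ?S t c) \<partial>?C)
        + (\<integral>\<^sup>+c. ennreal (real n) * (ennreal (4 * K) * d c + ennreal c0) \<partial>?C)"
      unfolding \<Phi>_def by (rule nn_integral_add) measurable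
    moreover have "(\<integral>\<^sup>+c. (\<Sum>t<n. ?S t c) \<partial>?C) =
        (\<Sum>t<n. \<integral>\<^sup>+c. ?S t c \<partial>?C)"
      by (rule nn_integral_sum) measurable
    ultimately show ?thesis
      by (simp add: nn_integral_add nn_integral_cmult C.emeasure_space_1)
  qed
  also have "\<dots> \<le> (\<Sum>t<n. ennreal \<Delta>) + ennreal (real n) * (ennreal (4 * K) * ennreal \<epsilon> + ennreal c0)"
    by (intro add_mono sum_mono ED mult_left_mono Ed) auto
  also have "\<dots> = ennreal (real n * (\<Delta> + 4 * K * \<epsilon> + c0))"
    using pos \<epsilon> c0 \<Delta>_nonneg
    by (simp add: ennreal_mult[symmetric] ennreal_plus[symmetric] ennreal_of_nat_eq_real_of_nat algebra_simps del: ennreal_plus)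
  also have "\<dots> < ennreal (real n * D)"
    using pos D D0 \<epsilon> c0 \<Delta>_nonneg unfolding c0_def[symmetric] by (intro ennreal_lessI mult_strict_left_mono) auto
  finally have lt: "(\<integral>\<^sup>+c. \<Phi> c \<partial>?C) < ennreal (real n * D)" .
  \<comment> \<open>If every codebook exceeded the level, so would the average.\<close>
  have "\<exists>c. \<Phi> c \<le> ennreal (real n * D)"
  proof (rule ccontr)
    assume "\<not> (\<exists>c. \<Phi> c \<le> ennreal (real n * D))"
    then have "(\<integral>\<^sup>+c. ennreal (real n * D) \<partial>?C) \<le> (\<integral>\<^sup>+c. \<Phi> c \<partial>?C)"
      by (intro nn_integral_mono) (auto simp: not_le intro: less_imp_le)
    then show False using lt by (simp add: C.emeasure_space_1)
  qed
  then obtain c where c: "\<Phi> c \<le> ennreal (real n * D)" by blast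
  \<comment> \<open>The locale \<open>codebook\<close> wants normalized densities for all index
    pairs; outside \<open>?I\<close> the constant 1 provides them.\<close>
  define f where "f = (\<lambda>i x. if i \<in> ?I then X.block n (x, c i) else 1)"
  define g where "g = (\<lambda>i y. if i \<in> ?I then Y.block n (y, c i) else 1)"
  interpret cb: codebook n L M mu s \<sigma> f g
  proof
    show "f i \<in> borel_measurable (rec_space n)" "g i \<in> borel_measurable (rec_space n)" for i
      by (cases "i \<in> ?I"; simp add: f_def g_def X.measurable_block_fst Y.measurable_block_fst)+
    show "0 \<le> f i x" "0 \<le> g i x" for i x
      unfolding f_def g_def by (auto simp: X.block_nonneg Y.block_nonneg)
    show "(\<integral>\<^sup>+x. ennreal (f i x) \<partial>?p) = 1" for i
      using prob_space.emeasure_space_1[OF prob_space_src_block[OF X.s_pos, of n mu]]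
      by (cases "i \<in> ?I") (simp_all add: f_def X.block_fst)
    show "(\<integral>\<^sup>+x. ennreal (g i x) \<partial>?q) = 1" for i
      using prob_space.emeasure_space_1[OF prob_space_src_block[OF Y.s_pos, of n mu]]
      by (cases "i \<in> ?I") (simp_all add: g_def Y.block_fst)
  qed (use pos X.s_pos Y.s_pos in auto)
  have "ennreal cb.\<delta> \<le> d c"
  proof -
    have "(\<Sum>i\<in>{k} \<times> {..<M}. X.block n (x, c i)) = (\<Sum>j<M. f (k, j) x)" if "k < L" for k x
    proof -
      have "(\<Sum>i\<in>{k} \<times> {..<M}. X.block n (x, c i)) = (\<Sum>k\<in>{k}. \<Sum>j<M. X.block n (x, c (k, j)))"
        by (subst sum.cartesian_product) (auto intro!: sum.cong)
      then show ?thesis using that by (simp add: f_def)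
    qed
    then have "(\<Sum>k<L. \<integral>\<^sup>+x. ennreal (max 0 (1 - cb.Q k x)) \<partial>?p) = (\<Sum>k<L. A k c)"
      by (intro sum.cong) (simp_all add: A_def cb.Q_def)
    moreover have "(\<integral>\<^sup>+y. ennreal (max 0 (1 - cb.Qh y)) \<partial>?q) = B c"
      unfolding B_def cb.Qh_def by (simp add: g_def)
    ultimately show ?thesis using cb.\<delta>_le by (simp add: d_def)
  qed
  note \<delta>d = this
  have "(\<Sum>t<n. \<integral>\<^sup>+z. ennreal ((fst z t - snd z t)\<^sup>2) \<partial>cb.cj) \<le>
    (\<Sum>t<n. ?S t c + (ennreal (4 * K) * d c + ennreal c0))"
  proof (rule sum_mono)
    fix t assume "t \<in> {..<n}"
    then have t: "t < n" by simp
    have "(\<Sum>i\<in>?I. \<integral>\<^sup>+x. ennreal (f i x) * (\<integral>\<^sup>+y. ennreal ((x t - y t)\<^sup>2) * ennreal (g i y) \<partial>?q) \<partial>?p) = (\<Sum>i\<in>?I. D2 (c i t))"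
      using block_distortion[OF t] by (intro sum.cong refl) (simp add: f_def g_def)
    moreover have "ennreal (4 * K * cb.\<delta> + c0) \<le> ennreal (4 * K) * d c + ennreal c0"
    proof -
      have "ennreal (4 * K * cb.\<delta> + c0) = ennreal (4 * K) * ennreal cb.\<delta> + ennreal c0"
        using pos cb.\<delta>_nonneg c0 by (simp add: ennreal_mult)
      then show ?thesis using \<delta>d by (auto intro: add_right_mono mult_left_mono)
    qed
    ultimately show "(\<integral>\<^sup>+z. ennreal ((fst z t - snd z t)\<^sup>2) \<partial>cb.cj) \<le>
      ?S t c + (ennreal (4 * K) * d c + ennreal c0)"
      using cb.distortion_bound[OF t pos(4), folded c0_def]
      by (auto intro: order_trans add_left_mono)
  qed
  also have "\<dots> = \<Phi> c"
    by (simp add: \<Phi>_def sum.distrib ennreal_of_nat_eq_real_of_nat)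
  also note c
  finally have "(\<Sum>t<n. \<integral>\<^sup>+z. ennreal ((fst z t - snd z t)\<^sup>2) \<partial>cb.cj) \<le> ennreal (real n * D)" .
  moreover have "0 \<le> D" using D0 by simp
  ultimately show ?thesis
    using rate rate_c P Y.s_pos cb.distr_cj_output
    by (intro cb.C.achievable_gauss_output[where \<sigma>=\<sigma>])
qed

end

section \<open>Gaussian kernels\<close>

lemma gauss_affine:
  assumes s: "0 < s"
  shows "gauss mu s = distr (gauss 0 1) borel (\<lambda>z. mu + s * z)"
proof -
  interpret prob_space "gauss 0 1" by (rule prob_space_gauss) simp
  have "distributed (gauss 0 1) lborel (\<lambda>z. z) (normal_density 0 1)"
    by (auto simp: distributed_def gauss_def intro!: measure_eqI simp: emeasure_distr)
  from normal_density_affine[OF this, of s mu] s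
  have "distributed (gauss 0 1) lborel (\<lambda>z. mu + s * z) (normal_density mu s)" by simp
  then have "distr (gauss 0 1) lborel (\<lambda>z. mu + s * z) = gauss mu s"
    by (simp add: distributed_def gauss_def)
  moreover have "distr (gauss 0 1) lborel (\<lambda>z. mu + s * z) = distr (gauss 0 1) borel (\<lambda>z. mu + s * z)"
    by (rule distr_cong) auto
  ultimately show ?thesis by simp
qed

lemma nn_integral_gauss:
  assumes "0 < s" "h \<in> borel_measurable borel"
  shows "(\<integral>\<^sup>+x. h x \<partial>gauss mu s) = (\<integral>\<^sup>+z. h (mu + s * z) \<partial>gauss 0 1)"
  using assms by (simp add: gauss_affine[of s mu] nn_integral_distr)

text \<open>Completing the square turns the integrand into a multiple of the normal density with
  variance \<open>1 / (1 + 2 * A)\<close> and mean \<open>B / (1 + 2 * A)\<close>.\<close>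

lemma nn_integral_gauss_exp_quadratic:
  assumes A: "0 < 1 + 2 * A"
  shows "(\<integral>\<^sup>+u. ennreal (exp (- A * u\<^sup>2 + B * u)) \<partial>gauss 0 1) =
    ennreal (exp (B\<^sup>2 / (2 * (1 + 2 * A))) / sqrt (1 + 2 * A))"
proof -
  define v where "v = 1 + 2 * A"
  have v: "0 < v" "A = (v - 1) / 2" using A by (auto simp: v_def)
  have pt: "normal_density 0 1 u * exp (- A * u\<^sup>2 + B * u) =
    exp (B\<^sup>2 / (2 * v)) / sqrt v * normal_density (B / v) (1 / sqrt v) u" for u
  proof -
    have "- u\<^sup>2 / 2 + (- A * u\<^sup>2 + B * u) = B\<^sup>2 / (2 * v) + (- (u - B / v)\<^sup>2 / (2 * (1 / sqrt v)\<^sup>2))"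
      using v(1) by (simp add: v(2) power_divide field_simps power2_eq_square)
    then have "exp (- u\<^sup>2 / 2) * exp (- A * u\<^sup>2 + B * u) = exp (B\<^sup>2 / (2 * v)) * exp (- (u - B / v)\<^sup>2 / (2 * (1 / sqrt v)\<^sup>2))"
      by (simp only: exp_add[symmetric])
    moreover have "1 / sqrt v * (1 / sqrt (2 * pi * (1 / sqrt v)\<^sup>2)) = 1 / sqrt (2 * pi)"
      using v(1) by (simp add: power_divide real_sqrt_divide)
    ultimately show ?thesis
      by (simp add: normal_density_def field_simps)
  qed
  have "(\<integral>\<^sup>+u. ennreal (exp (- A * u\<^sup>2 + B * u)) \<partial>gauss 0 1) =
    (\<integral>\<^sup>+u. ennreal (normal_density 0 1 u * exp (- A * u\<^sup>2 + B * u)) \<partial>lborel)"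
    unfolding gauss_def by (subst nn_integral_density) (auto simp: ennreal_mult')
  also have "\<dots> = (\<integral>\<^sup>+u. ennreal (exp (B\<^sup>2 / (2 * v)) / sqrt v) * ennreal (normal_density (B / v) (1 / sqrt v) u) \<partial>lborel)"
    unfolding pt using v by (simp add: ennreal_mult'[symmetric])
  also have "\<dots> = ennreal (exp (B\<^sup>2 / (2 * v)) / sqrt v)"
    using v by (simp add: nn_integral_cmult nn_integral_eq_integral)
  finally show ?thesis by (simp add: v_def)
qed

text \<open>Density of a standard Gaussian pair with correlation \<open>\<rho>\<close> relative to the product of its
  marginals.\<close>

definition mehler :: "real \<Rightarrow> real \<Rightarrow> real \<Rightarrow> real" where
  "mehler \<rho> z u = exp (- (\<rho>\<^sup>2 * z\<^sup>2 - 2 * \<rho> * z * u + \<rho>\<^sup>2 * u\<^sup>2) / (2 * (1 - \<rho>\<^sup>2))) / sqrt (1 - \<rho>\<^sup>2)"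

lemma mehler_commute: "mehler \<rho> z u = mehler \<rho> u z"
  by (simp add: mehler_def algebra_simps)

lemma measurable_mehler [measurable]: "case_prod (mehler \<rho>) \<in> borel_measurable (borel \<Otimes>\<^sub>M borel)"
  unfolding mehler_def split_beta by measurable

lemma measurable_mehler' [measurable (raw)]:
  assumes "f \<in> borel_measurable A" "g \<in> borel_measurable A"
  shows "(\<lambda>w. mehler \<rho> (f w) (g w)) \<in> borel_measurable A"
  using measurable_compose[OF measurable_Pair[OF assms] measurable_mehler] by simp

locale correlation =
  fixes \<rho> :: real
  assumes \<rho>: "0 \<le> \<rho>" "\<rho> < 1"
begin

lemma \<rho>_sq: "0 < 1 - \<rho>\<^sup>2" "\<rho>\<^sup>2 < 1"
  using \<rho> by (auto simp: abs_square_less_1)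

lemma mehler_nonneg: "0 \<le> mehler \<rho> z u"
  using \<rho>_sq by (simp add: mehler_def)

text \<open>This is the conditional law of one component given the other: mean
  \<open>\<rho> * u\<close>, variance \<open>1 - \<rho>^2\<close>.\<close>

lemma mehler_tilt: "normal_density 0 1 z * mehler \<rho> z u = normal_density (\<rho> * u) (sqrt (1 - \<rho>\<^sup>2)) z"
proof -
  define v where "v = 1 - \<rho>\<^sup>2"
  have v: "0 < v" and r: "\<rho>\<^sup>2 = 1 - v" using \<rho>_sq by (auto simp: v_def)
  have "- z\<^sup>2 / 2 + (- ((1 - v) * z\<^sup>2 - 2 * \<rho> * z * u + (1 - v) * u\<^sup>2) / (2 * v)) =
      (- (z\<^sup>2 - 2 * \<rho> * z * u + (1 - v) * u\<^sup>2)) / (2 * v)"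
    using v by (simp add: field_simps)
  also have "z\<^sup>2 - 2 * \<rho> * z * u + (1 - v) * u\<^sup>2 = (z - \<rho> * u)\<^sup>2"
    by (simp only: r[symmetric]) (simp add: power2_eq_square algebra_simps)
  finally have "exp (- z\<^sup>2 / 2) * exp (- ((1 - v) * z\<^sup>2 - 2 * \<rho> * z * u + (1 - v) * u\<^sup>2) / (2 * v)) =
      exp (- (z - \<rho> * u)\<^sup>2 / (2 * v))"
    by (simp only: exp_add[symmetric])
  moreover have "normal_density 0 1 z * mehler \<rho> z u =
      (exp (- z\<^sup>2 / 2) * exp (- ((1 - v) * z\<^sup>2 - 2 * \<rho> * z * u + (1 - v) * u\<^sup>2) / (2 * v))) / (sqrt (2 * pi) * sqrt v)"
    unfolding mehler_def v_def[symmetric] unfolding r by (simp add: normal_density_def)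
  moreover have "normal_density (\<rho> * u) (sqrt (1 - \<rho>\<^sup>2)) z = exp (- (z - \<rho> * u)\<^sup>2 / (2 * v)) / (sqrt (2 * pi) * sqrt v)"
    unfolding v_def[symmetric] using v by (simp add: normal_density_def real_sqrt_mult)
  ultimately show ?thesis by (simp only:)
qed

lemma nn_integral_mehler:
  assumes h [measurable]: "h \<in> borel_measurable borel"
  shows "(\<integral>\<^sup>+z. ennreal (mehler \<rho> z u) * h z \<partial>gauss 0 1) = (\<integral>\<^sup>+z. h z \<partial>gauss (\<rho> * u) (sqrt (1 - \<rho>\<^sup>2)))"
proof -
  have "(\<integral>\<^sup>+z. ennreal (mehler \<rho> z u) * h z \<partial>gauss 0 1) =
      (\<integral>\<^sup>+z. ennreal (normal_density 0 1 z * mehler \<rho> z u) * h z \<partial>lborel)"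
    unfolding gauss_def using mehler_nonneg
    by (subst nn_integral_density) (auto simp: ennreal_mult mult.assoc)
  also have "\<dots> = (\<integral>\<^sup>+z. h z \<partial>gauss (\<rho> * u) (sqrt (1 - \<rho>\<^sup>2)))"
    unfolding mehler_tilt gauss_def by (subst nn_integral_density) auto
  finally show ?thesis .
qed

lemma mehler_one: "(\<integral>\<^sup>+z. ennreal (mehler \<rho> z u) \<partial>gauss 0 1) = 1"
  using nn_integral_mehler[of "\<lambda>_. 1" u] prob_space.emeasure_space_1[OF prob_space_gauss[of "sqrt (1 - \<rho>\<^sup>2)" "\<rho> * u"]] \<rho>_sq
  by simp

text \<open>Two successive Gaussian integrals. The first factor is \<open>exp (a * r)\<close> when
  \<open>1 - \<rho>^2 = exp (- 2 * r)\<close>, that is, mutual information \<open>r\<close>; the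
  second deviates from 1 only to order \<open>a^2\<close>, so a small \<open>a\<close> wins as soon
  as the rate exceeds \<open>r\<close>.\<close>

lemma mehler_powr:
  assumes a: "0 < a" "a < 1"
  shows "(\<integral>\<^sup>+z. \<integral>\<^sup>+u. ennreal (mehler \<rho> z u powr (1 + a)) \<partial>gauss 0 1 \<partial>gauss 0 1) =
    ennreal ((1 - \<rho>\<^sup>2) powr (- a / 2) / sqrt (1 - a\<^sup>2 * \<rho>\<^sup>2))"
proof -
  define v where "v = 1 - \<rho>\<^sup>2"
  have v: "0 < v" and r: "\<rho>\<^sup>2 = 1 - v" using \<rho>_sq by (auto simp: v_def)
  have v1: "v \<le> 1" by (simp add: v_def)
  define \<kappa> where "\<kappa> = (1 + a) / (2 * v)"
  have \<kappa>: "0 < \<kappa>" "2 * \<kappa> * v = 1 + a" using a v by (auto simp: \<kappa>_def)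
  define c where "c = v powr (- (1 / 2) * (1 + a))"
  have c: "0 < c" using v by (simp add: c_def)
  define A where "A = \<kappa> * \<rho>\<^sup>2"
  have A: "0 \<le> A" using \<kappa> by (simp add: A_def)
  \<comment> \<open>The coefficient of \<open>- z^2\<close> that remains after integrating out
    \<open>u\<close>.\<close>
  define A' where "A' = A - (2 * \<kappa> * \<rho>)\<^sup>2 / (2 * (1 + 2 * A))"
  have pw: "mehler \<rho> z u powr (1 + a) = c * exp (- A * z\<^sup>2) * exp (- A * u\<^sup>2 + (2 * \<kappa> * \<rho> * z) * u)" for z u
  proof -
    define e where "e = - (\<rho>\<^sup>2 * z\<^sup>2 - 2 * \<rho> * z * u + \<rho>\<^sup>2 * u\<^sup>2) / (2 * v)"
    have "v powr (- (1 / 2)) = 1 / sqrt v"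
      using v unfolding powr_minus powr_half_sqrt[OF less_imp_le[OF v]] by (simp add: divide_inverse)
    then have "mehler \<rho> z u = v powr (- (1 / 2)) * exp e"
      unfolding mehler_def v_def[symmetric] e_def[symmetric] by simp
    then have "mehler \<rho> z u powr (1 + a) = (v powr (- (1 / 2))) powr (1 + a) * exp e powr (1 + a)"
      using v by (simp only: powr_mult)
    also have "(v powr (- (1 / 2))) powr (1 + a) = c"
      unfolding powr_powr c_def ..
    also have "exp e powr (1 + a) = exp ((1 + a) * e)" by (simp add: powr_def)
    also have "(1 + a) * e = - \<kappa> * (\<rho>\<^sup>2 * z\<^sup>2 - 2 * \<rho> * z * u + \<rho>\<^sup>2 * u\<^sup>2)"
    proof -
      have "x * (- q / y) = - (x / y) * q" for x y q :: real by simp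
      then show ?thesis unfolding e_def \<kappa>_def .
    qed
    also have "\<dots> = - A * z\<^sup>2 + (- A * u\<^sup>2 + (2 * \<kappa> * \<rho> * z) * u)"
      unfolding A_def by (simp add: algebra_simps)
    finally show ?thesis by (simp only: exp_add mult.assoc)
  qed
  \<comment> \<open>The product is the determinant
    \<open>(1 + 2 * A)^2 - (2 * \<kappa> * \<rho>)^2\<close> of the quadratic form in both
    variables.\<close>
  have A': "(1 + 2 * A) * (1 + 2 * A') = (1 - a\<^sup>2 * \<rho>\<^sup>2) / v"
  proof -
    have A2: "(1 + 2 * A) * v = 1 + a * \<rho>\<^sup>2"
    proof -
      have "(1 + 2 * A) * v = v + (2 * \<kappa> * v) * \<rho>\<^sup>2" by (simp add: A_def algebra_simps)
      then show ?thesis unfolding \<kappa>(2) r by (simp add: algebra_simps)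
    qed
    have "(1 + 2 * A) * (1 + 2 * A') = (1 + 2 * A)\<^sup>2 - (2 * \<kappa> * \<rho>)\<^sup>2"
    proof -
      have *: "w * (w - X / w) = w\<^sup>2 - X" if "w \<noteq> 0" for w X :: real
        using that by (simp add: right_diff_distrib power2_eq_square)
      have "1 + 2 * (x - X / (2 * w)) = (1 + 2 * x) - X / w" for x X w :: real by simp
      then have "1 + 2 * A' = (1 + 2 * A) - (2 * \<kappa> * \<rho>)\<^sup>2 / (1 + 2 * A)"
        unfolding A'_def .
      moreover have "(1 + 2 * A) * ((1 + 2 * A) - (2 * \<kappa> * \<rho>)\<^sup>2 / (1 + 2 * A)) = (1 + 2 * A)\<^sup>2 - (2 * \<kappa> * \<rho>)\<^sup>2"
        using A by (intro *) simp
      ultimately show ?thesis by (simp only:)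
    qed
    moreover have "(w\<^sup>2 - (2 * \<kappa> * \<rho>)\<^sup>2) * v\<^sup>2 = (w * v)\<^sup>2 - (2 * \<kappa> * v)\<^sup>2 * \<rho>\<^sup>2" for w
      by (simp add: power_mult_distrib left_diff_distrib)
    ultimately have "(1 + 2 * A) * (1 + 2 * A') * v\<^sup>2 = ((1 + 2 * A) * v)\<^sup>2 - (2 * \<kappa> * v)\<^sup>2 * \<rho>\<^sup>2"
      by (simp only:)
    also have "\<dots> = (1 - a\<^sup>2 * \<rho>\<^sup>2) * (1 - \<rho>\<^sup>2)"
      unfolding A2 \<kappa>(2) by (simp add: power2_eq_square algebra_simps)
    also have "1 - \<rho>\<^sup>2 = v" by (simp add: v_def)
    finally have "(1 + 2 * A) * (1 + 2 * A') * v\<^sup>2 = (1 - a\<^sup>2 * \<rho>\<^sup>2) * v" .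
    moreover have "x = y / v" if "x * v\<^sup>2 = y * v" for x y
      using that v by (simp add: field_simps power2_eq_square)
    ultimately show ?thesis by blast
  qed
  have "a\<^sup>2 * \<rho>\<^sup>2 < 1"
    using a \<rho>_sq(2) mult_strict_mono[of "a\<^sup>2" 1 "\<rho>\<^sup>2" 1] by (simp add: abs_square_less_1)
  then have pos: "0 < (1 + 2 * A) * (1 + 2 * A')" unfolding A' using v by simp
  then have A'_pos: "0 < 1 + 2 * A'" using A by (simp add: zero_less_mult_iff)
  have A_pos: "0 < 1 + 2 * A" using A by simp
  have inner: "(\<integral>\<^sup>+u. ennreal (mehler \<rho> z u powr (1 + a)) \<partial>gauss 0 1) =
    ennreal (c / sqrt (1 + 2 * A)) * ennreal (exp (- A' * z\<^sup>2 + 0 * z))" for z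
  proof -
    have "(\<integral>\<^sup>+u. ennreal (mehler \<rho> z u powr (1 + a)) \<partial>gauss 0 1) =
      (\<integral>\<^sup>+u. ennreal (c * exp (- A * z\<^sup>2)) * ennreal (exp (- A * u\<^sup>2 + (2 * \<kappa> * \<rho> * z) * u)) \<partial>gauss 0 1)"
      unfolding pw using c by (simp add: ennreal_mult'[symmetric])
    also have "\<dots> = ennreal (c * exp (- A * z\<^sup>2)) *
        ennreal (exp ((2 * \<kappa> * \<rho> * z)\<^sup>2 / (2 * (1 + 2 * A))) / sqrt (1 + 2 * A))"
      by (subst nn_integral_cmult) (simp_all only: nn_integral_gauss_exp_quadratic[OF A_pos], measurable)
    also have "\<dots> = ennreal (c * exp (- A * z\<^sup>2) * (exp ((2 * \<kappa> * \<rho> * z)\<^sup>2 / (2 * (1 + 2 * A))) / sqrt (1 + 2 * A)))"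
      using c by (intro ennreal_mult'[symmetric]) simp
    also have "c * exp (- A * z\<^sup>2) * (exp ((2 * \<kappa> * \<rho> * z)\<^sup>2 / (2 * (1 + 2 * A))) / sqrt (1 + 2 * A)) =
        c / sqrt (1 + 2 * A) * (exp (- A * z\<^sup>2) * exp ((2 * \<kappa> * \<rho> * z)\<^sup>2 / (2 * (1 + 2 * A))))"
      by simp
    also have "exp (- A * z\<^sup>2) * exp ((2 * \<kappa> * \<rho> * z)\<^sup>2 / (2 * (1 + 2 * A))) = exp (- A' * z\<^sup>2 + 0 * z)"
      unfolding exp_add[symmetric] by (simp add: A'_def power_mult_distrib left_diff_distrib)
    also have "ennreal (c / sqrt (1 + 2 * A) * exp (- A' * z\<^sup>2 + 0 * z)) =
      ennreal (c / sqrt (1 + 2 * A)) * ennreal (exp (- A' * z\<^sup>2 + 0 * z))"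
      using c A_pos by (intro ennreal_mult) auto
    finally show ?thesis .
  qed
  have "(\<integral>\<^sup>+z. \<integral>\<^sup>+u. ennreal (mehler \<rho> z u powr (1 + a)) \<partial>gauss 0 1 \<partial>gauss 0 1) =
    ennreal (c / sqrt (1 + 2 * A)) * ennreal (exp (0\<^sup>2 / (2 * (1 + 2 * A'))) / sqrt (1 + 2 * A'))"
    unfolding inner
    by (subst nn_integral_cmult) (simp_all only: nn_integral_gauss_exp_quadratic[OF A'_pos], measurable)
  also have "\<dots> = ennreal (c / sqrt ((1 + 2 * A) * (1 + 2 * A')))"
    using c A_pos A'_pos by (simp add: ennreal_mult'[symmetric] real_sqrt_mult)
  also have "c / sqrt ((1 + 2 * A) * (1 + 2 * A')) = c * sqrt v / sqrt (1 - a\<^sup>2 * \<rho>\<^sup>2)"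
    unfolding A' by (simp add: real_sqrt_divide)
  also have "c * sqrt v = v powr (- a / 2)"
  proof -
    have "- (1 / 2) * (1 + a) + 1 / 2 = - a / 2" by (simp add: field_simps)
    then show ?thesis
      unfolding c_def powr_half_sqrt[OF less_imp_le[OF v], symmetric] powr_add[symmetric] by (simp only:)
  qed
  finally show ?thesis by (simp add: v_def)
qed

end

context correlation begin

lemma kernel_mehler:
  assumes s: "0 < s"
  shows "kernel mu s (\<lambda>x u. mehler \<rho> ((x - mu) / s) u)"
proof
  show "(\<integral>\<^sup>+x. ennreal (mehler \<rho> ((x - mu) / s) u) \<partial>gauss mu s) = 1" for u
    using s by (subst nn_integral_gauss) (auto simp: mehler_one)
  show "(\<integral>\<^sup>+u. ennreal (mehler \<rho> ((x - mu) / s) u) \<partial>gauss 0 1) = 1" for x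
    by (subst mehler_commute) (rule mehler_one)
qed (use s mehler_nonneg in auto)

text \<open>Dropping \<open>\<rho>^2 \<le> 1\<close> from the second factor gives one constant valid
  for both correlations.\<close>

lemma kernel_mehler_powr:
  assumes s: "0 < s" and a: "0 < a" "a < 1" and r: "1 - \<rho>\<^sup>2 = exp (- 2 * r)"
  shows "(\<integral>\<^sup>+x. \<integral>\<^sup>+u. ennreal (mehler \<rho> ((x - mu) / s) u powr (1 + a)) \<partial>gauss 0 1 \<partial>gauss mu s)
    \<le> ennreal (exp (a * r) / sqrt (1 - a\<^sup>2))"
proof -
  interpret u: prob_space "gauss 0 1" by (rule prob_space_gauss) simp
  have "(\<integral>\<^sup>+x. \<integral>\<^sup>+u. ennreal (mehler \<rho> ((x - mu) / s) u powr (1 + a)) \<partial>gauss 0 1 \<partial>gauss mu s) =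
    ennreal ((1 - \<rho>\<^sup>2) powr (- a / 2) / sqrt (1 - a\<^sup>2 * \<rho>\<^sup>2))"
    using s by (subst nn_integral_gauss) (simp_all add: mehler_powr[OF a])
  also have "(1 - \<rho>\<^sup>2) powr (- a / 2) = exp (a * r)"
    unfolding r by (simp add: powr_def)
  also have "exp (a * r) / sqrt (1 - a\<^sup>2 * \<rho>\<^sup>2) \<le> exp (a * r) / sqrt (1 - a\<^sup>2)"
  proof -
    have "a\<^sup>2 < 1" using a by (simp add: abs_square_less_1)
    moreover have "a\<^sup>2 * \<rho>\<^sup>2 \<le> a\<^sup>2 * 1" using \<rho>_sq by (intro mult_left_mono) auto
    ultimately show ?thesis by (intro divide_left_mono real_sqrt_le_mono mult_pos_pos) auto
  qed
  finally show ?thesis by (simp add: ennreal_leI)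
qed

end

lemma test_channel_mehler:
  assumes s: "0 < s" and \<sigma>: "0 < \<sigma>" and "correlation \<rho>1" "correlation \<rho>2"
  shows "test_channel mu s \<sigma> (\<lambda>x u. mehler \<rho>1 ((x - mu) / s) u) (\<lambda>y u. mehler \<rho>2 ((y - mu) / \<sigma>) u)
    (s\<^sup>2 + \<sigma>\<^sup>2 - 2 * s * \<sigma> * (\<rho>1 * \<rho>2))"
proof -
  interpret c1: correlation \<rho>1 by fact
  interpret c2: correlation \<rho>2 by fact
  interpret X: kernel mu s "\<lambda>x u. mehler \<rho>1 ((x - mu) / s) u" by (rule c1.kernel_mehler[OF s])
  interpret Y: kernel mu \<sigma> "\<lambda>x u. mehler \<rho>2 ((x - mu) / \<sigma>) u" by (rule c2.kernel_mehler[OF \<sigma>])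
  let ?v1 = "sqrt (1 - \<rho>1\<^sup>2)" and ?v2 = "sqrt (1 - \<rho>2\<^sup>2)"
  have v: "0 < ?v1" "0 < ?v2" using c1.\<rho>_sq c2.\<rho>_sq by auto
  have v2: "?v1\<^sup>2 = 1 - \<rho>1\<^sup>2" "?v2\<^sup>2 = 1 - \<rho>2\<^sup>2" using c1.\<rho>_sq c2.\<rho>_sq by auto
  interpret s: prob_space "gauss mu \<sigma>" by (rule prob_space_gauss[OF \<sigma>])
  let ?e = "\<lambda>x u. ennreal ((x - mu - \<sigma> * (\<rho>2 * u))\<^sup>2 + \<sigma>\<^sup>2 * ?v2\<^sup>2)"
  define \<Delta> where "\<Delta> = s\<^sup>2 + \<sigma>\<^sup>2 - 2 * s * \<sigma> * (\<rho>1 * \<rho>2)"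
  \<comment> \<open>Given \<open>u\<close>, the two conditional means differ by
    \<open>(s * \<rho>1 - \<sigma> * \<rho>2) * u\<close> and the conditional variances add.\<close>
  have \<Delta>: "\<Delta> = (s * \<rho>1 - \<sigma> * \<rho>2)\<^sup>2 + (s\<^sup>2 * ?v1\<^sup>2 + \<sigma>\<^sup>2 * ?v2\<^sup>2)"
    unfolding v2 by (simp add: \<Delta>_def power2_eq_square algebra_simps)
  have 1: "(\<integral>\<^sup>+y. ennreal ((x - y)\<^sup>2) * ennreal (mehler \<rho>2 ((y - mu) / \<sigma>) u) \<partial>gauss mu \<sigma>) =
      ?e x u" for x u
  proof -
    have "(\<integral>\<^sup>+y. ennreal ((x - y)\<^sup>2) * ennreal (mehler \<rho>2 ((y - mu) / \<sigma>) u) \<partial>gauss mu \<sigma>) =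
      (\<integral>\<^sup>+w. ennreal (mehler \<rho>2 w u) * ennreal ((x - mu + - \<sigma> * w)\<^sup>2 + 0) \<partial>gauss 0 1)"
      using \<sigma> by (subst nn_integral_gauss) (auto simp: mult.commute algebra_simps intro!: nn_integral_cong)
    also have "\<dots> = (\<integral>\<^sup>+w. ennreal ((x - mu + - \<sigma> * w)\<^sup>2 + 0) \<partial>gauss (\<rho>2 * u) ?v2)"
      by (rule c2.nn_integral_mehler) measurable
    also have "\<dots> = ennreal ((x - mu + - \<sigma> * (\<rho>2 * u))\<^sup>2 + (- \<sigma>)\<^sup>2 * ?v2\<^sup>2 + 0)"
      using v by (intro nn_integral_gauss_square) auto
    finally show ?thesis by simp
  qed
  have 2: "(\<integral>\<^sup>+x. ennreal (mehler \<rho>1 ((x - mu) / s) u) * ?e x u \<partial>gauss mu s) =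
      ennreal ((0 + (s * \<rho>1 - \<sigma> * \<rho>2) * u)\<^sup>2 + (s\<^sup>2 * ?v1\<^sup>2 + \<sigma>\<^sup>2 * ?v2\<^sup>2))" for u
  proof -
    let ?f = "\<lambda>z. ennreal ((- \<sigma> * (\<rho>2 * u) + s * z)\<^sup>2 + \<sigma>\<^sup>2 * ?v2\<^sup>2)"
    have "(\<integral>\<^sup>+x. ennreal (mehler \<rho>1 ((x - mu) / s) u) * ?e x u \<partial>gauss mu s) =
      (\<integral>\<^sup>+z. ennreal (mehler \<rho>1 z u) * ?f z \<partial>gauss 0 1)"
    proof (subst nn_integral_gauss[OF s])
      show "(\<lambda>x. ennreal (mehler \<rho>1 ((x - mu) / s) u) * ?e x u) \<in> borel_measurable borel"
        by measurable
      have "mu + s * z - mu - \<sigma> * (\<rho>2 * u) = - \<sigma> * (\<rho>2 * u) + s * z" "(mu + s * z - mu) / s = z" for z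
        using s by auto
      then show "(\<integral>\<^sup>+z. ennreal (mehler \<rho>1 ((mu + s * z - mu) / s) u) *
          ennreal ((mu + s * z - mu - \<sigma> * (\<rho>2 * u))\<^sup>2 + \<sigma>\<^sup>2 * ?v2\<^sup>2) \<partial>gauss 0 1) =
        (\<integral>\<^sup>+z. ennreal (mehler \<rho>1 z u) * ?f z \<partial>gauss 0 1)"
        by (simp only:)
    qed
    also have "\<dots> = (\<integral>\<^sup>+z. ?f z \<partial>gauss (\<rho>1 * u) ?v1)"
      by (rule c1.nn_integral_mehler) measurable
    also have "\<dots> = ennreal ((- \<sigma> * (\<rho>2 * u) + s * (\<rho>1 * u))\<^sup>2 + s\<^sup>2 * ?v1\<^sup>2 + \<sigma>\<^sup>2 * ?v2\<^sup>2)"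
      using v by (intro nn_integral_gauss_square) auto
    also have "- \<sigma> * (\<rho>2 * u) + s * (\<rho>1 * u) = 0 + (s * \<rho>1 - \<sigma> * \<rho>2) * u"
      by (simp add: algebra_simps)
    finally show ?thesis by (simp only: add.assoc)
  qed
  have "(\<integral>\<^sup>+u. ennreal ((0 + (s * \<rho>1 - \<sigma> * \<rho>2) * u)\<^sup>2 + (s\<^sup>2 * ?v1\<^sup>2 + \<sigma>\<^sup>2 * ?v2\<^sup>2)) \<partial>gauss 0 1) = ennreal \<Delta>"
    by (subst nn_integral_gauss_square) (simp_all add: \<Delta> del: ennreal_plus real_sqrt_pow2_iff real_sqrt_pow2)
  then show ?thesis
    unfolding \<Delta>_def[symmetric]
    by unfold_locales (simp_all only: 1 2 \<Delta>, simp_all del: ennreal_plus real_sqrt_pow2_iff real_sqrt_pow2)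
qed

section \<open>The rate-distortion-perception bounds\<close>

text \<open>With \<open>a = \<gamma> / 2\<close> the gain is \<open>exp (- 2 * a^2)\<close>, while
  the loss \<open>1 / sqrt (1 - a^2)\<close> is about \<open>exp (a^2 / 2)\<close>;
  \<open>a \<le> 1 / 2\<close> makes the comparison rigorous.\<close>

lemma rate_gap_constant:
  assumes \<gamma>: "0 < \<gamma>" "\<gamma> \<le> 1"
  defines "a \<equiv> \<gamma> / 2"
  shows "exp (- (a * \<gamma>)) / sqrt (1 - a\<^sup>2) < 1"
proof -
  have a: "0 < a" "a \<le> 1 / 2" using \<gamma> by (auto simp: a_def)
  have a1: "0 < 1 - a\<^sup>2" using a by (simp add: abs_square_less_1)
  have "a\<^sup>2 \<le> (1 / 2)\<^sup>2" using a by (intro power_mono) auto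
  then have "0 < a\<^sup>2 * (3 - 4 * a\<^sup>2)" using a by (intro mult_pos_pos) (auto simp: power2_eq_square)
  then have "1 < (1 + 4 * a\<^sup>2) * (1 - a\<^sup>2)" by (simp add: algebra_simps)
  also have "\<dots> \<le> exp (4 * a\<^sup>2) * (1 - a\<^sup>2)"
    using a1 exp_ge_add_one_self by (intro mult_right_mono) auto
  also have "4 * a\<^sup>2 = 2 * (a * \<gamma>)" by (simp add: a_def power2_eq_square)
  finally have "1 < exp (2 * (a * \<gamma>)) * (1 - a\<^sup>2)" .
  then have "sqrt 1 < sqrt ((exp (a * \<gamma>))\<^sup>2 * (1 - a\<^sup>2))"
    unfolding exp_double by (rule real_sqrt_less_mono)
  then have "1 < exp (a * \<gamma>) * sqrt (1 - a\<^sup>2)" by (simp add: real_sqrt_mult)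
  then show ?thesis using a1 by (simp add: exp_minus field_simps)
qed

lemma achievable_below_rate:
  assumes s: "0 < s" and \<sigma>: "0 < \<sigma>" "psi s \<sigma> \<le> P" and r: "0 < r" "r < R" and Rc: "0 \<le> Rc"
    and D: "s\<^sup>2 + \<sigma>\<^sup>2 - 2 * s * \<sigma> * xi r Rc < D"
  shows "achievable mu s R Rc P D"
proof -
  define \<rho>1 where "\<rho>1 = sqrt (1 - exp (- 2 * r))"
  define \<rho>2 where "\<rho>2 = sqrt (1 - exp (- 2 * (r + Rc)))"
  have e: "0 < exp (- 2 * r)" "exp (- 2 * r) < 1" "0 < exp (- 2 * (r + Rc))" "exp (- 2 * (r + Rc)) < 1"
    using r Rc by auto
  have \<rho>: "1 - \<rho>1\<^sup>2 = exp (- 2 * r)" "1 - \<rho>2\<^sup>2 = exp (- 2 * (r + Rc))"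
    unfolding \<rho>1_def \<rho>2_def using e by simp_all
  have xi: "xi r Rc = \<rho>1 * \<rho>2"
    by (simp add: xi_def \<rho>1_def \<rho>2_def real_sqrt_mult)
  interpret c1: correlation \<rho>1
    by unfold_locales (use e in \<open>simp_all add: \<rho>1_def\<close>)
  interpret c2: correlation \<rho>2
    by unfold_locales (use e in \<open>simp_all add: \<rho>2_def\<close>)
  define \<Delta> where "\<Delta> = s\<^sup>2 + \<sigma>\<^sup>2 - 2 * s * \<sigma> * (\<rho>1 * \<rho>2)"
  interpret T: test_channel mu s \<sigma> "\<lambda>x u. mehler \<rho>1 ((x - mu) / s) u" "\<lambda>y u. mehler \<rho>2 ((y - mu) / \<sigma>) u" \<Delta>
    unfolding \<Delta>_def by (rule test_channel_mehler[OF s \<sigma>(1) c1.correlation_axioms c2.correlation_axioms])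
  have \<Delta>D: "\<Delta> < D" using D by (simp add: \<Delta>_def xi)
  \<comment> \<open>The gap between \<open>r\<close> and \<open>R\<close> is cut so that
    \<open>r' = r + 2 * \<gamma>\<close> stays below \<open>R\<close>, with the covering thresholds
    at distance \<open>\<gamma>\<close> from both ends. The cap at 1 is for
    \<open>rate_gap_constant\<close>.\<close>
  define \<gamma> where "\<gamma> = min 1 ((R - r) / 4)"
  have \<gamma>: "0 < \<gamma>" "\<gamma> \<le> 1" "\<gamma> \<le> (R - r) / 4"
    unfolding \<gamma>_def using r min.cobounded2[of 1 "(R - r) / 4"] by simp_all
  define r' where "r' = r + 2 * \<gamma>"
  have r': "0 < r'" "r' < R" using r \<gamma> by (auto simp: r'_def)
  define a where "a = \<gamma> / 2"
  have a: "0 < a" "a < 1" using \<gamma> by (auto simp: a_def)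
  define \<kappa> where "\<kappa> = 1 / sqrt (1 - a\<^sup>2)"
  have \<kappa>: "0 < \<kappa>" using a by (simp add: \<kappa>_def abs_square_less_1)
  define \<theta> where "\<theta> = exp (- (a * \<gamma>)) * \<kappa>"
  have \<theta>: "0 < \<theta>" "\<theta> < 1"
    using rate_gap_constant[OF \<gamma>(1,2)] \<kappa> by (simp_all add: \<theta>_def a_def \<kappa>_def)
  define C where "C = s ^ 4 + \<sigma> ^ 4"
  have C: "0 < C" using s \<sigma> by (simp add: C_def add_pos_pos)
  \<comment> \<open>Lets the fourth-moment term use half of the slack \<open>D - \<Delta>\<close>;
    the other half is for \<open>4 * K * \<epsilon>\<close>.\<close>
  define K where "K = 12 * C / (D - \<Delta>)"
  have K: "0 < K" "6 * C / K = (D - \<Delta>) / 2" using C \<Delta>D by (auto simp: K_def)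
  have "(\<lambda>n. 3 * exp (- \<gamma> / 2) ^ n + 2 * \<theta> ^ n) \<longlonglongrightarrow> 3 * 0 + 2 * 0"
    using \<gamma> \<theta> by (intro tendsto_intros LIMSEQ_power_zero) auto
  then have "\<forall>\<^sub>F n in sequentially. 3 * exp (- \<gamma> / 2) ^ n + 2 * \<theta> ^ n < (D - \<Delta>) / (8 * K)"
    using K \<Delta>D by (intro order_tendstoD(2)) auto
  moreover have "\<forall>\<^sub>F n in sequentially. 2 / (R - r') \<le> real n"
    by (rule eventually_sequentiallyI[of "nat \<lceil>2 / (R - r')\<rceil>"]) linarith
  moreover have "\<forall>\<^sub>F n in sequentially. 1 \<le> n" by (rule eventually_ge_at_top)
  ultimately obtain n where n: "3 * exp (- \<gamma> / 2) ^ n + 2 * \<theta> ^ n < (D - \<Delta>) / (8 * K)"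
    "2 / (R - r') \<le> real n" "1 \<le> n"
    using eventually_happens'[OF sequentially_bot eventually_conj[OF _ eventually_conj]] by blast
  have n2: "2 \<le> n * (R - r')" using n(2) r' by (simp add: field_simps)
  \<comment> \<open>One message is reserved for encoder failures, hence the subtraction.\<close>
  define M where "M = nat \<lfloor>exp (n * R)\<rfloor> - 1"
  define L where "L = nat \<lfloor>exp (n * Rc)\<rfloor>"
  \<comment> \<open>The summand 2 pays for rounding down and for the reserved message; it is
    available since \<open>n * (R - r') \<ge> 2\<close>.\<close>
  have M_ge: "exp (n * r') \<le> real M"
  proof -
    have "exp (n * r') + 2 \<le> exp (n * r') * (1 + n * (R - r'))"
    proof -
      have "1 * 2 \<le> exp (n * r') * (n * (R - r'))" using n2 r' by (intro mult_mono) auto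
      then show ?thesis by (simp add: algebra_simps)
    qed
    also have "\<dots> \<le> exp (n * r') * exp (n * (R - r'))"
      by (intro mult_left_mono exp_ge_add_one_self) auto
    also have "\<dots> = exp (n * R)" unfolding exp_add[symmetric] by (simp add: algebra_simps)
    finally show ?thesis unfolding M_def using exp_gt_zero[of "n * r'"] by linarith
  qed
  have M: "0 < M" using M_ge exp_gt_zero[of "n * r'"] by (cases M) auto
  have SucM: "real (Suc M) \<le> exp (n * R)"
    using M unfolding M_def by linarith
  have eRc: "1 \<le> exp (n * Rc)" using Rc by simp
  have L: "0 < L" "real L \<le> exp (n * Rc)" "exp (n * Rc) / 2 \<le> real L"
  proof -
    have "1 \<le> \<lfloor>exp (n * Rc)\<rfloor>" using eRc by (simp only: one_le_floor)
    moreover from this have "real L = of_int \<lfloor>exp (n * Rc)\<rfloor>" by (simp add: L_def)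
    moreover have "exp (n * Rc) < of_int \<lfloor>exp (n * Rc)\<rfloor> + 1" "of_int \<lfloor>exp (n * Rc)\<rfloor> \<le> exp (n * Rc)"
      by linarith+
    moreover from \<open>1 \<le> \<lfloor>exp (n * Rc)\<rfloor>\<close> have "(1 :: real) \<le> of_int \<lfloor>exp (n * Rc)\<rfloor>" by simp
    ultimately show "0 < L" "real L \<le> exp (n * Rc)" "exp (n * Rc) / 2 \<le> real L" by linarith+
  qed
  have rate: "ln (real (Suc M)) / real n \<le> R"
    using SucM n(3) ln_mono[of "real (Suc M)" "exp (n * R)"] by (simp add: field_simps del: of_nat_Suc)
  have rate_c: "ln (real L) / real n \<le> Rc"
    using L n(3) ln_mono[of "real L" "exp (n * Rc)"] by (simp add: field_simps)
  \<comment> \<open>Thresholds halfway between the information \<open>r\<close> and the codebook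
    rate: the variance terms decay like \<open>exp (- \<gamma> / 2) ^ n\<close>, the tails like
    \<open>\<theta> ^ n\<close>.\<close>
  define T1 where "T1 = exp (n * (r + \<gamma>))"
  define T2 where "T2 = exp (n * (r + Rc + \<gamma>))"
  have gn: "exp (- \<gamma> / 2) ^ n = exp (- (n * \<gamma>) / 2)"
    by (simp add: exp_of_nat_mult[symmetric])
  have sqrt_exp: "sqrt (exp (- (n * \<gamma>))) = exp (- \<gamma> / 2) ^ n"
    unfolding gn by (rule real_sqrt_unique) (simp_all add: exp_double[symmetric])
  have tail: "exp (n * (q + \<gamma>)) powr (- a) * (exp (a * q) * \<kappa>) ^ n = \<theta> ^ n" for q
  proof -
    have "exp (n * (q + \<gamma>)) powr (- a) = exp (- (a * (q + \<gamma>))) ^ n"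
      by (simp add: powr_def exp_of_nat_mult[symmetric] algebra_simps)
    then have "exp (n * (q + \<gamma>)) powr (- a) * (exp (a * q) * \<kappa>) ^ n =
        ((exp (- (a * (q + \<gamma>))) * exp (a * q)) * \<kappa>) ^ n"
      by (simp add: power_mult_distrib)
    also have "exp (- (a * (q + \<gamma>))) * exp (a * q) = exp (- (a * \<gamma>))"
      unfolding exp_add[symmetric] by (simp add: algebra_simps)
    finally show ?thesis by (simp add: \<theta>_def)
  qed
  have cover1: "sqrt (T1 / M) \<le> exp (- \<gamma> / 2) ^ n"
  proof -
    have "T1 / M \<le> T1 / exp (n * r')"
      using M_ge M by (intro divide_left_mono) (auto simp: T1_def)
    also have "\<dots> = exp (- (n * \<gamma>))"
      by (simp add: T1_def exp_diff[symmetric] r'_def algebra_simps)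
    finally show ?thesis unfolding sqrt_exp[symmetric] by (rule real_sqrt_le_mono)
  qed
  \<comment> \<open>The factor 2 absorbs the loss in \<open>exp (n * Rc) / 2 \<le> L\<close> from
    rounding.\<close>
  have cover2: "sqrt (T2 / (L * M)) \<le> 2 * exp (- \<gamma> / 2) ^ n"
  proof -
    have "exp (n * Rc) / 2 * exp (n * r') \<le> L * M"
      unfolding of_nat_mult using L M_ge by (intro mult_mono) auto
    then have "T2 / (L * M) \<le> T2 / (exp (n * Rc) / 2 * exp (n * r'))"
      using L M by (intro divide_left_mono mult_pos_pos) (auto simp: T2_def)
    also have "\<dots> = 2 * exp (n * (r + Rc + \<gamma>) - (n * Rc + n * r'))"
      by (simp add: T2_def exp_diff exp_add)
    also have "n * (r + Rc + \<gamma>) - (n * Rc + n * r') = - (n * \<gamma>)"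
      by (simp add: r'_def algebra_simps)
    also have "2 * exp (- (n * \<gamma>)) \<le> 2\<^sup>2 * exp (- (n * \<gamma>))" by simp
    finally have "sqrt (T2 / (L * M)) \<le> sqrt (2\<^sup>2 * exp (- (n * \<gamma>)))" by (rule real_sqrt_le_mono)
    also have "\<dots> = 2 * exp (- \<gamma> / 2) ^ n" by (simp only: real_sqrt_mult sqrt_exp real_sqrt_abs abs_numeral)
    finally show ?thesis .
  qed
  define \<epsilon> where "\<epsilon> = (sqrt (T1 / M) + T1 powr (- a) * (exp (a * r) * \<kappa>) ^ n)
    + (sqrt (T2 / (L * M)) + T2 powr (- a) * (exp (a * (r + Rc)) * \<kappa>) ^ n)"
  have "\<epsilon> \<le> 3 * exp (- \<gamma> / 2) ^ n + 2 * \<theta> ^ n"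
    unfolding \<epsilon>_def T1_def[unfolded T1_def] using cover1 cover2 tail[of r] tail[of "r + Rc"]
    by (simp add: T1_def T2_def)
  then have "\<epsilon> < (D - \<Delta>) / (8 * K)" using n(1) by simp
  then have "4 * K * \<epsilon> < (D - \<Delta>) / 2" using K by (simp add: field_simps)
  then have bound: "\<Delta> + 4 * K * \<epsilon> + 6 * (s ^ 4 + \<sigma> ^ 4) / K < D"
    using K(2) unfolding C_def[symmetric] by (simp add: field_simps)
  show ?thesis
  proof (rule T.random_coding)
    show "(\<integral>\<^sup>+x. \<integral>\<^sup>+u. ennreal (mehler \<rho>1 ((x - mu) / s) u powr (1 + a)) \<partial>gauss 0 1 \<partial>gauss mu s) \<le> ennreal (exp (a * r) * \<kappa>)"
      using c1.kernel_mehler_powr[OF s a \<rho>(1)] by (simp add: \<kappa>_def)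
    show "(\<integral>\<^sup>+x. \<integral>\<^sup>+u. ennreal (mehler \<rho>2 ((x - mu) / \<sigma>) u powr (1 + a)) \<partial>gauss 0 1 \<partial>gauss mu \<sigma>) \<le> ennreal (exp (a * (r + Rc)) * \<kappa>)"
      using c2.kernel_mehler_powr[OF \<sigma>(1) a \<rho>(2)] by (simp add: \<kappa>_def)
    show "\<Delta> + 4 * K * ((sqrt (T1 / M) + T1 powr (- a) * (exp (a * r) * \<kappa>) ^ n)
      + (sqrt (T2 / (L * M)) + T2 powr (- a) * (exp (a * (r + Rc)) * \<kappa>) ^ n)) + 6 * (s ^ 4 + \<sigma> ^ 4) / K < D"
      using bound unfolding \<epsilon>_def .
  qed (use rate rate_c \<sigma> n(3) M L(1) K(1) a \<kappa> in \<open>auto simp: T1_def T2_def\<close>)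
qed

text \<open>The strict inequality for \<open>D\<close> persists for rates slightly below
  \<open>R\<close>, because \<open>xi\<close> is continuous in the rate.\<close>

lemma achievable_gauss:
  assumes s: "0 < s" and \<sigma>: "0 < \<sigma>" "psi s \<sigma> \<le> P" and R: "0 \<le> R" "0 \<le> Rc"
    and D: "s\<^sup>2 + \<sigma>\<^sup>2 - 2 * s * \<sigma> * xi R Rc < D"
  shows "achievable mu s R Rc P D"
proof (cases "R = 0")
  case True
  then show ?thesis
    using achievable_rate_zero[OF s R \<sigma>, of D] D by (simp add: xi_def)
next
  case False
  then have R0: "0 < R" using R by simp
  have "isCont (\<lambda>r. s\<^sup>2 + \<sigma>\<^sup>2 - 2 * s * \<sigma> * xi r Rc) R"
    unfolding xi_def by (intro continuous_intros)
  then have "((\<lambda>r. s\<^sup>2 + \<sigma>\<^sup>2 - 2 * s * \<sigma> * xi r Rc) \<longlongrightarrow> s\<^sup>2 + \<sigma>\<^sup>2 - 2 * s * \<sigma> * xi R Rc) (at_left R)"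
    unfolding isCont_def by (rule filterlim_mono[OF _ order_refl at_le]) simp
  then have "\<forall>\<^sub>F r in at_left R. s\<^sup>2 + \<sigma>\<^sup>2 - 2 * s * \<sigma> * xi r Rc < D"
    using D by (rule order_tendstoD(2))
  moreover have "\<forall>\<^sub>F r in at_left R. r \<in> {0<..<R}"
    using R0 by (rule eventually_at_left_real)
  ultimately obtain r where "s\<^sup>2 + \<sigma>\<^sup>2 - 2 * s * \<sigma> * xi r Rc < D" "0 < r" "r < R"
    using eventually_happens'[OF trivial_limit_at_left_real eventually_conj] by fastforce
  then show ?thesis by (intro achievable_below_rate[OF s \<sigma> _ _ R(2)])
qed

theorem theorem3:
  fixes mu sX R Rc P :: real
  assumes "0 < sX" and "0 \<le> R" and "0 \<le> Rc" and "0 \<le> P"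
  shows "D_lower R Rc P sX \<le> D_RDP R Rc P mu sX \<and> D_RDP R Rc P mu sX \<le> D_upper R Rc P sX"
proof -
  let ?S = "{D. achievable mu sX R Rc P D}"
  have lower: "D_lower R Rc P sX \<le> D" if "D \<in> ?S" for D
    using D_lower_le_achievable[OF assms] that by simp
  then have bdd: "bdd_below ?S" by (rule bdd_belowI)
  note sig = sigmaP[OF assms(1,4)]
  \<comment> \<open>The quadratic \<open>sX^2 + x^2 - 2 * sX * x * xi R Rc\<close> has its minimum
    at \<open>sX * xi R Rc\<close>; its minimizer over \<open>x \<ge> sigmaP sX P\<close> is this
    maximum, and both cases of \<open>D_upper\<close> are its value there.\<close>
  define \<sigma> where "\<sigma> = max (sigmaP sX P) (sX * xi R Rc)"
  have "(1 - exp (-2 * R)) * (1 - exp (-2 * (R + Rc))) \<le> 1 * 1"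
    using assms by (intro mult_mono) auto
  then have "xi R Rc \<le> 1" by (simp add: xi_def)
  then have \<sigma>: "0 < \<sigma>" "sigmaP sX P \<le> \<sigma>" "\<sigma> \<le> sX"
    using sig assms(1) by (auto simp: \<sigma>_def)
  then have psi: "psi sX \<sigma> \<le> P" using psi_le_iff[OF assms(1,4)] by simp
  have upper: "D_upper R Rc P sX = sX\<^sup>2 + \<sigma>\<^sup>2 - 2 * sX * \<sigma> * xi R Rc"
    by (auto simp: D_upper_def \<sigma>_def max_def power2_eq_square algebra_simps)
  have ach: "D \<in> ?S" if "D_upper R Rc P sX < D" for D
    using achievable_gauss[OF assms(1) \<sigma>(1) psi assms(2,3)] that upper by simp
  have "D_lower R Rc P sX \<le> Inf ?S"
    using lower ach[of "D_upper R Rc P sX + 1"] by (intro cInf_greatest) auto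
  \<comment> \<open>Only levels strictly above \<open>D_upper\<close> are known to be achievable, so
    the infimum is compared by density of the reals.\<close>
  moreover have "Inf ?S \<le> D_upper R Rc P sX"
    by (rule dense_ge) (auto intro!: cInf_lower[OF _ bdd] dest: ach)
  ultimately show ?thesis by (simp add: D_RDP_def)
qed

end
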